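(* Let $(\mathcal{C},\mathbb{E},\mathfrak{s})$ be an extriangulated category with enough projectives and enough injectives, and let $(\mathcal{S},\mathcal{T})$, $(\mathcal{U},\mathcal{V})$ and $(\mathcal{X},\mathcal{Y})$ be cotorsion pairs on $\mathcal{C}$ with $\mathcal{W}=\mathcal{S}\cap\mathcal{T}=\mathcal{U}\cap\mathcal{V}=\mathcal{X}\cap\mathcal{Y}$. Suppose that $\mathcal{X}\cap\mathcal{T}=\mathcal{V}$, $\mathcal{Y}\subseteq\mathcal{T}$, $\Sigma\mathcal{V}\subseteq\mathcal{V}$ and $\Sigma\mathcal{Y}\subseteq\mathcal{Y}$. Then there are two recollements of additive categories $$\mathcal{V}/\mathcal{W}\xrightarrow{\;F\;}\mathcal{T}/\mathcal{W}\xrightarrow{\;G\;}(\mathcal{T}\cap\mathcal{U})/\mathcal{W},\qquad \mathcal{V}/\mathcal{W}\xrightarrow{\;F\;}\mathcal{T}/\mathcal{W}\xrightarrow{\;G'\;}\mathcal{Y}/\mathcal{W},$$ in which $F$ has left adjoint $F_\lambda$ and right adjoint $F_\delta$, $G$ has left adjoint $G_\lambda$ and right adjoint $G_\delta$, $G'$ has left adjoint $G'_\lambda$ and right adjoint $G'_\delta$, and where $F:\mathcal{V}/\mathcal{W}\to\mathcal{T}/\mathcal{W}$, $G_\lambda:(\mathcal{T}\cap\mathcal{U})/\mathcal{W}\to\mathcal{T}/\mathcal{W}$ and $G'_\delta:\mathcal{Y}/\mathcal{W}\to\mathcal{T}/\mathcal{W}$ are the full embeddings (inclusions).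
   Context: Extriangulated categories (Nakaoka–Palu). Let $\mathcal{C}$ be an additive category and $\mathbb{E}:\mathcal{C}^{\rm op}\times\mathcal{C}\to{\rm Ab}$ an additive bifunctor. Elements $\delta\in\mathbb{E}(C,A)$ are called extensions; for $a:A\to A'$ and $c:C'\to C$ write $a_*\delta=\mathbb{E}(C,a)(\delta)$, $c^*\delta=\mathbb{E}(c,A)(\delta)$. A morphism from $\delta\in\mathbb{E}(C,A)$ to $\delta'\in\mathbb{E}(C',A')$ is a pair $(a:A\to A',c:C\to C')$ with $a_*\delta=c^*\delta'$. Two sequences $A\to B\to C$ and $A\to B'\to C$ are equivalent if there is an isomorphism $B\to B'$ compatible with the identities of $A$ and $C$. A realization $\mathfrak{s}$ assigns to each $\delta\in\mathbb{E}(C,A)$ an equivalence class $\mathfrak{s}(\delta)=[A\xrightarrow{x}B\xrightarrow{y}C]$ such that for each morphism $(a,c):\delta\to\delta'$ with $\mathfrak{s}(\delta')=[A'\xrightarrow{x'}B'\xrightarrow{y'}C']$ there is $b:B\to B'$ with $bx=x'a$, $y'b=cy$. It is additive if $\mathfrak{s}(0)=[A\to A\oplus C\to C]$ (canonical maps) and $\mathfrak{s}(\delta\oplus\delta')=\mathfrak{s}(\delta)\oplus\mathfrak{s}(\delta')$. $(\mathcal{C},\mathbb{E},\mathfrak{s})$ is extriangulated if $\mathbb{E}$ is an additive bifunctor, $\mathfrak{s}$ is an additive realization, and: (ET3) if $\delta,\delta'$ are realized by $A\xrightarrow{x}B\xrightarrow{y}C$ and $A'\xrightarrow{x'}B'\xrightarrow{y'}C'$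 and $bx=x'a$, then there is $c:C\to C'$ with $y'b=cy$ and $a_*\delta=c^*\delta'$; (ET3)$^{\rm op}$ the dual; (ET4) if $\delta\in\mathbb{E}(D,A)$ is realized by $A\xrightarrow{f}B\xrightarrow{f'}D$ and $\delta'\in\mathbb{E}(F,B)$ by $B\xrightarrow{g}C\xrightarrow{g'}F$, then there are an object $E$, an extension $\delta''\in\mathbb{E}(E,A)$ realized by $A\xrightarrow{gf}C\xrightarrow{h'}E$, and morphisms $d:D\to E$, $e:E\to F$ with $h'g=df'$, $eh'=g'$, such that $D\xrightarrow{d}E\xrightarrow{e}F$ realizes $f'_*\delta'$, $d^*\delta''=\delta$ and $f_*\delta''=e^*\delta'$; (ET4)$^{\rm op}$ the dual. An $\mathbb{E}$-triangle $A\xrightarrow{x}B\xrightarrow{y}C\overset{\delta}{\dashrightarrow}$ is a sequence realizing $\delta\in\mathbb{E}(C,A)$. An object $P$ is projective if for every $\mathbb{E}$-triangle $A\to B\xrightarrow{y}C\dashrightarrow$ every morphism $P\to C$ factors through $y$; $\mathcal{C}$ has enough projectives if for every $C$ there is an $\mathbb{E}$-triangle $A\to P\to C\dashrightarrow$ with $P$ projective. Injective objects and enough injectives are defined dually. For a subcategory $\mathcal{D}$, $\Sigma\mathcal{D}$ is the subcategory of all objects $C$ admitting an $\mathbb{E}$-triangle $D\to I\to C\dashrightarrow$ with $D\in\mathcal{D}$ and $I$ injective. A cotorsion pair on $\mathcal{C}$ is a pair $(\mathcal{U},\mathcal{V})$ of full additive subcategories closed under isomorphisms and direct summands such that $\mathbb{E}(U,V)=0$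 for all $U\in\mathcal{U},V\in\mathcal{V}$, and for every $C\in\mathcal{C}$ there are $\mathbb{E}$-triangles $V_C\to U_C\to C\dashrightarrow$ and $C\to V^C\to U^C\dashrightarrow$ with $U_C,U^C\in\mathcal{U}$, $V_C,V^C\in\mathcal{V}$. $\mathcal{C}/\mathcal{W}$ is the additive quotient category: same objects as $\mathcal{C}$, morphisms modulo those factoring through an object of $\mathcal{W}$. For a full subcategory $\mathcal{D}\supseteq\mathcal{W}$, $\mathcal{D}/\mathcal{W}$ is the corresponding full subcategory of $\mathcal{C}/\mathcal{W}$. A sequence of additive functors $\mathcal{A}'\xrightarrow{F}\mathcal{A}\xrightarrow{G}\mathcal{A}''$ between additive categories is a localization sequence if $F$ is fully faithful and has a right adjoint $F_\delta$, $G$ has a fully faithful right adjoint $G_\delta$, and $\operatorname{Im}F=\operatorname{Ker}G$, where $\operatorname{Im}F=\{A\in\mathcal{A}: A\cong F(X)\text{ for some }X\in\mathcal{A}'\}$ and $\operatorname{Ker}G=\{A\in\mathcal{A}: G(A)\cong 0\}$. A colocalization sequence is defined dually: $F$ is fully faithful and has a left adjoint $F_\lambda$, $G$ has a fully faithful left adjoint $G_\lambda$, and $\operatorname{Im}F=\operatorname{Ker}G$. A recollement of additive categories is a sequence that is both a localization and a colocalization sequence. *)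

theory Defs
  imports "HOL-Algebra.Coset"
begin

section \<open>Additive categories\<close>

text \<open>
  Hom-groups are HOL-Algebra groups, hence written multiplicatively: \<open>\<otimes>\<close> is addition of morphisms
  and \<open>\<one>\<close> is the zero morphism. The same applies to the groups of extensions below.
  Distinct hom-sets are disjoint, so composition does not have to mention objects.
\<close>

record ('o, 'm) category =
  Obj :: "'o set"
  Hom :: "'o \<Rightarrow> 'o \<Rightarrow> 'm monoid"
  Ident :: "'o \<Rightarrow> 'm"
  Comp :: "'m \<Rightarrow> 'm \<Rightarrow> 'm"  (infixr "\<cdot>\<index>" 75)

abbreviation Mor :: "('o, 'm, 'z) category_scheme \<Rightarrow> 'o \<Rightarrow> 'o \<Rightarrow> 'm set"
  where "Mor K A B \<equiv> carrier (Hom K A B)"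

abbreviation zero_mor :: "('o, 'm, 'z) category_scheme \<Rightarrow> 'o \<Rightarrow> 'o \<Rightarrow> 'm"
  where "zero_mor K A B \<equiv> one (Hom K A B)"

abbreviation add_mor :: "('o, 'm, 'z) category_scheme \<Rightarrow> 'o \<Rightarrow> 'o \<Rightarrow> 'm \<Rightarrow> 'm \<Rightarrow> 'm"
  where "add_mor K A B \<equiv> mult (Hom K A B)"

locale preadditive_category =
  fixes K (structure)
  assumes hom_group: "\<lbrakk>A \<in> Obj K; B \<in> Obj K\<rbrakk> \<Longrightarrow> comm_group (Hom K A B)"
    and hom_disjoint: "\<lbrakk>A \<in> Obj K; B \<in> Obj K; A' \<in> Obj K; B' \<in> Obj K; f \<in> Mor K A B; f \<in> Mor K A' B'\<rbrakk>
      \<Longrightarrow> A = A' \<and> B = B'"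
    and ident_closed: "A \<in> Obj K \<Longrightarrow> Ident K A \<in> Mor K A A"
    and comp_closed: "\<lbrakk>A \<in> Obj K; B \<in> Obj K; C \<in> Obj K; f \<in> Mor K A B; g \<in> Mor K B C\<rbrakk>
      \<Longrightarrow> g \<cdot> f \<in> Mor K A C"
    and comp_ident_right: "\<lbrakk>A \<in> Obj K; B \<in> Obj K; f \<in> Mor K A B\<rbrakk> \<Longrightarrow> f \<cdot> Ident K A = f"
    and comp_ident_left: "\<lbrakk>A \<in> Obj K; B \<in> Obj K; f \<in> Mor K A B\<rbrakk> \<Longrightarrow> Ident K B \<cdot> f = f"
    and comp_assoc: "\<lbrakk>A \<in> Obj K; B \<in> Obj K; C \<in> Obj K; D \<in> Obj K;
        f \<in> Mor K A B; g \<in> Mor K B C; h \<in> Mor K C D\<rbrakk> \<Longrightarrow> (h \<cdot> g) \<cdot> f = h \<cdot> (g \<cdot> f)"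
    and comp_add_right: "\<lbrakk>A \<in> Obj K; B \<in> Obj K; C \<in> Obj K;
        f \<in> Mor K A B; f' \<in> Mor K A B; g \<in> Mor K B C\<rbrakk>
      \<Longrightarrow> g \<cdot> add_mor K A B f f' = add_mor K A C (g \<cdot> f) (g \<cdot> f')"
    and comp_add_left: "\<lbrakk>A \<in> Obj K; B \<in> Obj K; C \<in> Obj K;
        f \<in> Mor K A B; g \<in> Mor K B C; g' \<in> Mor K B C\<rbrakk>
      \<Longrightarrow> add_mor K B C g g' \<cdot> f = add_mor K A C (g \<cdot> f) (g' \<cdot> f)"

definition isomorphism :: "('o, 'm, 'z) category_scheme \<Rightarrow> 'o \<Rightarrow> 'o \<Rightarrow> 'm \<Rightarrow> bool"
  where "isomorphism K A B f \<longleftrightarrow> f \<in> Mor K A B \<and>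
    (\<exists>g \<in> Mor K B A. g \<cdot>\<^bsub>K\<^esub> f = Ident K A \<and> f \<cdot>\<^bsub>K\<^esub> g = Ident K B)"

definition isomorphic :: "('o, 'm, 'z) category_scheme \<Rightarrow> 'o \<Rightarrow> 'o \<Rightarrow> bool"
  where "isomorphic K A B \<longleftrightarrow> (\<exists>f. isomorphism K A B f)"

definition zero_object :: "('o, 'm, 'z) category_scheme \<Rightarrow> 'o \<Rightarrow> bool"
  where "zero_object K Z \<longleftrightarrow> Z \<in> Obj K \<and>
    (\<forall>A \<in> Obj K. (\<exists>!f. f \<in> Mor K A Z) \<and> (\<exists>!f. f \<in> Mor K Z A))"

record ('o, 'm) biprod =
  Sum :: 'o
  inc1 :: 'm
  inc2 :: 'm
  prj1 :: 'm
  prj2 :: 'm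

definition biproduct :: "('o, 'm, 'z) category_scheme \<Rightarrow> 'o \<Rightarrow> 'o \<Rightarrow> ('o, 'm) biprod \<Rightarrow> bool"
  where "biproduct K A B P \<longleftrightarrow> Sum P \<in> Obj K \<and>
    inc1 P \<in> Mor K A (Sum P) \<and> inc2 P \<in> Mor K B (Sum P) \<and>
    prj1 P \<in> Mor K (Sum P) A \<and> prj2 P \<in> Mor K (Sum P) B \<and>
    prj1 P \<cdot>\<^bsub>K\<^esub> inc1 P = Ident K A \<and> prj2 P \<cdot>\<^bsub>K\<^esub> inc2 P = Ident K B \<and>
    prj2 P \<cdot>\<^bsub>K\<^esub> inc1 P = zero_mor K A B \<and> prj1 P \<cdot>\<^bsub>K\<^esub> inc2 P = zero_mor K B A \<and>
    add_mor K (Sum P) (Sum P) (inc1 P \<cdot>\<^bsub>K\<^esub> prj1 P) (inc2 P \<cdot>\<^bsub>K\<^esub> prj2 P) = Ident K (Sum P)"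

locale additive_category = preadditive_category +
  assumes has_zero_object: "\<exists>Z. zero_object K Z"
    and has_biproducts: "\<lbrakk>A \<in> Obj K; B \<in> Obj K\<rbrakk> \<Longrightarrow> \<exists>P. biproduct K A B P"

text \<open>The morphism \<open>f \<oplus> f'\<close> between the objects of the biproducts \<open>P\<close> (source) and \<open>Q\<close> (target).\<close>

definition sum_mor :: "('o, 'm, 'z) category_scheme \<Rightarrow> ('o, 'm) biprod \<Rightarrow> ('o, 'm) biprod \<Rightarrow> 'm \<Rightarrow> 'm \<Rightarrow> 'm"
  where "sum_mor K P Q f f' = add_mor K (Sum P) (Sum Q)
    (inc1 Q \<cdot>\<^bsub>K\<^esub> f \<cdot>\<^bsub>K\<^esub> prj1 P) (inc2 Q \<cdot>\<^bsub>K\<^esub> f' \<cdot>\<^bsub>K\<^esub> prj2 P)"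


section \<open>Additive subcategories and quotients\<close>

text \<open>Full subcategories are given by their sets of objects.\<close>

definition additive_subcategory :: "('o, 'm, 'z) category_scheme \<Rightarrow> 'o set \<Rightarrow> bool"
  where "additive_subcategory K \<D> \<longleftrightarrow> \<D> \<subseteq> Obj K \<and> (\<exists>Z \<in> \<D>. zero_object K Z) \<and>
    (\<forall>A \<in> \<D>. \<forall>B \<in> \<D>. \<exists>P. biproduct K A B P \<and> Sum P \<in> \<D>)"

definition closed_under_iso :: "('o, 'm, 'z) category_scheme \<Rightarrow> 'o set \<Rightarrow> bool"
  where "closed_under_iso K \<D> \<longleftrightarrow> (\<forall>A \<in> \<D>. \<forall>B \<in> Obj K. isomorphic K A B \<longrightarrow> B \<in> \<D>)"

definition closed_under_summands :: "('o, 'm, 'z) category_scheme \<Rightarrow> 'o set \<Rightarrow> bool"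
  where "closed_under_summands K \<D> \<longleftrightarrow>
    (\<forall>A \<in> Obj K. \<forall>B \<in> Obj K. \<forall>P. biproduct K A B P \<and> Sum P \<in> \<D> \<longrightarrow> A \<in> \<D> \<and> B \<in> \<D>)"

definition full_subcategory :: "('o, 'm) category \<Rightarrow> 'o set \<Rightarrow> ('o, 'm) category"
  where "full_subcategory K \<D> = K\<lparr>Obj := \<D>\<rparr>"

definition factoring :: "('o, 'm, 'z) category_scheme \<Rightarrow> 'o set \<Rightarrow> 'o \<Rightarrow> 'o \<Rightarrow> 'm set"
  where "factoring K \<W> A B = {g \<cdot>\<^bsub>K\<^esub> f | f g W. W \<in> \<W> \<and> f \<in> Mor K A W \<and> g \<in> Mor K W B}"

text \<open>
  The category \<open>K/\<W>\<close>: a morphism is the coset of a morphism of \<open>K\<close> modulo those factoring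
  through \<open>\<W>\<close>, and the composite of two cosets is the coset of the composites of their members.
\<close>

definition quotient_category :: "('o, 'm, 'z) category_scheme \<Rightarrow> 'o set \<Rightarrow> ('o, 'm set) category"
  where "quotient_category K \<W> = \<lparr>
    Obj = Obj K,
    Hom = (\<lambda>A B. Hom K A B Mod factoring K \<W> A B),
    Ident = (\<lambda>A. factoring K \<W> A A #>\<^bsub>Hom K A A\<^esub> Ident K A),
    Comp = (\<lambda>q p. \<Union>{factoring K \<W> A C #>\<^bsub>Hom K A C\<^esub> (g \<cdot>\<^bsub>K\<^esub> f) | A B C f g.
      A \<in> Obj K \<and> B \<in> Obj K \<and> C \<in> Obj K \<and> f \<in> p \<inter> Mor K A B \<and> g \<in> q \<inter> Mor K B C})\<rparr>"

definition sub_quotient :: "('o, 'm, 'z) category_scheme \<Rightarrow> 'o set \<Rightarrow> 'o set \<Rightarrow> ('o, 'm set) category"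
  where "sub_quotient K \<D> \<W> = full_subcategory (quotient_category K \<W>) \<D>"


section \<open>Extriangulated categories\<close>

text \<open>
  \<open>Ext K C A\<close> is the group \<open>\<bbbE>(C, A)\<close>, and for \<open>c : C' \<rightarrow> C\<close> and \<open>a : A \<rightarrow> A'\<close> the map
  \<open>\<bbbE>(c, a) : \<bbbE>(C, A) \<rightarrow> \<bbbE>(C', A')\<close> is \<open>ext_map K c a\<close>. The set \<open>Rlz K C A \<delta>\<close> is the equivalence class
  \<open>\<ss>(\<delta>)\<close>, whose members \<open>(B, x, y)\<close> are sequences from \<open>A\<close> via \<open>B\<close> to \<open>C\<close>.
\<close>

record ('o, 'm, 'e) ext_category = "('o, 'm) category" +
  Ext :: "'o \<Rightarrow> 'o \<Rightarrow> 'e monoid"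
  ext_map :: "'m \<Rightarrow> 'm \<Rightarrow> 'e \<Rightarrow> 'e"
  Rlz :: "'o \<Rightarrow> 'o \<Rightarrow> 'e \<Rightarrow> ('o \<times> 'm \<times> 'm) set"

locale additive_bifunctor = additive_category K
  for K :: "('o, 'm, 'e, 'z) ext_category_scheme" (structure) +
  assumes ext_group: "\<lbrakk>C \<in> Obj K; A \<in> Obj K\<rbrakk> \<Longrightarrow> comm_group (Ext K C A)"
    and ext_map_hom: "\<lbrakk>C \<in> Obj K; C' \<in> Obj K; A \<in> Obj K; A' \<in> Obj K; c \<in> Mor K C' C; a \<in> Mor K A A'\<rbrakk>
      \<Longrightarrow> ext_map K c a \<in> hom (Ext K C A) (Ext K C' A')"
    and ext_map_ident: "\<lbrakk>C \<in> Obj K; A \<in> Obj K; \<delta> \<in> carrier (Ext K C A)\<rbrakk>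
      \<Longrightarrow> ext_map K (Ident K C) (Ident K A) \<delta> = \<delta>"
    and ext_map_comp: "\<lbrakk>C \<in> Obj K; C' \<in> Obj K; C'' \<in> Obj K; A \<in> Obj K; A' \<in> Obj K; A'' \<in> Obj K;
        c \<in> Mor K C' C; c' \<in> Mor K C'' C'; a \<in> Mor K A A'; a' \<in> Mor K A' A'';
        \<delta> \<in> carrier (Ext K C A)\<rbrakk>
      \<Longrightarrow> ext_map K (c \<cdot> c') (a' \<cdot> a) \<delta> = ext_map K c' a' (ext_map K c a \<delta>)"
    and ext_map_add_left: "\<lbrakk>C \<in> Obj K; C' \<in> Obj K; A \<in> Obj K; A' \<in> Obj K;
        c \<in> Mor K C' C; c' \<in> Mor K C' C; a \<in> Mor K A A'; \<delta> \<in> carrier (Ext K C A)\<rbrakk>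
      \<Longrightarrow> ext_map K (add_mor K C' C c c') a \<delta> =
          mult (Ext K C' A') (ext_map K c a \<delta>) (ext_map K c' a \<delta>)"
    and ext_map_add_right: "\<lbrakk>C \<in> Obj K; C' \<in> Obj K; A \<in> Obj K; A' \<in> Obj K;
        c \<in> Mor K C' C; a \<in> Mor K A A'; a' \<in> Mor K A A'; \<delta> \<in> carrier (Ext K C A)\<rbrakk>
      \<Longrightarrow> ext_map K c (add_mor K A A' a a') \<delta> =
          mult (Ext K C' A') (ext_map K c a \<delta>) (ext_map K c a' \<delta>)"

text \<open>For \<open>\<delta> \<in> \<bbbE>(C, A)\<close>, \<open>push K C a \<delta>\<close> is \<open>a\<^sub>*\<delta>\<close> and \<open>pull K A c \<delta>\<close> is \<open>c\<^sup>*\<delta>\<close>.\<close>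

definition push :: "('o, 'm, 'e, 'z) ext_category_scheme \<Rightarrow> 'o \<Rightarrow> 'm \<Rightarrow> 'e \<Rightarrow> 'e"
  where "push K C a \<delta> = ext_map K (Ident K C) a \<delta>"

definition pull :: "('o, 'm, 'e, 'z) ext_category_scheme \<Rightarrow> 'o \<Rightarrow> 'm \<Rightarrow> 'e \<Rightarrow> 'e"
  where "pull K A c \<delta> = ext_map K c (Ident K A) \<delta>"

text \<open>
  The extension \<open>\<delta> \<oplus> \<delta>'\<close> in \<open>\<bbbE>(C \<oplus> C', A \<oplus> A')\<close>, the element with components \<open>(\<delta>, 0, 0, \<delta>')\<close> under
  \<open>\<bbbE>(C \<oplus> C', A \<oplus> A') \<cong> \<bbbE>(C, A) \<oplus> \<bbbE>(C, A') \<oplus> \<bbbE>(C', A) \<oplus> \<bbbE>(C', A')\<close>. Here \<open>R\<close> is the biproduct of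
  \<open>C\<close> and \<open>C'\<close>, and \<open>P\<close> that of \<open>A\<close> and \<open>A'\<close>.
\<close>

definition sum_ext :: "('o, 'm, 'e, 'z) ext_category_scheme \<Rightarrow> ('o, 'm) biprod \<Rightarrow> ('o, 'm) biprod \<Rightarrow> 'e \<Rightarrow> 'e \<Rightarrow> 'e"
  where "sum_ext K R P \<delta> \<delta>' = mult (Ext K (Sum R) (Sum P))
    (ext_map K (prj1 R) (inc1 P) \<delta>) (ext_map K (prj2 R) (inc2 P) \<delta>')"

definition sequences :: "('o, 'm, 'z) category_scheme \<Rightarrow> 'o \<Rightarrow> 'o \<Rightarrow> ('o \<times> 'm \<times> 'm) set"
  where "sequences K A C = {(B, x, y). B \<in> Obj K \<and> x \<in> Mor K A B \<and> y \<in> Mor K B C}"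

definition seq_equiv :: "('o, 'm, 'z) category_scheme \<Rightarrow> 'o \<Rightarrow> 'o \<Rightarrow> ('o \<times> 'm \<times> 'm) rel"
  where "seq_equiv K A C = {((B, x, y), (B', x', y')).
    (B, x, y) \<in> sequences K A C \<and> (B', x', y') \<in> sequences K A C \<and>
    (\<exists>b. isomorphism K B B' b \<and> b \<cdot>\<^bsub>K\<^esub> x = x' \<and> y' \<cdot>\<^bsub>K\<^esub> b = y)}"

definition etriangle :: "('o, 'm, 'e, 'z) ext_category_scheme \<Rightarrow> 'o \<Rightarrow> 'm \<Rightarrow> 'o \<Rightarrow> 'm \<Rightarrow> 'o \<Rightarrow> 'e \<Rightarrow> bool"
  where "etriangle K A x B y C \<delta> \<longleftrightarrow> A \<in> Obj K \<and> C \<in> Obj K \<and>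
    \<delta> \<in> carrier (Ext K C A) \<and> (B, x, y) \<in> Rlz K C A \<delta>"

locale additive_realization = additive_bifunctor +
  assumes rlz_class: "\<lbrakk>C \<in> Obj K; A \<in> Obj K; \<delta> \<in> carrier (Ext K C A)\<rbrakk>
      \<Longrightarrow> Rlz K C A \<delta> \<in> sequences K A C // seq_equiv K A C"
    and rlz_mor: "\<lbrakk>etriangle K A x B y C \<delta>; etriangle K A' x' B' y' C' \<delta>';
        a \<in> Mor K A A'; c \<in> Mor K C C'; push K C a \<delta> = pull K A' c \<delta>'\<rbrakk>
      \<Longrightarrow> \<exists>b \<in> Mor K B B'. b \<cdot> x = x' \<cdot> a \<and> y' \<cdot> b = c \<cdot> y"
    and rlz_zero: "\<lbrakk>A \<in> Obj K; C \<in> Obj K; biproduct K A C P\<rbrakk>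
      \<Longrightarrow> etriangle K A (inc1 P) (Sum P) (prj2 P) C (one (Ext K C A))"
    and rlz_sum: "\<lbrakk>etriangle K A x B y C \<delta>; etriangle K A' x' B' y' C' \<delta>';
        biproduct K A A' P; biproduct K B B' Q; biproduct K C C' R\<rbrakk>
      \<Longrightarrow> etriangle K (Sum P) (sum_mor K P Q x x') (Sum Q) (sum_mor K Q R y y') (Sum R)
            (sum_ext K R P \<delta> \<delta>')"

definition ET3 :: "('o, 'm, 'e) ext_category \<Rightarrow> bool"
  where "ET3 K \<longleftrightarrow> (\<forall>A x B y C \<delta> A' x' B' y' C' \<delta>' a b.
    etriangle K A x B y C \<delta> \<and> etriangle K A' x' B' y' C' \<delta>' \<and>
    a \<in> Mor K A A' \<and> b \<in> Mor K B B' \<and> b \<cdot>\<^bsub>K\<^esub> x = x' \<cdot>\<^bsub>K\<^esub> a \<longrightarrow>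
    (\<exists>c \<in> Mor K C C'. y' \<cdot>\<^bsub>K\<^esub> b = c \<cdot>\<^bsub>K\<^esub> y \<and> push K C a \<delta> = pull K A' c \<delta>'))"

definition ET4 :: "('o, 'm, 'e) ext_category \<Rightarrow> bool"
  where "ET4 K \<longleftrightarrow> (\<forall>A f B f' D \<delta> g C g' F \<delta>'.
    etriangle K A f B f' D \<delta> \<and> etriangle K B g C g' F \<delta>' \<longrightarrow>
    (\<exists>E h' \<delta>'' d e. etriangle K A (g \<cdot>\<^bsub>K\<^esub> f) C h' E \<delta>'' \<and>
      d \<in> Mor K D E \<and> e \<in> Mor K E F \<and>
      h' \<cdot>\<^bsub>K\<^esub> g = d \<cdot>\<^bsub>K\<^esub> f' \<and> e \<cdot>\<^bsub>K\<^esub> h' = g' \<and>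
      etriangle K D d E e F (push K F f' \<delta>') \<and>
      pull K A d \<delta>'' = \<delta> \<and> push K E f \<delta>'' = pull K B e \<delta>'))"

text \<open>
  The opposite category with \<open>\<bbbE>\<^sup>o\<^sup>p(C, A) = \<bbbE>(A, C)\<close>, in which \<open>\<delta>\<close> is realized by the reversed sequences;
  the axioms (ET3)\<open>\<^sup>o\<^sup>p\<close> and (ET4)\<open>\<^sup>o\<^sup>p\<close> are (ET3) and (ET4) for it.
\<close>

definition opposite :: "('o, 'm, 'e) ext_category \<Rightarrow> ('o, 'm, 'e) ext_category"
  where "opposite K = \<lparr>
    Obj = Obj K,
    Hom = (\<lambda>A B. Hom K B A),
    Ident = Ident K,
    Comp = (\<lambda>g f. f \<cdot>\<^bsub>K\<^esub> g),
    Ext = (\<lambda>C A. Ext K A C),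
    ext_map = (\<lambda>c a. ext_map K a c),
    Rlz = (\<lambda>C A \<delta>. {(B, x, y). (B, y, x) \<in> Rlz K A C \<delta>})\<rparr>"

locale extriangulated_category = additive_realization K
  for K :: "('o, 'm, 'e) ext_category" (structure) +
  assumes ET3: "ET3 K" and ET3_op: "ET3 (opposite K)"
    and ET4: "ET4 K" and ET4_op: "ET4 (opposite K)"

definition projective :: "('o, 'm, 'e, 'z) ext_category_scheme \<Rightarrow> 'o \<Rightarrow> bool"
  where "projective K P \<longleftrightarrow> P \<in> Obj K \<and>
    (\<forall>A x B y C \<delta>. etriangle K A x B y C \<delta> \<longrightarrow>
      (\<forall>f \<in> Mor K P C. \<exists>g \<in> Mor K P B. y \<cdot>\<^bsub>K\<^esub> g = f))"

definition injective :: "('o, 'm, 'e, 'z) ext_category_scheme \<Rightarrow> 'o \<Rightarrow> bool"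
  where "injective K I \<longleftrightarrow> I \<in> Obj K \<and>
    (\<forall>A x B y C \<delta>. etriangle K A x B y C \<delta> \<longrightarrow>
      (\<forall>f \<in> Mor K A I. \<exists>g \<in> Mor K B I. g \<cdot>\<^bsub>K\<^esub> x = f))"

definition enough_projectives :: "('o, 'm, 'e, 'z) ext_category_scheme \<Rightarrow> bool"
  where "enough_projectives K \<longleftrightarrow>
    (\<forall>C \<in> Obj K. \<exists>A x P y \<delta>. projective K P \<and> etriangle K A x P y C \<delta>)"

definition enough_injectives :: "('o, 'm, 'e, 'z) ext_category_scheme \<Rightarrow> bool"
  where "enough_injectives K \<longleftrightarrow>
    (\<forall>A \<in> Obj K. \<exists>x I y C \<delta>. injective K I \<and> etriangle K A x I y C \<delta>)"

text \<open>The subcategory \<open>\<Sigma>\<D>\<close>.\<close>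

definition suspension :: "('o, 'm, 'e, 'z) ext_category_scheme \<Rightarrow> 'o set \<Rightarrow> 'o set"
  where "suspension K \<D> =
    {C. \<exists>D x I y \<delta>. D \<in> \<D> \<and> injective K I \<and> etriangle K D x I y C \<delta>}"

definition cotorsion_pair :: "('o, 'm, 'e, 'z) ext_category_scheme \<Rightarrow> 'o set \<Rightarrow> 'o set \<Rightarrow> bool"
  where "cotorsion_pair K \<U> \<V> \<longleftrightarrow>
    additive_subcategory K \<U> \<and> closed_under_iso K \<U> \<and> closed_under_summands K \<U> \<and>
    additive_subcategory K \<V> \<and> closed_under_iso K \<V> \<and> closed_under_summands K \<V> \<and>
    (\<forall>U \<in> \<U>. \<forall>V \<in> \<V>. carrier (Ext K U V) = {one (Ext K U V)}) \<and>
    (\<forall>C \<in> Obj K. \<exists>V \<in> \<V>. \<exists>U \<in> \<U>. \<exists>x y \<delta>. etriangle K V x U y C \<delta>) \<and>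
    (\<forall>C \<in> Obj K. \<exists>V \<in> \<V>. \<exists>U \<in> \<U>. \<exists>x y \<delta>. etriangle K C x V y U \<delta>)"


section \<open>Functors, adjunctions and recollements\<close>

record ('o1, 'm1, 'o2, 'm2) cat_functor =
  on_obj :: "'o1 \<Rightarrow> 'o2"
  on_mor :: "'m1 \<Rightarrow> 'm2"

definition is_functor :: "('o1, 'm1) category \<Rightarrow> ('o2, 'm2) category \<Rightarrow> ('o1, 'm1, 'o2, 'm2) cat_functor \<Rightarrow> bool"
  where "is_functor K L F \<longleftrightarrow>
    (\<forall>A \<in> Obj K. on_obj F A \<in> Obj L) \<and>
    (\<forall>A \<in> Obj K. \<forall>B \<in> Obj K. \<forall>f \<in> Mor K A B. on_mor F f \<in> Mor L (on_obj F A) (on_obj F B)) \<and>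
    (\<forall>A \<in> Obj K. on_mor F (Ident K A) = Ident L (on_obj F A)) \<and>
    (\<forall>A \<in> Obj K. \<forall>B \<in> Obj K. \<forall>C \<in> Obj K. \<forall>f \<in> Mor K A B. \<forall>g \<in> Mor K B C.
      on_mor F (g \<cdot>\<^bsub>K\<^esub> f) = on_mor F g \<cdot>\<^bsub>L\<^esub> on_mor F f)"

definition additive_functor :: "('o1, 'm1) category \<Rightarrow> ('o2, 'm2) category \<Rightarrow> ('o1, 'm1, 'o2, 'm2) cat_functor \<Rightarrow> bool"
  where "additive_functor K L F \<longleftrightarrow> is_functor K L F \<and>
    (\<forall>A \<in> Obj K. \<forall>B \<in> Obj K. on_mor F \<in> hom (Hom K A B) (Hom L (on_obj F A) (on_obj F B)))"

definition fully_faithful :: "('o1, 'm1) category \<Rightarrow> ('o2, 'm2) category \<Rightarrow> ('o1, 'm1, 'o2, 'm2) cat_functor \<Rightarrow> bool"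
  where "fully_faithful K L F \<longleftrightarrow>
    (\<forall>A \<in> Obj K. \<forall>B \<in> Obj K. bij_betw (on_mor F) (Mor K A B) (Mor L (on_obj F A) (on_obj F B)))"

text \<open>\<open>F : K \<rightarrow> L\<close> is left adjoint to \<open>G : L \<rightarrow> K\<close>.\<close>

definition adjoint :: "('o1, 'm1) category \<Rightarrow> ('o2, 'm2) category \<Rightarrow>
    ('o1, 'm1, 'o2, 'm2) cat_functor \<Rightarrow> ('o2, 'm2, 'o1, 'm1) cat_functor \<Rightarrow> bool"
  where "adjoint K L F G \<longleftrightarrow> is_functor K L F \<and> is_functor L K G \<and>
    (\<exists>\<phi>. (\<forall>A \<in> Obj K. \<forall>B \<in> Obj L.
            bij_betw (\<phi> A B) (Mor L (on_obj F A) B) (Mor K A (on_obj G B))) \<and>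
         (\<forall>A \<in> Obj K. \<forall>A' \<in> Obj K. \<forall>B \<in> Obj L. \<forall>B' \<in> Obj L.
            \<forall>a \<in> Mor K A' A. \<forall>b \<in> Mor L B B'. \<forall>f \<in> Mor L (on_obj F A) B.
            \<phi> A' B' (b \<cdot>\<^bsub>L\<^esub> f \<cdot>\<^bsub>L\<^esub> on_mor F a) = on_mor G b \<cdot>\<^bsub>K\<^esub> \<phi> A B f \<cdot>\<^bsub>K\<^esub> a))"

definition functor_image :: "('o1, 'm1) category \<Rightarrow> ('o2, 'm2) category \<Rightarrow> ('o1, 'm1, 'o2, 'm2) cat_functor \<Rightarrow> 'o2 set"
  where "functor_image K L F = {A \<in> Obj L. \<exists>X \<in> Obj K. isomorphic L A (on_obj F X)}"

definition functor_kernel :: "('o1, 'm1) category \<Rightarrow> ('o2, 'm2) category \<Rightarrow> ('o1, 'm1, 'o2, 'm2) cat_functor \<Rightarrow> 'o1 set"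
  where "functor_kernel K L G = {A \<in> Obj K. \<exists>Z. zero_object L Z \<and> isomorphic L (on_obj G A) Z}"

definition additive_sequence :: "('o1, 'm1) category \<Rightarrow> ('o2, 'm2) category \<Rightarrow> ('o3, 'm3) category \<Rightarrow>
    ('o1, 'm1, 'o2, 'm2) cat_functor \<Rightarrow> ('o2, 'm2, 'o3, 'm3) cat_functor \<Rightarrow> bool"
  where "additive_sequence K' K K'' F G \<longleftrightarrow>
    additive_category K' \<and> additive_category K \<and> additive_category K'' \<and>
    additive_functor K' K F \<and> additive_functor K K'' G"

definition localization_sequence :: "('o1, 'm1) category \<Rightarrow> ('o2, 'm2) category \<Rightarrow> ('o3, 'm3) category \<Rightarrow>
    ('o1, 'm1, 'o2, 'm2) cat_functor \<Rightarrow> ('o2, 'm2, 'o3, 'm3) cat_functor \<Rightarrow> bool"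
  where "localization_sequence K' K K'' F G \<longleftrightarrow> additive_sequence K' K K'' F G \<and>
    fully_faithful K' K F \<and> (\<exists>Fr. adjoint K' K F Fr) \<and>
    (\<exists>Gr. adjoint K K'' G Gr \<and> fully_faithful K'' K Gr) \<and>
    functor_image K' K F = functor_kernel K K'' G"

definition colocalization_sequence :: "('o1, 'm1) category \<Rightarrow> ('o2, 'm2) category \<Rightarrow> ('o3, 'm3) category \<Rightarrow>
    ('o1, 'm1, 'o2, 'm2) cat_functor \<Rightarrow> ('o2, 'm2, 'o3, 'm3) cat_functor \<Rightarrow> bool"
  where "colocalization_sequence K' K K'' F G \<longleftrightarrow> additive_sequence K' K K'' F G \<and>
    fully_faithful K' K F \<and> (\<exists>Fl. adjoint K K' Fl F) \<and>
    (\<exists>Gl. adjoint K'' K Gl G \<and> fully_faithful K'' K Gl) \<and>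
    functor_image K' K F = functor_kernel K K'' G"

definition recollement :: "('o1, 'm1) category \<Rightarrow> ('o2, 'm2) category \<Rightarrow> ('o3, 'm3) category \<Rightarrow>
    ('o1, 'm1, 'o2, 'm2) cat_functor \<Rightarrow> ('o2, 'm2, 'o3, 'm3) cat_functor \<Rightarrow> bool"
  where "recollement K' K K'' F G \<longleftrightarrow>
    localization_sequence K' K K'' F G \<and> colocalization_sequence K' K K'' F G"

text \<open>Inclusion of a full subcategory, to be used between full subcategories of one category.\<close>

definition inclusion :: "('o, 'm, 'o, 'm) cat_functor"
  where "inclusion = \<lparr>on_obj = (\<lambda>A. A), on_mor = (\<lambda>f. f)\<rparr>"

end

theory Submission
  imports Defs
begin

text \<open>
  For a cotorsion pair \<open>(U, V)\<close> with core \<open>W\<close>, the triangles \<open>V\<^sub>C \<rightarrow> U\<^sub>C \<rightarrow> C\<close> and \<open>C \<rightarrow> V\<^sup>C \<rightarrow> U\<^sup>C\<close>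
  make \<open>U/W\<close> coreflective and \<open>V/W\<close> reflective in the quotient by \<open>W\<close>. Restricted to \<open>T\<close>, this gives
  both adjoints of \<open>F\<close>, via \<open>T \<mapsto> V\<^sup>T\<close> and \<open>T \<mapsto> X\<^sub>T \<in> X \<inter> T = V\<close>, and also \<open>G = (T \<mapsto> U\<^sub>T)\<close> and
  \<open>G' = (T \<mapsto> Y\<^sup>T)\<close>. The remaining adjoints come from the natural isomorphisms modulo \<open>W\<close>
  \<open>Hom(U\<^sub>T, T') \<cong> Hom(U\<^sub>T, Y\<^bsup>T'\<^esup>) \<cong> Hom(T, Y\<^bsup>T'\<^esup>)\<close> for \<open>T, T'\<close> in \<open>T\<close>: hence \<open>M \<mapsto> Y\<^sup>M\<close> is right adjoint to
  \<open>G\<close> and \<open>N \<mapsto> U\<^sub>N\<close> is left adjoint to \<open>G'\<close>. These isomorphisms and the description of the kernels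
  reduce to the vanishing of second extension groups such as \<open>\<bbbE>(U, \<Sigma>V)\<close>, which is what \<open>\<Sigma>V \<subseteq> V\<close> and
  \<open>\<Sigma>Y \<subseteq> Y\<close> provide.
\<close>

section \<open>Opposite categories and full subcategories\<close>

text \<open>The obstacle is the pair (S, T), for which nothing is assumed about \<Sigma>T. Testing
  this against S meets an obstruction in the second extension group from S to T, which dimension
  shifting removes only if syzygies of objects of S stay in S. They do, because S = U \<inter> X:
  orthogonality gives one inclusion, the triangles from Y over V onto objects of T give the other,
  and the conditions on \<Sigma> close both U and X under first terms of triangles whose other two
  terms they contain. Duality is available only at the two ends, for exact sequences of triangles
  and for abstract recollements. In between, T and the classes closed under \<Sigma> are all
  right-hand classes, so the two comparison bijections get separate arguments; the symmetry between
  the recollements appears only in T/W.\<close>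

definition dual :: "('o, 'm, 'z) category_scheme \<Rightarrow> ('o, 'm) category"
  where "dual K = \<lparr>Obj = Obj K, Hom = (\<lambda>A B. Hom K B A), Ident = Ident K, Comp = (\<lambda>g f. f \<cdot>\<^bsub>K\<^esub> g)\<rparr>"

lemma dual_simps [simp]:
  "Obj (dual K) = Obj K" "Hom (dual K) A B = Hom K B A" "Ident (dual K) = Ident K"
  "Comp (dual K) = (\<lambda>g f. f \<cdot>\<^bsub>K\<^esub> g)"
  by (simp_all add: dual_def)

text \<open>\<open>dual\<close> cuts a record down to a plain category, so it is an involution only
  at that type; hence the type constraint.\<close>

lemma dual_dual [simp]: "dual (dual K) = (K :: ('o, 'm) category)"
  by (simp add: dual_def)

lemma full_subcategory_simps [simp]:
  "Obj (full_subcategory K D) = D" "Hom (full_subcategory K D) A B = Hom K A B"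
  "Ident (full_subcategory K D) = Ident K" "Comp (full_subcategory K D) = Comp K"
  by (simp_all add: full_subcategory_def)

lemma full_subcategory_dual: "full_subcategory (dual K) D = dual (full_subcategory K D)"
  by (simp add: full_subcategory_def dual_def)

lemma full_subcategory_full_subcategory [simp]:
  "full_subcategory (full_subcategory K D) E = full_subcategory K E"
  by (simp add: full_subcategory_def)

context preadditive_category
begin

lemma zero_closed: "\<lbrakk>A \<in> Obj K; B \<in> Obj K\<rbrakk> \<Longrightarrow> zero_mor K A B \<in> Mor K A B"
  using hom_group by (simp add: comm_group_def group.is_monoid monoid.one_closed)

lemma add_closed:
  "\<lbrakk>A \<in> Obj K; B \<in> Obj K; f \<in> Mor K A B; g \<in> Mor K A B\<rbrakk> \<Longrightarrow> add_mor K A B f g \<in> Mor K A B"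
  using hom_group by (meson comm_group_def group.is_monoid monoid.m_closed)

lemma comp_zero_right:
  assumes "A \<in> Obj K" "B \<in> Obj K" "C \<in> Obj K" "g \<in> Mor K B C"
  shows "g \<cdot> zero_mor K A B = zero_mor K A C"
proof -
  interpret AB: comm_group "Hom K A B" using assms hom_group by blast
  interpret AC: comm_group "Hom K A C" using assms hom_group by blast
  have c: "g \<cdot> zero_mor K A B \<in> Mor K A C" using assms comp_closed by blast
  have "g \<cdot> zero_mor K A B = add_mor K A C (g \<cdot> zero_mor K A B) (g \<cdot> zero_mor K A B)"
    using comp_add_right[of A B C "zero_mor K A B" "zero_mor K A B" g] assms by simp
  then show ?thesis using c AC.r_cancel_one by force
qed

lemma comp_zero_left:
  assumes "A \<in> Obj K" "B \<in> Obj K" "C \<in> Obj K" "f \<in> Mor K A B"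
  shows "zero_mor K B C \<cdot> f = zero_mor K A C"
proof -
  interpret BC: comm_group "Hom K B C" using assms hom_group by blast
  interpret AC: comm_group "Hom K A C" using assms hom_group by blast
  have c: "zero_mor K B C \<cdot> f \<in> Mor K A C" using assms comp_closed by blast
  have "zero_mor K B C \<cdot> f = add_mor K A C (zero_mor K B C \<cdot> f) (zero_mor K B C \<cdot> f)"
    using comp_add_left[of A B C f "zero_mor K B C" "zero_mor K B C"] assms by simp
  then show ?thesis using c AC.r_cancel_one by force
qed

text \<open>If the identity vanishes, so does every morphism into or out of \<open>Z\<close>. Unlike
  the definition, this criterion involves a single hom-group, so it transports to full
  subcategories, opposites and quotients.\<close>

lemma zero_object_iff: "zero_object K Z \<longleftrightarrow> Z \<in> Obj K \<and> Ident K Z = zero_mor K Z Z"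
proof
  assume "zero_object K Z"
  then show "Z \<in> Obj K \<and> Ident K Z = zero_mor K Z Z"
    unfolding zero_object_def using ident_closed zero_closed by metis
next
  assume Z: "Z \<in> Obj K \<and> Ident K Z = zero_mor K Z Z"
  show "zero_object K Z"
    unfolding zero_object_def
  proof (intro conjI ballI ex1I)
    fix A f assume "A \<in> Obj K" "f \<in> Mor K A Z"
    then show "f = zero_mor K A Z" using Z comp_ident_left comp_zero_left by metis
  next
    fix A f assume "A \<in> Obj K" "f \<in> Mor K Z A"
    then show "f = zero_mor K Z A" using Z comp_ident_right comp_zero_right by metis
  qed (use Z zero_closed in auto)
qed

lemma isomorphic_refl: "A \<in> Obj K \<Longrightarrow> isomorphic K A A"
  unfolding isomorphic_def isomorphism_def using ident_closed comp_ident_left by metis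

lemma isomorphic_zero_object:
  assumes "zero_object K Z" "isomorphic K A Z" "A \<in> Obj K"
  shows "zero_object K A"
proof -
  obtain f g where fg: "f \<in> Mor K A Z" "g \<in> Mor K Z A" "g \<cdot> f = Ident K A"
    using assms unfolding isomorphic_def isomorphism_def by blast
  have "f = zero_mor K A Z" using assms fg zero_closed unfolding zero_object_def by metis
  then show ?thesis using fg comp_zero_right assms unfolding zero_object_iff by metis
qed

text \<open>Stated for any \<open>L\<close> with reversed arrows rather than for
  \<open>dual K\<close>, because \<open>opposite K\<close>, which also carries extensions, has to be
  covered as well.\<close>

lemma preadditive_contravariant:
  assumes "Obj L = Obj K" "\<And>A B. Hom L A B = Hom K B A" "Ident L = Ident K"
    and "\<And>g f. g \<cdot>\<^bsub>L\<^esub> f = f \<cdot> g"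
  shows "preadditive_category L"
  by (intro preadditive_category.intro; unfold assms)
    (auto simp: hom_group ident_closed comp_closed comp_ident_left
      comp_ident_right comp_assoc comp_add_left comp_add_right dest: hom_disjoint)

lemma preadditive_dual: "preadditive_category (dual K)"
  by (rule preadditive_contravariant) auto

end

lemma preadditive_full_subcategory:
  fixes K :: "('o, 'm) category"
  assumes "preadditive_category K" "D \<subseteq> Obj K"
  shows "preadditive_category (full_subcategory K D)"
proof -
  interpret preadditive_category K by fact
  show ?thesis
    using assms(2)
    by (intro preadditive_category.intro; unfold full_subcategory_simps)
      (meson subsetD hom_group hom_disjoint ident_closed comp_closed comp_ident_right
        comp_ident_left comp_assoc comp_add_right comp_add_left)+
qed

section \<open>Functors, adjunctions and recollements under reversal of arrows\<close>

lemma isomorphic_dual: "isomorphic (dual K) A B \<longleftrightarrow> isomorphic K B A"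
  unfolding isomorphic_def isomorphism_def by auto

lemma zero_object_dual: "zero_object (dual K) Z \<longleftrightarrow> zero_object K Z"
  unfolding zero_object_def by auto

definition dual_biproduct :: "('o, 'm) biprod \<Rightarrow> ('o, 'm) biprod"
  where "dual_biproduct P = \<lparr>Sum = Sum P, inc1 = prj1 P, inc2 = prj2 P, prj1 = inc1 P, prj2 = inc2 P\<rparr>"

lemma Sum_dual_biproduct [simp]: "Sum (dual_biproduct P) = Sum P"
  by (simp add: dual_biproduct_def)

lemma biproduct_contravariant:
  assumes "Obj L = Obj K" "\<And>A B. Hom L A B = Hom K B A" "Ident L = Ident K"
    and "\<And>g f. g \<cdot>\<^bsub>L\<^esub> f = f \<cdot>\<^bsub>K\<^esub> g" and "biproduct K A B P"
  shows "biproduct L A B (dual_biproduct P)"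
  using assms unfolding biproduct_def dual_biproduct_def by simp

lemma (in additive_category) additive_contravariant:
  assumes "Obj L = Obj K" "\<And>A B. Hom L A B = Hom K B A" "Ident L = Ident K"
    and "\<And>g f. g \<cdot>\<^bsub>L\<^esub> f = f \<cdot> g"
  shows "additive_category L"
proof -
  interpret L: preadditive_category L by (rule preadditive_contravariant) (use assms in auto)
  show ?thesis
  proof
    show "\<exists>Z. zero_object L Z"
      using has_zero_object unfolding zero_object_iff L.zero_object_iff by (simp add: assms)
    fix A B assume "A \<in> Obj L" "B \<in> Obj L"
    then obtain P where "biproduct K A B P" using has_biproducts unfolding assms(1) by blast
    then show "\<exists>P. biproduct L A B P" using biproduct_contravariant[of L K, OF assms] by blast
  qed
qed

lemma additive_dual: "additive_category K \<Longrightarrow> additive_category (dual K)"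
  by (rule additive_category.additive_contravariant) auto

lemma is_functor_dual: "is_functor (dual K) (dual L) F \<longleftrightarrow> is_functor K L F"
  unfolding is_functor_def by auto

lemma additive_functor_dual: "additive_functor (dual K) (dual L) F \<longleftrightarrow> additive_functor K L F"
  unfolding additive_functor_def is_functor_dual by auto

lemma fully_faithful_dual: "fully_faithful (dual K) (dual L) F \<longleftrightarrow> fully_faithful K L F"
  unfolding fully_faithful_def by auto

text \<open>In the opposite categories the hom bijection runs the other way, so the bijection wanted
  here is its inverse with the two objects exchanged. Naturality is checked after applying the given
  bijection, which is injective; associativity enters because reversal rebrackets triple
  composites.\<close>

lemma adjoint_dual:
  assumes "preadditive_category K" "preadditive_category L" and adj: "adjoint (dual L) (dual K) G F"
  shows "adjoint K L F G"
proof -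
  interpret K: preadditive_category K by fact
  interpret L: preadditive_category L by fact
  obtain \<phi> where
    \<phi>: "\<forall>A\<in>Obj L. \<forall>B\<in>Obj K. bij_betw (\<phi> A B) (Mor K B (on_obj G A)) (Mor L (on_obj F B) A)"
      "\<forall>A\<in>Obj L. \<forall>A'\<in>Obj L. \<forall>B\<in>Obj K. \<forall>B'\<in>Obj K.
        \<forall>a\<in>Mor L A A'. \<forall>b\<in>Mor K B' B. \<forall>f\<in>Mor K B (on_obj G A).
          \<phi> A' B' ((on_mor G a \<cdot>\<^bsub>K\<^esub> f) \<cdot>\<^bsub>K\<^esub> b) = (a \<cdot>\<^bsub>L\<^esub> \<phi> A B f) \<cdot>\<^bsub>L\<^esub> on_mor F b"
    using adj unfolding adjoint_def dual_simps by (elim conjE exE) (rule that)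
  have b: "bij_betw (\<phi> A B) (Mor K B (on_obj G A)) (Mor L (on_obj F B) A)"
    if "A \<in> Obj L" "B \<in> Obj K" for A B
    using \<phi>(1) that by blast
  have n: "\<phi> A' B' ((on_mor G a \<cdot>\<^bsub>K\<^esub> f) \<cdot>\<^bsub>K\<^esub> b) = (a \<cdot>\<^bsub>L\<^esub> \<phi> A B f) \<cdot>\<^bsub>L\<^esub> on_mor F b"
    if "A \<in> Obj L" "A' \<in> Obj L" "B \<in> Obj K" "B' \<in> Obj K"
      "a \<in> Mor L A A'" "b \<in> Mor K B' B" "f \<in> Mor K B (on_obj G A)" for A A' B B' a b f
    using \<phi>(2) that by blast
  have F: "is_functor K L F" and G: "is_functor L K G"
    using adj unfolding adjoint_def is_functor_dual by auto
  have F_obj: "on_obj F A \<in> Obj L" if "A \<in> Obj K" for A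
    using F that unfolding is_functor_def by blast
  have F_mor: "on_mor F f \<in> Mor L (on_obj F A) (on_obj F B)"
    if "A \<in> Obj K" "B \<in> Obj K" "f \<in> Mor K A B" for A B f
    using F that unfolding is_functor_def by blast
  have G_obj: "on_obj G A \<in> Obj K" if "A \<in> Obj L" for A
    using G that unfolding is_functor_def by blast
  have G_mor: "on_mor G f \<in> Mor K (on_obj G A) (on_obj G B)"
    if "A \<in> Obj L" "B \<in> Obj L" "f \<in> Mor L A B" for A B f
    using G that unfolding is_functor_def by blast
  define \<psi> where "\<psi> A B = inv_into (Mor K A (on_obj G B)) (\<phi> B A)" for A B
  have "bij_betw (\<psi> A B) (Mor L (on_obj F A) B) (Mor K A (on_obj G B))"
    if "A \<in> Obj K" "B \<in> Obj L" for A B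
    unfolding \<psi>_def using b that bij_betw_inv_into by blast
  moreover have "\<psi> A' B' (y \<cdot>\<^bsub>L\<^esub> f \<cdot>\<^bsub>L\<^esub> on_mor F x) = on_mor G y \<cdot>\<^bsub>K\<^esub> \<psi> A B f \<cdot>\<^bsub>K\<^esub> x"
    if obj: "A \<in> Obj K" "A' \<in> Obj K" "B \<in> Obj L" "B' \<in> Obj L"
      and x: "x \<in> Mor K A' A" and y: "y \<in> Mor L B B'" and f: "f \<in> Mor L (on_obj F A) B"
    for A A' B B' x y f
  proof -
    let ?g = "\<psi> A B f"
    have g: "?g \<in> Mor K A (on_obj G B)" "\<phi> B A ?g = f"
      using b[of B A] obj f unfolding \<psi>_def
      by (auto simp: bij_betw_def inv_into_into f_inv_into_f)
    have eq: "(on_mor G y \<cdot>\<^bsub>K\<^esub> ?g) \<cdot>\<^bsub>K\<^esub> x = on_mor G y \<cdot>\<^bsub>K\<^esub> ?g \<cdot>\<^bsub>K\<^esub> x"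
      by (rule K.comp_assoc[of A' A "on_obj G B" "on_obj G B'"]) (use g obj x y G_obj G_mor in auto)
    have "(y \<cdot>\<^bsub>L\<^esub> f) \<cdot>\<^bsub>L\<^esub> on_mor F x = y \<cdot>\<^bsub>L\<^esub> f \<cdot>\<^bsub>L\<^esub> on_mor F x"
      by (rule L.comp_assoc[of "on_obj F A'" "on_obj F A" B B']) (use f obj x y F_obj F_mor in auto)
    then have "\<phi> B' A' (on_mor G y \<cdot>\<^bsub>K\<^esub> ?g \<cdot>\<^bsub>K\<^esub> x) = y \<cdot>\<^bsub>L\<^esub> f \<cdot>\<^bsub>L\<^esub> on_mor F x"
      using n[of B B' A A' y x ?g] obj x y g eq by simp
    moreover have "on_mor G y \<cdot>\<^bsub>K\<^esub> ?g \<cdot>\<^bsub>K\<^esub> x \<in> Mor K A' (on_obj G B')"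
      using obj x y g G_obj G_mor K.comp_closed by meson
    ultimately show ?thesis
      unfolding \<psi>_def using b[of B' A'] obj by (metis bij_betw_inv_into_left)
  qed
  ultimately show ?thesis
    unfolding adjoint_def using F G by blast
qed

lemma functor_image_dual: "functor_image (dual K) (dual L) F = functor_image K L F"
  unfolding functor_image_def isomorphic_dual unfolding isomorphic_def isomorphism_def by auto

lemma functor_kernel_dual: "functor_kernel (dual K) (dual L) F = functor_kernel K L F"
  unfolding functor_kernel_def isomorphic_dual zero_object_dual
  unfolding isomorphic_def isomorphism_def by auto

lemma additive_sequence_dual:
  assumes "additive_sequence (dual K') (dual K) (dual K'') F G"
  shows "additive_sequence K' K K'' F G"
  using assms additive_dual[of "dual K'"] additive_dual[of "dual K"] additive_dual[of "dual K''"]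
  unfolding additive_sequence_def additive_functor_dual by simp

text \<open>Reversal of arrows exchanges localization with colocalization sequences: left and right
  adjoints trade places, while full faithfulness, image and kernel are unaffected.\<close>

lemma recollement_dual:
  assumes "recollement (dual K') (dual K) (dual K'') F G"
  shows "recollement K' K K'' F G"
proof -
  have s: "additive_sequence K' K K'' F G"
    using assms additive_sequence_dual unfolding recollement_def localization_sequence_def by blast
  then have "preadditive_category K'" "preadditive_category K" "preadditive_category K''"
    unfolding additive_sequence_def additive_category_def by auto
  note adj = adjoint_dual[OF this(1,2)] adjoint_dual[OF this(2,1)]
    adjoint_dual[OF this(2,3)] adjoint_dual[OF this(3,2)]
  show ?thesis
    using assms s
    unfolding recollement_def localization_sequence_def colocalization_sequence_def
      fully_faithful_dual functor_image_dual functor_kernel_dual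
    by (meson adj)
qed

lemma inclusion_simps [simp]: "on_obj inclusion A = A" "on_mor inclusion f = f"
  by (simp_all add: inclusion_def)

lemma additive_functor_inclusion:
  assumes "preadditive_category K" "D \<subseteq> Obj K"
  shows "additive_functor (full_subcategory K D) K inclusion"
proof -
  interpret preadditive_category K by fact
  show ?thesis
    using assms(2) unfolding additive_functor_def is_functor_def hom_def by auto
qed

lemma fully_faithful_inclusion: "fully_faithful (full_subcategory K D) K inclusion"
  unfolding fully_faithful_def by (auto simp: bij_betw_def inj_on_def)

text \<open>This is how a reflector onto one subcategory becomes a functor defined on another, as
  the extra adjoints of the recollements require.\<close>

lemma is_functor_restrict:
  assumes "is_functor K (full_subcategory K E) F" "D \<subseteq> Obj K" "E \<subseteq> Obj K"
  shows "is_functor (full_subcategory K D) K F"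
  using assms unfolding is_functor_def full_subcategory_simps by (intro conjI ballI) (meson subsetD)+


section \<open>Reflections, coreflections and recollements\<close>

text \<open>Only objects and counit morphisms are recorded, with the universal property of a right
  adjoint to the inclusion. Approximation triangles supply just these data; functoriality is
  derived.\<close>

definition coreflection :: "('o, 'm) category \<Rightarrow> 'o set \<Rightarrow> ('o \<Rightarrow> 'o) \<Rightarrow> ('o \<Rightarrow> 'm) \<Rightarrow> bool"
  where "coreflection K D r e \<longleftrightarrow> D \<subseteq> Obj K \<and> (\<forall>A \<in> Obj K. r A \<in> D \<and> e A \<in> Mor K (r A) A \<and>
    (\<forall>N \<in> D. bij_betw (\<lambda>g. e A \<cdot>\<^bsub>K\<^esub> g) (Mor K N (r A)) (Mor K N A)))"

definition reflection :: "('o, 'm) category \<Rightarrow> 'o set \<Rightarrow> ('o \<Rightarrow> 'o) \<Rightarrow> ('o \<Rightarrow> 'm) \<Rightarrow> bool"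
  where "reflection K D r e \<longleftrightarrow> D \<subseteq> Obj K \<and> (\<forall>A \<in> Obj K. r A \<in> D \<and> e A \<in> Mor K A (r A) \<and>
    (\<forall>N \<in> D. bij_betw (\<lambda>g. g \<cdot>\<^bsub>K\<^esub> e A) (Mor K (r A) N) (Mor K A N)))"

lemma coreflection_dual: "coreflection (dual K) D r e \<longleftrightarrow> reflection K D r e"
  unfolding coreflection_def reflection_def by simp

lemma reflection_dual: "reflection (dual K) D r e \<longleftrightarrow> coreflection K D r e"
  unfolding coreflection_def reflection_def by simp

text \<open>A functor acts on bare morphisms, so source and target must be recovered from
  \<open>f\<close>; disjointness of the hom-sets makes them, and hence the completing
  \<open>g\<close>, unique. Applied to \<open>dual K\<close> the same formula is a
  reflector.\<close>

definition coreflector :: "('o, 'm) category \<Rightarrow> ('o \<Rightarrow> 'o) \<Rightarrow> ('o \<Rightarrow> 'm) \<Rightarrow> ('o, 'm, 'o, 'm) cat_functor"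
  where "coreflector K r e = \<lparr>on_obj = r, on_mor = (\<lambda>f. THE g. \<exists>A \<in> Obj K. \<exists>B \<in> Obj K.
    f \<in> Mor K A B \<and> g \<in> Mor K (r A) (r B) \<and> e B \<cdot>\<^bsub>K\<^esub> g = f \<cdot>\<^bsub>K\<^esub> e A)\<rparr>"

lemma on_obj_coreflector [simp]: "on_obj (coreflector K r e) = r"
  by (simp add: coreflector_def)

locale coreflective = preadditive_category K
  for K :: "('o, 'm) category" (structure) +
  fixes D r e
  assumes coreflection: "coreflection K D r e"
begin

abbreviation "R \<equiv> coreflector K r e"

lemma D_subset: "N \<in> D \<Longrightarrow> N \<in> Obj K"
  using coreflection unfolding coreflection_def by blast

lemma r_closed: "A \<in> Obj K \<Longrightarrow> r A \<in> D"
  using coreflection unfolding coreflection_def by blast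

lemma e_closed: "A \<in> Obj K \<Longrightarrow> e A \<in> Mor K (r A) A"
  using coreflection unfolding coreflection_def by blast

lemma couniversal: "\<lbrakk>A \<in> Obj K; N \<in> D\<rbrakk> \<Longrightarrow> bij_betw (\<lambda>g. e A \<cdot> g) (Mor K N (r A)) (Mor K N A)"
  using coreflection unfolding coreflection_def by blast

lemma couniversal_ex:
  assumes "A \<in> Obj K" "N \<in> D" "f \<in> Mor K N A"
  obtains g where "g \<in> Mor K N (r A)" "e A \<cdot> g = f"
  using couniversal[OF assms(1,2)] assms(3) unfolding bij_betw_def by (metis imageE)

lemma couniversal_eq:
  assumes "A \<in> Obj K" "N \<in> D" "g \<in> Mor K N (r A)" "g' \<in> Mor K N (r A)" "e A \<cdot> g = e A \<cdot> g'"
  shows "g = g'"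
  using couniversal[OF assms(1,2)] assms(3-) unfolding bij_betw_def inj_on_def by blast

lemma on_mor_ex1:
  assumes "A \<in> Obj K" "B \<in> Obj K" "f \<in> Mor K A B"
  shows "\<exists>!g. g \<in> Mor K (r A) (r B) \<and> e B \<cdot> g = f \<cdot> e A"
proof -
  have "f \<cdot> e A \<in> Mor K (r A) B"
    using assms comp_closed e_closed r_closed D_subset by meson
  then obtain g where "g \<in> Mor K (r A) (r B)" "e B \<cdot> g = f \<cdot> e A"
    using couniversal_ex assms r_closed by metis
  then show ?thesis using couniversal_eq assms r_closed by metis
qed

lemma on_mor_eq_the:
  assumes "A \<in> Obj K" "B \<in> Obj K" "f \<in> Mor K A B"
  shows "on_mor R f = (THE g. g \<in> Mor K (r A) (r B) \<and> e B \<cdot> g = f \<cdot> e A)"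
proof -
  have "(\<exists>A' \<in> Obj K. \<exists>B' \<in> Obj K. f \<in> Mor K A' B' \<and> g \<in> Mor K (r A') (r B') \<and> e B' \<cdot> g = f \<cdot> e A')
      \<longleftrightarrow> g \<in> Mor K (r A) (r B) \<and> e B \<cdot> g = f \<cdot> e A" for g
    using assms hom_disjoint by metis
  then show ?thesis by (simp add: coreflector_def)
qed

lemma
  assumes "A \<in> Obj K" "B \<in> Obj K" "f \<in> Mor K A B"
  shows on_mor_closed: "on_mor R f \<in> Mor K (r A) (r B)"
    and on_mor_square: "e B \<cdot> on_mor R f = f \<cdot> e A"
  using theI'[OF on_mor_ex1[OF assms]] on_mor_eq_the[OF assms] by auto

lemma on_mor_eqI:
  assumes "A \<in> Obj K" "B \<in> Obj K" "f \<in> Mor K A B" "g \<in> Mor K (r A) (r B)" "e B \<cdot> g = f \<cdot> e A"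
  shows "on_mor R f = g"
  using on_mor_ex1[OF assms(1-3)] assms(4,5) on_mor_closed[OF assms(1-3)] on_mor_square[OF assms(1-3)]
  by blast

text \<open>Identities, sums and composites of completing morphisms complete the corresponding
  squares themselves, so uniqueness of the completion gives every preservation property.\<close>

lemma additive_functor_coreflector: "additive_functor K (full_subcategory K D) R"
  unfolding additive_functor_def is_functor_def full_subcategory_simps
proof (intro conjI ballI)
  fix A assume A: "A \<in> Obj K"
  show "on_obj R A \<in> D" using A r_closed by simp
  show "on_mor R (Ident K A) = Ident K (on_obj R A)"
    using A on_mor_eqI[of A A "Ident K A" "Ident K (r A)"] ident_closed r_closed D_subset e_closed
      comp_ident_left[of "r A" A "e A"] comp_ident_right[of "r A" A "e A"] by simp
  fix B assume B: "B \<in> Obj K"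
  show f: "on_mor R f \<in> Mor K (on_obj R A) (on_obj R B)" if "f \<in> Mor K A B" for f
    using on_mor_closed[OF A B that] by simp
  show "on_mor R \<in> hom (Hom K A B) (Hom K (on_obj R A) (on_obj R B))"
    unfolding hom_def
  proof (intro CollectI conjI ballI)
    show "on_mor R \<in> Mor K A B \<rightarrow> Mor K (on_obj R A) (on_obj R B)" using f by blast
    fix f g assume fg: "f \<in> Mor K A B" "g \<in> Mor K A B"
    note c = on_mor_closed[OF A B fg(1)] on_mor_closed[OF A B fg(2)]
    have "e B \<cdot> add_mor K (r A) (r B) (on_mor R f) (on_mor R g) = add_mor K A B f g \<cdot> e A"
      using A B fg c comp_add_left[of "r A" A B "e A" f g]
        comp_add_right[of "r A" "r B" B "on_mor R f" "on_mor R g" "e B"]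
      by (simp add: e_closed on_mor_square[OF A B] r_closed D_subset)
    then show "on_mor R (add_mor K A B f g) =
        add_mor K (on_obj R A) (on_obj R B) (on_mor R f) (on_mor R g)"
      using on_mor_eqI[OF A B add_closed[OF A B fg], of "add_mor K (r A) (r B) (on_mor R f) (on_mor R g)"]
        add_closed[of "r A" "r B"] A B c r_closed D_subset by simp
  qed
  fix C f g assume C: "C \<in> Obj K" and f: "f \<in> Mor K A B" and g: "g \<in> Mor K B C"
  note c = on_mor_closed[OF A B f] on_mor_closed[OF B C g]
  have "e C \<cdot> on_mor R g \<cdot> on_mor R f = (e C \<cdot> on_mor R g) \<cdot> on_mor R f"
    using comp_assoc[of "r A" "r B" "r C" C] A B C c e_closed r_closed D_subset by simp
  also have "\<dots> = g \<cdot> e B \<cdot> on_mor R f"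
    using comp_assoc[of "r A" "r B" B C] on_mor_square[OF B C g] A B C c f g e_closed r_closed D_subset
    by simp
  also have "\<dots> = (g \<cdot> f) \<cdot> e A"
    using comp_assoc[of "r A" A B C] on_mor_square[OF A B f] A B C c f g e_closed r_closed D_subset
    by simp
  finally show "on_mor R (g \<cdot> f) = on_mor R g \<cdot> on_mor R f"
    using on_mor_eqI[OF A C comp_closed[OF A B C f g], of "on_mor R g \<cdot> on_mor R f"]
      comp_closed[of "r A" "r B" "r C", OF _ _ _ c] A B C r_closed D_subset by simp
qed

lemma is_functor_coreflector: "is_functor K (full_subcategory K D) R"
  using additive_functor_coreflector unfolding additive_functor_def by blast

lemma adjoint_inclusion_coreflector: "adjoint (full_subcategory K D) K inclusion R"
proof -
  \<comment> \<open>The transpose of \<open>f\<close> is its unique lift along the counit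
    \<open>e B\<close>. Naturality below is tested after composing with \<open>e B'\<close>, which
    is injective on morphisms from \<open>A'\<close>.\<close>
  define \<phi> where "\<phi> A B = inv_into (Mor K A (r B)) (\<lambda>g. e B \<cdot> g)" for A B
  have \<phi>: "\<phi> A B f \<in> Mor K A (r B)" "e B \<cdot> \<phi> A B f = f"
    if "A \<in> D" "B \<in> Obj K" "f \<in> Mor K A B" for A B f
    using couniversal[OF that(2,1)] that(3) unfolding \<phi>_def
    by (auto simp: bij_betw_def inv_into_into f_inv_into_f)
  have "bij_betw (\<phi> A B) (Mor K A B) (Mor K A (r B))" if "A \<in> D" "B \<in> Obj K" for A B
    unfolding \<phi>_def using couniversal[OF that(2,1)] bij_betw_inv_into by blast
  moreover have "\<phi> A' B' (b \<cdot> f \<cdot> a) = on_mor R b \<cdot> \<phi> A B f \<cdot> a"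
    if obj: "A \<in> D" "A' \<in> D" "B \<in> Obj K" "B' \<in> Obj K"
      and a: "a \<in> Mor K A' A" and b: "b \<in> Mor K B B'" and f: "f \<in> Mor K A B" for A A' B B' a b f
  proof -
    let ?g = "\<phi> A B f" and ?b = "on_mor R b"
    note o = obj D_subset[OF obj(1)] D_subset[OF obj(2)] D_subset[OF r_closed[OF obj(3)]]
      D_subset[OF r_closed[OF obj(4)]]
    note m = a b f \<phi>[OF obj(1,3) f] on_mor_closed[OF obj(3,4) b] e_closed[OF obj(3)] e_closed[OF obj(4)]
    have ga: "?g \<cdot> a \<in> Mor K A' (r B)" and fa: "f \<cdot> a \<in> Mor K A' B"
      using o m comp_closed by blast+
    then have bga: "?b \<cdot> ?g \<cdot> a \<in> Mor K A' (r B')" and bfa: "b \<cdot> f \<cdot> a \<in> Mor K A' B'"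
      using o m comp_closed by blast+
    have "e B' \<cdot> ?b \<cdot> ?g \<cdot> a = (e B' \<cdot> ?b) \<cdot> ?g \<cdot> a"
      using comp_assoc[of A' "r B" "r B'" B'] o m ga by simp
    also have "\<dots> = b \<cdot> e B \<cdot> ?g \<cdot> a"
      using comp_assoc[of A' "r B" B B'] on_mor_square[OF obj(3,4) b] o m ga by simp
    also have "e B \<cdot> ?g \<cdot> a = f \<cdot> a"
      using comp_assoc[of A' A "r B" B a ?g "e B"] o m by simp
    finally show ?thesis
      using couniversal_eq[OF obj(4,2) \<phi>(1)[OF obj(2,4) bfa] bga] \<phi>(2)[OF obj(2,4) bfa] by simp
  qed
  moreover have "is_functor (full_subcategory K D) K inclusion"
    using additive_functor_inclusion[OF preadditive_category_axioms, of D] D_subset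
    unfolding additive_functor_def by blast
  ultimately show ?thesis
    unfolding adjoint_def full_subcategory_simps inclusion_simps on_obj_coreflector
    by (intro conjI exI[of _ \<phi>] ballI is_functor_coreflector)
qed

end

lemma reflection_adjoint:
  assumes "preadditive_category K" "reflection K D s n"
  shows "adjoint K (full_subcategory K D) (coreflector (dual K) s n) inclusion"
proof -
  interpret K: preadditive_category K by fact
  interpret coreflective "dual K" D s n
    using K.preadditive_dual assms(2) by (simp add: coreflective_def coreflective_axioms_def coreflection_dual)
  have "preadditive_category (full_subcategory K D)"
    using preadditive_full_subcategory assms unfolding reflection_def by blast
  then show ?thesis
    using adjoint_dual[OF assms(1)] adjoint_inclusion_coreflector by (simp add: full_subcategory_dual)
qed

lemma coreflection_adjoint:
  assumes "preadditive_category K" "coreflection K D r e"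
  shows "adjoint (full_subcategory K D) K inclusion (coreflector K r e)"
proof -
  interpret coreflective K D r e
    using assms by (simp add: coreflective_def coreflective_axioms_def)
  show ?thesis by (rule adjoint_inclusion_coreflector)
qed

text \<open>
  The bijections \<open>Hom(r A, B) \<cong> Hom(r A, s B) \<cong> Hom(A, s B)\<close> from \<open>M_unit\<close> and \<open>Y_counit\<close> will be the
  adjunction between \<open>r\<close> and \<open>s\<close>. Passing to the dual category exchanges \<open>M\<close> with \<open>Y\<close>, so only one of
  the two recollements needs a direct proof.
\<close>

locale recollement_data = additive_category K
  for K :: "('o, 'm) category" (structure) +
  fixes V M Y r e s n rV eV sV nV
  assumes additive_V: "additive_category (full_subcategory K V)"
    and additive_M: "additive_category (full_subcategory K M)"
    and additive_Y: "additive_category (full_subcategory K Y)"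
    and coreflection_M: "coreflection K M r e"
    and reflection_Y: "reflection K Y s n"
    and coreflection_V: "coreflection K V rV eV"
    and reflection_V: "reflection K V sV nV"
    and M_unit: "\<lbrakk>N \<in> M; A \<in> Obj K\<rbrakk> \<Longrightarrow> bij_betw (\<lambda>g. n A \<cdot> g) (Mor K N A) (Mor K N (s A))"
    and Y_counit: "\<lbrakk>N \<in> Y; A \<in> Obj K\<rbrakk> \<Longrightarrow> bij_betw (\<lambda>g. g \<cdot> e A) (Mor K A N) (Mor K (r A) N)"
    and M_kernel: "A \<in> Obj K \<Longrightarrow> zero_object K (r A) \<longleftrightarrow> A \<in> V"
    and Y_kernel: "A \<in> Obj K \<Longrightarrow> zero_object K (s A) \<longleftrightarrow> A \<in> V"
begin

lemma subsets: "V \<subseteq> Obj K" "M \<subseteq> Obj K" "Y \<subseteq> Obj K"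
  using coreflection_V coreflection_M reflection_Y unfolding coreflection_def reflection_def by auto

lemma recollement_data_dual: "recollement_data (dual K) V Y M s n r e sV nV rV eV"
proof (intro recollement_data.intro recollement_data_axioms.intro)
  show "additive_category (dual K)" using additive_dual additive_category_axioms by blast
qed (use additive_V additive_M additive_Y coreflection_M reflection_Y coreflection_V reflection_V
      M_unit Y_counit M_kernel Y_kernel in
    \<open>simp_all add: full_subcategory_dual additive_dual coreflection_dual reflection_dual zero_object_dual\<close>)

sublocale M: coreflective K M r e
  using coreflection_M by unfold_locales

sublocale Y: coreflective "dual K" Y s n
  using preadditive_dual reflection_Y
  by (simp add: coreflective_def coreflective_axioms_def coreflection_dual)

abbreviation "G \<equiv> coreflector K r e"

abbreviation "H \<equiv> coreflector (dual K) s n"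

text \<open>\<open>H\<close> has two roles: with target \<open>Y\<close> it is the reflector, the
  functor of the second recollement; restricted to \<open>M\<close> it is the right adjoint of
  \<open>G\<close>.\<close>

lemma is_functor_H: "is_functor (full_subcategory K M) K H"
  using is_functor_restrict[of K Y H M] Y.is_functor_coreflector subsets
  by (simp add: full_subcategory_dual is_functor_dual)

lemma adjoint_G_H: "adjoint K (full_subcategory K M) G H"
proof -
  \<comment> \<open>\<open>\<phi> A B f\<close> is the unique \<open>A \<rightarrow> s B\<close>
    whose composite with \<open>e A\<close> is \<open>n B \<cdot> f\<close>: compose with the unit,
    then extend along the counit.\<close>
  define \<phi> where "\<phi> A B f = inv_into (Mor K A (s B)) (\<lambda>g. g \<cdot> e A) (n B \<cdot> f)" for A B f
  have sB: "s B \<in> Y" "s B \<in> Obj K" "n B \<in> Mor K B (s B)" if "B \<in> Obj K" for B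
    using Y.r_closed Y.e_closed subsets that by auto
  have rA: "r A \<in> M" "r A \<in> Obj K" "e A \<in> Mor K (r A) A" if "A \<in> Obj K" for A
    using M.r_closed M.e_closed subsets that by auto
  have nf: "n B \<cdot> f \<in> Mor K (r A) (s B)" if "A \<in> Obj K" "B \<in> Obj K" "f \<in> Mor K (r A) B" for A B f
    using that comp_closed[of "r A" B "s B" f "n B"] sB rA by simp
  have \<phi>: "\<phi> A B f \<in> Mor K A (s B)" "\<phi> A B f \<cdot> e A = n B \<cdot> f"
    if "A \<in> Obj K" "B \<in> Obj K" "f \<in> Mor K (r A) B" for A B f
    using Y_counit[OF sB(1)[OF that(2)] that(1)] nf[OF that] bij_betw_inv_into_right
      bij_betw_apply[OF bij_betw_inv_into] unfolding \<phi>_def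
    by fastforce+
  have "bij_betw (\<phi> A B) (Mor K (r A) B) (Mor K A (s B))" if "A \<in> Obj K" "B \<in> M" for A B
  proof -
    have B: "B \<in> Obj K" using that subsets by auto
    have "bij_betw (inv_into (Mor K A (s B)) (\<lambda>g. g \<cdot> e A) \<circ> (\<lambda>f. n B \<cdot> f))
        (Mor K (r A) B) (Mor K A (s B))"
      by (rule bij_betw_trans[OF M_unit[OF rA(1)[OF that(1)] B]
            bij_betw_inv_into[OF Y_counit[OF sB(1)[OF B] that(1)]]])
    then show ?thesis unfolding \<phi>_def comp_def .
  qed
  moreover have "\<phi> A' B' (b \<cdot> f \<cdot> on_mor G a) = on_mor H b \<cdot> \<phi> A B f \<cdot> a"
    if obj: "A \<in> Obj K" "A' \<in> Obj K" "B \<in> M" "B' \<in> M"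
      and a: "a \<in> Mor K A' A" and b: "b \<in> Mor K B B'" and f: "f \<in> Mor K (r A) B" for A A' B B' a b f
  proof -
    let ?g = "\<phi> A B f" and ?a = "on_mor G a" and ?b = "on_mor H b"
    have B: "B \<in> Obj K" "B' \<in> Obj K" using obj subsets by auto
    note o = obj(1,2) B rA[OF obj(1)] rA[OF obj(2)] sB[OF B(1)] sB[OF B(2)]
    have a': "?a \<in> Mor K (r A') (r A)" "e A \<cdot> ?a = a \<cdot> e A'"
      using M.on_mor_closed[OF obj(2,1) a] M.on_mor_square[OF obj(2,1) a] .
    have b': "?b \<in> Mor K (s B) (s B')" "?b \<cdot> n B = n B' \<cdot> b"
      using Y.on_mor_closed[of B' B b] Y.on_mor_square[of B' B b] B b by auto
    note m = o a b f a'(1) b'(1) \<phi>(1)[OF obj(1) B(1) f]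
    have ga: "?g \<cdot> a \<in> Mor K A' (s B)" and fa: "f \<cdot> ?a \<in> Mor K (r A') B"
      using m comp_closed by blast+
    then have bga: "?b \<cdot> ?g \<cdot> a \<in> Mor K A' (s B')" and bfa: "b \<cdot> f \<cdot> ?a \<in> Mor K (r A') B'"
      using m comp_closed by blast+
    have "(?b \<cdot> ?g \<cdot> a) \<cdot> e A' = ?b \<cdot> (?g \<cdot> a) \<cdot> e A'"
      using comp_assoc[of "r A'" A' "s B" "s B'"] m ga by simp
    also have "(?g \<cdot> a) \<cdot> e A' = ?g \<cdot> e A \<cdot> ?a"
      using comp_assoc[of "r A'" A' A "s B"] m a' by simp
    also have "?g \<cdot> e A \<cdot> ?a = (?g \<cdot> e A) \<cdot> ?a"
      using comp_assoc[of "r A'" "r A" A "s B"] m by simp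
    also have "\<dots> = n B \<cdot> f \<cdot> ?a"
      using comp_assoc[of "r A'" "r A" B "s B"] m \<phi>(2)[OF obj(1) B(1) f] by simp
    also have "?b \<cdot> n B \<cdot> f \<cdot> ?a = (?b \<cdot> n B) \<cdot> f \<cdot> ?a"
      using comp_assoc[of "r A'" B "s B" "s B'"] m fa by simp
    also have "\<dots> = n B' \<cdot> b \<cdot> f \<cdot> ?a"
      using comp_assoc[of "r A'" B B' "s B'"] m fa b' by simp
    also have "\<dots> = \<phi> A' B' (b \<cdot> f \<cdot> ?a) \<cdot> e A'"
      using \<phi>(2)[OF obj(2) B(2) bfa] by simp
    finally show ?thesis
      using Y_counit[OF sB(1)[OF B(2)] obj(2)] bga \<phi>(1)[OF obj(2) B(2) bfa]
      unfolding bij_betw_def inj_on_def by metis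
  qed
  ultimately show ?thesis
    unfolding adjoint_def full_subcategory_simps on_obj_coreflector
    using M.is_functor_coreflector is_functor_H by (intro conjI exI[of _ \<phi>] ballI)
qed

text \<open>Two bijections compose: \<open>Hom(A, B) \<cong> Hom(A, s B)\<close> by
  \<open>M_unit\<close>, and \<open>Hom(A, s B) \<cong> Hom(s A, s B)\<close> by the reflection. The
  naturality square of the unit shows that the composite is the action of \<open>H\<close>.\<close>

lemma fully_faithful_H: "fully_faithful (full_subcategory K M) K H"
  unfolding fully_faithful_def full_subcategory_simps on_obj_coreflector
proof (intro ballI)
  fix A B assume AB: "A \<in> M" "B \<in> M"
  then have o: "A \<in> Obj K" "B \<in> Obj K" using subsets by auto
  have "s A \<in> Y" "s B \<in> Y" using Y.r_closed o by auto
  have b: "bij_betw (\<lambda>g. g \<cdot> n A) (Mor K (s A) (s B)) (Mor K A (s B))"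
    using Y.couniversal[of A "s B"] o \<open>s B \<in> Y\<close> by simp
  have "bij_betw (inv_into (Mor K (s A) (s B)) (\<lambda>g. g \<cdot> n A) \<circ> (\<lambda>f. n B \<cdot> f))
      (Mor K A B) (Mor K (s A) (s B))"
    using bij_betw_trans M_unit[OF AB(1) o(2)] bij_betw_inv_into[OF b] by blast
  moreover have "on_mor H f = (inv_into (Mor K (s A) (s B)) (\<lambda>g. g \<cdot> n A) \<circ> (\<lambda>f. n B \<cdot> f)) f"
    if "f \<in> Mor K A B" for f
  proof -
    have "on_mor H f \<in> Mor K (s A) (s B)" "on_mor H f \<cdot> n A = n B \<cdot> f"
      using Y.on_mor_closed[of B A f] Y.on_mor_square[of B A f] o that by simp_all
    then show ?thesis using bij_betw_inv_into_left[OF b, of "on_mor H f"] by simp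
  qed
  ultimately show "bij_betw (on_mor H) (Mor K A B) (Mor K (s A) (s B))"
    by (simp add: bij_betw_cong[of "Mor K A B" "on_mor H"] comp_def)
qed

lemma zero_object_subcategory:
  assumes "D \<subseteq> Obj K" "Z \<in> D"
  shows "zero_object (full_subcategory K D) Z \<longleftrightarrow> zero_object K Z"
proof -
  interpret D: preadditive_category "full_subcategory K D"
    using preadditive_full_subcategory preadditive_category_axioms assms(1) .
  show ?thesis
    using assms unfolding zero_object_iff D.zero_object_iff by auto
qed

text \<open>Closure of \<open>V\<close> under isomorphism in \<open>K\<close> is recovered from
  \<open>M_kernel\<close>: \<open>G\<close> preserves isomorphisms, and vanishing of
  \<open>r A\<close> characterizes \<open>V\<close>.\<close>

lemma kernel_G: "functor_image (full_subcategory K V) K inclusion = functor_kernel K (full_subcategory K M) G"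
proof -
  interpret KM: additive_category "full_subcategory K M" by (rule additive_M)
  have M: "r A \<in> Obj (full_subcategory K M)" if "A \<in> Obj K" for A
    using that M.r_closed by simp
  have iso: "isomorphic (full_subcategory K M) (r A) (r B)"
    if o: "A \<in> Obj K" "B \<in> Obj K" and isoAB: "isomorphic K A B" for A B
  proof -
    obtain f g where fg: "f \<in> Mor K A B" "g \<in> Mor K B A" "g \<cdot> f = Ident K A" "f \<cdot> g = Ident K B"
      using isoAB unfolding isomorphic_def isomorphism_def by blast
    have "is_functor K (full_subcategory K M) G" using M.is_functor_coreflector .
    then have "on_mor G g \<cdot> on_mor G f = Ident K (r A)" "on_mor G f \<cdot> on_mor G g = Ident K (r B)"
      using o fg unfolding is_functor_def by (metis full_subcategory_simps(3,4) on_obj_coreflector)+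
    then show ?thesis
      using M.on_mor_closed[OF o fg(1)] M.on_mor_closed[OF o(2,1) fg(2)]
      unfolding isomorphic_def isomorphism_def by auto
  qed
  have z: "zero_object (full_subcategory K M) (r A) \<longleftrightarrow> A \<in> V" if "A \<in> Obj K" for A
    using zero_object_subcategory[OF subsets(2)] M_kernel M.r_closed that by blast
  show ?thesis
  proof (intro equalityI subsetI)
    fix A assume "A \<in> functor_image (full_subcategory K V) K inclusion"
    then obtain B where AB: "A \<in> Obj K" "B \<in> V" "isomorphic K A B"
      unfolding functor_image_def by auto
    then show "A \<in> functor_kernel K (full_subcategory K M) G"
      using z[of B] iso subsets unfolding functor_kernel_def on_obj_coreflector by blast
  next
    fix A assume "A \<in> functor_kernel K (full_subcategory K M) G"
    then obtain Z where A: "A \<in> Obj K" and Z: "zero_object (full_subcategory K M) Z"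
      "isomorphic (full_subcategory K M) (r A) Z"
      unfolding functor_kernel_def by auto
    then have "A \<in> V" using KM.isomorphic_zero_object[OF Z M[OF A]] z by blast
    then show "A \<in> functor_image (full_subcategory K V) K inclusion"
      using A isomorphic_refl unfolding functor_image_def by auto
  qed
qed

lemma recollement_M: "recollement (full_subcategory K V) K (full_subcategory K M) inclusion G"
proof -
  have "additive_sequence (full_subcategory K V) K (full_subcategory K M) inclusion G"
    unfolding additive_sequence_def
    by (intro conjI additive_V additive_M additive_category_axioms M.additive_functor_coreflector
        additive_functor_inclusion[OF preadditive_category_axioms subsets(1)])
  note facts = this fully_faithful_inclusion kernel_G adjoint_G_H fully_faithful_H
    coreflection_adjoint[OF preadditive_category_axioms coreflection_V]
    reflection_adjoint[OF preadditive_category_axioms reflection_V]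
    coreflection_adjoint[OF preadditive_category_axioms coreflection_M]
  show ?thesis
    unfolding recollement_def localization_sequence_def colocalization_sequence_def
    by (rule exI conjI facts)+
qed

end

text \<open>The second recollement is the first one for the dual data, in which \<open>Y\<close>
  takes the place of \<open>M\<close>; dualizing back makes the inclusion of \<open>Y\<close> a
  right adjoint.\<close>

lemma (in recollement_data) two_recollements:
  "\<exists>F Fl Fr G Gl Gr G' G'l G'r.
    recollement (full_subcategory K V) K (full_subcategory K M) F G \<and>
    recollement (full_subcategory K V) K (full_subcategory K Y) F G' \<and>
    adjoint K (full_subcategory K V) Fl F \<and> adjoint (full_subcategory K V) K F Fr \<and>
    adjoint (full_subcategory K M) K Gl G \<and> adjoint K (full_subcategory K M) G Gr \<and>
    adjoint (full_subcategory K Y) K G'l G' \<and> adjoint K (full_subcategory K Y) G' G'r \<and>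
    F = inclusion \<and> Gl = inclusion \<and> G'r = inclusion"
proof -
  interpret op: recollement_data "dual K" V Y M s n r e sV nV rV eV
    by (rule recollement_data_dual)
  have Y1: "recollement (full_subcategory K V) K (full_subcategory K Y) inclusion H"
    using recollement_dual op.recollement_M unfolding full_subcategory_dual by blast
  have Y2: "adjoint (full_subcategory K Y) K G H"
    using op.adjoint_G_H adjoint_dual[of "full_subcategory K Y" K] preadditive_category_axioms additive_Y
    by (simp add: full_subcategory_dual additive_category_def)
  show ?thesis
    by (rule exI conjI refl recollement_M Y1 adjoint_G_H Y2
        coreflection_adjoint[OF preadditive_category_axioms coreflection_V]
        reflection_adjoint[OF preadditive_category_axioms reflection_V]
        coreflection_adjoint[OF preadditive_category_axioms coreflection_M]
        reflection_adjoint[OF preadditive_category_axioms reflection_Y])+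
qed


section \<open>The quotient by an ideal of morphisms\<close>

context preadditive_category
begin

definition arr :: "'b \<Rightarrow> 'a \<Rightarrow> 'a \<Rightarrow> bool"  (\<open>(_/ \<Colon> _ \<rightarrow> _)\<close> [51, 51, 51] 50)
  where "f \<Colon> A \<rightarrow> B \<longleftrightarrow> A \<in> Obj K \<and> B \<in> Obj K \<and> f \<in> Mor K A B"

lemma arrI: "\<lbrakk>A \<in> Obj K; B \<in> Obj K; f \<in> Mor K A B\<rbrakk> \<Longrightarrow> f \<Colon> A \<rightarrow> B"
  by (simp add: arr_def)

lemma arrD:
  assumes "f \<Colon> A \<rightarrow> B"
  shows "A \<in> Obj K" "B \<in> Obj K" "f \<in> Mor K A B"
  using assms by (simp_all add: arr_def)

lemma arr_comp: "\<lbrakk>f \<Colon> A \<rightarrow> B; g \<Colon> B \<rightarrow> C\<rbrakk> \<Longrightarrow> g \<cdot> f \<Colon> A \<rightarrow> C"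
  unfolding arr_def using comp_closed by blast

lemma arr_ident: "A \<in> Obj K \<Longrightarrow> Ident K A \<Colon> A \<rightarrow> A"
  unfolding arr_def using ident_closed by blast

lemma arr_zero: "\<lbrakk>A \<in> Obj K; B \<in> Obj K\<rbrakk> \<Longrightarrow> zero_mor K A B \<Colon> A \<rightarrow> B"
  unfolding arr_def using zero_closed by blast

lemma arr_add: "\<lbrakk>f \<Colon> A \<rightarrow> B; g \<Colon> A \<rightarrow> B\<rbrakk> \<Longrightarrow> add_mor K A B f g \<Colon> A \<rightarrow> B"
  unfolding arr_def using add_closed by blast

lemma assoc: "\<lbrakk>f \<Colon> A \<rightarrow> B; g \<Colon> B \<rightarrow> C; h \<Colon> C \<rightarrow> D\<rbrakk> \<Longrightarrow> (h \<cdot> g) \<cdot> f = h \<cdot> g \<cdot> f"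
  unfolding arr_def using comp_assoc by blast

lemma ident_right: "f \<Colon> A \<rightarrow> B \<Longrightarrow> f \<cdot> Ident K A = f"
  unfolding arr_def using comp_ident_right by blast

lemma ident_left: "f \<Colon> A \<rightarrow> B \<Longrightarrow> Ident K B \<cdot> f = f"
  unfolding arr_def using comp_ident_left by blast

lemma zero_right: "\<lbrakk>g \<Colon> B \<rightarrow> C; A \<in> Obj K\<rbrakk> \<Longrightarrow> g \<cdot> zero_mor K A B = zero_mor K A C"
  unfolding arr_def using comp_zero_right by blast

lemma zero_left: "\<lbrakk>f \<Colon> A \<rightarrow> B; C \<in> Obj K\<rbrakk> \<Longrightarrow> zero_mor K B C \<cdot> f = zero_mor K A C"
  unfolding arr_def using comp_zero_left by blast

lemma add_right: "\<lbrakk>f \<Colon> A \<rightarrow> B; f' \<Colon> A \<rightarrow> B; g \<Colon> B \<rightarrow> C\<rbrakk> \<Longrightarrow>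
    g \<cdot> add_mor K A B f f' = add_mor K A C (g \<cdot> f) (g \<cdot> f')"
  unfolding arr_def using comp_add_right by blast

lemma add_left: "\<lbrakk>f \<Colon> A \<rightarrow> B; g \<Colon> B \<rightarrow> C; g' \<Colon> B \<rightarrow> C\<rbrakk> \<Longrightarrow>
    add_mor K B C g g' \<cdot> f = add_mor K A C (g \<cdot> f) (g' \<cdot> f)"
  unfolding arr_def using comp_add_left by blast

section \<open>Differences of parallel morphisms\<close>

definition neg :: "'a \<Rightarrow> 'a \<Rightarrow> 'b \<Rightarrow> 'b"
  where "neg A B f = inv\<^bsub>Hom K A B\<^esub> f"

definition diff :: "'a \<Rightarrow> 'a \<Rightarrow> 'b \<Rightarrow> 'b \<Rightarrow> 'b"
  where "diff A B f g = add_mor K A B f (neg A B g)"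

lemma arr_neg: "f \<Colon> A \<rightarrow> B \<Longrightarrow> neg A B f \<Colon> A \<rightarrow> B"
  unfolding arr_def neg_def using hom_group by (meson comm_group_def group.inv_closed)

lemma arr_diff: "\<lbrakk>f \<Colon> A \<rightarrow> B; g \<Colon> A \<rightarrow> B\<rbrakk> \<Longrightarrow> diff A B f g \<Colon> A \<rightarrow> B"
  unfolding diff_def using arr_add arr_neg by blast

lemma add_neg: "f \<Colon> A \<rightarrow> B \<Longrightarrow> add_mor K A B f (neg A B f) = zero_mor K A B"
  unfolding arr_def neg_def using hom_group comm_group.axioms(2) group.r_inv by metis

lemma add_assoc: "\<lbrakk>f \<Colon> A \<rightarrow> B; g \<Colon> A \<rightarrow> B; h \<Colon> A \<rightarrow> B\<rbrakk> \<Longrightarrow>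
    add_mor K A B (add_mor K A B f g) h = add_mor K A B f (add_mor K A B g h)"
  unfolding arr_def using hom_group by (meson comm_group_def group.is_monoid monoid.m_assoc)

lemma add_commute: "\<lbrakk>f \<Colon> A \<rightarrow> B; g \<Colon> A \<rightarrow> B\<rbrakk> \<Longrightarrow> add_mor K A B f g = add_mor K A B g f"
  unfolding arr_def using hom_group by (meson comm_group_def comm_monoid.m_comm)

lemma add_zero: "f \<Colon> A \<rightarrow> B \<Longrightarrow> add_mor K A B f (zero_mor K A B) = f"
  unfolding arr_def using hom_group by (meson comm_group_def group.is_monoid monoid.r_one)

lemma zero_add: "f \<Colon> A \<rightarrow> B \<Longrightarrow> add_mor K A B (zero_mor K A B) f = f"
  unfolding arr_def using hom_group by (meson comm_group_def group.is_monoid monoid.l_one)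

lemma neg_unique:
  assumes "f \<Colon> A \<rightarrow> B" "g \<Colon> A \<rightarrow> B" "add_mor K A B f g = zero_mor K A B"
  shows "g = neg A B f"
  using assms add_assoc add_commute add_zero add_neg arr_neg by metis

lemma comp_neg_left:
  assumes "f \<Colon> A \<rightarrow> B" "g \<Colon> B \<rightarrow> C"
  shows "neg B C g \<cdot> f = neg A C (g \<cdot> f)"
  using neg_unique[OF arr_comp[OF assms] arr_comp[OF assms(1) arr_neg[OF assms(2)]]]
    add_left[OF assms arr_neg[OF assms(2)]] add_neg[OF assms(2)] zero_left[OF assms(1)] arrD(2)[OF assms(2)]
  by simp

lemma comp_neg_right:
  assumes "f \<Colon> A \<rightarrow> B" "g \<Colon> B \<rightarrow> C"
  shows "g \<cdot> neg A B f = neg A C (g \<cdot> f)"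
  using neg_unique[OF arr_comp[OF assms] arr_comp[OF arr_neg[OF assms(1)] assms(2)]]
    add_right[OF assms(1) arr_neg[OF assms(1)] assms(2)] add_neg[OF assms(1)] zero_right[OF assms(2)]
    arrD(1)[OF assms(1)]
  by simp

lemma diff_left:
  assumes "f \<Colon> A \<rightarrow> B" "g \<Colon> B \<rightarrow> C" "g' \<Colon> B \<rightarrow> C"
  shows "diff B C g g' \<cdot> f = diff A C (g \<cdot> f) (g' \<cdot> f)"
  unfolding diff_def using add_left[OF assms(1,2) arr_neg[OF assms(3)]] comp_neg_left[OF assms(1,3)] by simp

lemma diff_right:
  assumes "f \<Colon> A \<rightarrow> B" "f' \<Colon> A \<rightarrow> B" "g \<Colon> B \<rightarrow> C"
  shows "g \<cdot> diff A B f f' = diff A C (g \<cdot> f) (g \<cdot> f')"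
  unfolding diff_def using add_right[OF assms(1) arr_neg[OF assms(2)] assms(3)] comp_neg_right[OF assms(2,3)]
  by simp

lemma diff_self: "f \<Colon> A \<rightarrow> B \<Longrightarrow> diff A B f f = zero_mor K A B"
  unfolding diff_def by (rule add_neg)

lemma add_diff:
  assumes "f \<Colon> A \<rightarrow> B" "g \<Colon> A \<rightarrow> B"
  shows "add_mor K A B g (diff A B f g) = f"
  using assms add_assoc add_commute add_zero add_neg arr_neg arr_add unfolding diff_def by metis

lemma diff_add:
  assumes "f \<Colon> A \<rightarrow> B" "g \<Colon> A \<rightarrow> B"
  shows "diff A B (add_mor K A B f g) g = f"
  unfolding diff_def using assms add_assoc add_neg arr_neg add_zero by metis

lemma diff_diff:
  assumes "f \<Colon> A \<rightarrow> B" "g \<Colon> A \<rightarrow> B"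
  shows "diff A B f (diff A B f g) = g"
  using diff_add[OF assms(2) arr_diff[OF assms]] add_diff[OF assms] by simp

end

locale ideal_quotient = additive_category K
  for K :: "('o, 'm, 'z) category_scheme" (structure) +
  fixes W
  assumes W: "additive_subcategory K W"
begin

abbreviation "fac \<equiv> factoring K W"

definition cls :: "'o \<Rightarrow> 'o \<Rightarrow> 'm \<Rightarrow> 'm set"
  where "cls A B f = fac A B #>\<^bsub>Hom K A B\<^esub> f"

abbreviation "Q \<equiv> quotient_category K W"

lemma W_subset: "N \<in> W \<Longrightarrow> N \<in> Obj K"
  using W unfolding additive_subcategory_def by blast

lemma facI: "\<lbrakk>N \<in> W; f \<Colon> A \<rightarrow> N; g \<Colon> N \<rightarrow> B\<rbrakk> \<Longrightarrow> g \<cdot> f \<in> fac A B"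
  unfolding factoring_def arr_def by blast

lemma facE:
  assumes "h \<in> fac A B" "A \<in> Obj K" "B \<in> Obj K"
  obtains N f g where "N \<in> W" "f \<Colon> A \<rightarrow> N" "g \<Colon> N \<rightarrow> B" "h = g \<cdot> f"
  using assms W_subset unfolding factoring_def arr_def by blast

lemma arr_fac: "\<lbrakk>h \<in> fac A B; A \<in> Obj K; B \<in> Obj K\<rbrakk> \<Longrightarrow> h \<Colon> A \<rightarrow> B"
  by (elim facE) (auto intro: arr_comp)

lemma fac_comp_left:
  assumes "h \<in> fac A B" "g \<Colon> B \<rightarrow> C" "A \<in> Obj K"
  shows "g \<cdot> h \<in> fac A C"
proof -
  obtain N p q where *: "N \<in> W" "p \<Colon> A \<rightarrow> N" "q \<Colon> N \<rightarrow> B" "h = q \<cdot> p"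
    using facE assms arrD by metis
  then show ?thesis
    using facI[OF *(1,2) arr_comp[OF *(3) assms(2)]] assoc[OF *(2,3) assms(2)] by simp
qed

lemma fac_comp_right:
  assumes "h \<in> fac B C" "f \<Colon> A \<rightarrow> B" "C \<in> Obj K"
  shows "h \<cdot> f \<in> fac A C"
proof -
  obtain N p q where *: "N \<in> W" "p \<Colon> B \<rightarrow> N" "q \<Colon> N \<rightarrow> C" "h = q \<cdot> p"
    using facE assms arrD by metis
  then show ?thesis
    using facI[OF *(1) arr_comp[OF assms(2) *(2)] *(3)] assoc[OF assms(2) *(2,3)] by simp
qed

text \<open>Two factorizations add up to one through a biproduct of their middle objects, which can
  be chosen in \<open>W\<close>: \<open>u\<close> is the column with entries \<open>p\<close>,
  \<open>p'\<close> and \<open>v\<close> the row with entries \<open>q\<close>,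
  \<open>q'\<close>.\<close>

lemma fac_add:
  assumes "h \<in> fac A B" "h' \<in> fac A B" and o: "A \<in> Obj K" "B \<in> Obj K"
  shows "add_mor K A B h h' \<in> fac A B"
proof -
  obtain N p q where N: "N \<in> W" "p \<Colon> A \<rightarrow> N" "q \<Colon> N \<rightarrow> B" "h = q \<cdot> p"
    using assms(1) o by (rule facE)
  obtain N' p' q' where N': "N' \<in> W" "p' \<Colon> A \<rightarrow> N'" "q' \<Colon> N' \<rightarrow> B" "h' = q' \<cdot> p'"
    using assms(2) o by (rule facE)
  obtain P where P: "biproduct K N N' P" "Sum P \<in> W"
    using W N N' unfolding additive_subcategory_def by blast
  let ?S = "Sum P"
  have i: "inc1 P \<Colon> N \<rightarrow> ?S" "inc2 P \<Colon> N' \<rightarrow> ?S" "prj1 P \<Colon> ?S \<rightarrow> N" "prj2 P \<Colon> ?S \<rightarrow> N'"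
    using P N N' W_subset unfolding biproduct_def arr_def by auto
  have e: "prj1 P \<cdot> inc1 P = Ident K N" "prj2 P \<cdot> inc2 P = Ident K N'"
    "prj2 P \<cdot> inc1 P = zero_mor K N N'" "prj1 P \<cdot> inc2 P = zero_mor K N' N"
    using P unfolding biproduct_def by auto
  define u where "u = add_mor K A ?S (inc1 P \<cdot> p) (inc2 P \<cdot> p')"
  define v where "v = add_mor K ?S B (q \<cdot> prj1 P) (q' \<cdot> prj2 P)"
  note c = arr_comp[OF N(2) i(1)] arr_comp[OF N'(2) i(2)] arr_comp[OF i(3) N(3)] arr_comp[OF i(4) N'(3)]
  have u: "u \<Colon> A \<rightarrow> ?S" and v: "v \<Colon> ?S \<rightarrow> B"
    unfolding u_def v_def using arr_add c by blast+
  have "prj1 P \<cdot> u = add_mor K A N (prj1 P \<cdot> inc1 P \<cdot> p) (prj1 P \<cdot> inc2 P \<cdot> p')"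
    unfolding u_def using add_right[OF c(1,2) i(3)] .
  also have "\<dots> = p"
    using assoc[OF N(2) i(1,3)] assoc[OF N'(2) i(2,3)] e ident_left[OF N(2)] zero_left[OF N'(2)]
      add_zero[OF N(2)] arrD[OF N(2)] by simp
  finally have 1: "prj1 P \<cdot> u = p" .
  have "prj2 P \<cdot> u = add_mor K A N' (prj2 P \<cdot> inc1 P \<cdot> p) (prj2 P \<cdot> inc2 P \<cdot> p')"
    unfolding u_def using add_right[OF c(1,2) i(4)] .
  also have "\<dots> = p'"
    using assoc[OF N(2) i(1,4)] assoc[OF N'(2) i(2,4)] e ident_left[OF N'(2)] zero_left[OF N(2)]
      zero_add[OF N'(2)] arrD[OF N'(2)] by simp
  finally have 2: "prj2 P \<cdot> u = p'" .
  have "v \<cdot> u = add_mor K A B h h'"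
    unfolding v_def using add_left[OF u c(3,4)] assoc[OF u i(3) N(3)] assoc[OF u i(4) N'(3)] 1 2 N(4) N'(4)
    by simp
  then show ?thesis using facI[OF P(2) u v] by simp
qed

lemma fac_neg:
  assumes "h \<in> fac A B" "A \<in> Obj K" "B \<in> Obj K"
  shows "neg A B h \<in> fac A B"
proof -
  obtain N p q where *: "N \<in> W" "p \<Colon> A \<rightarrow> N" "q \<Colon> N \<rightarrow> B" "h = q \<cdot> p"
    using assms by (rule facE)
  then show ?thesis
    using facI[OF *(1,2) arr_neg[OF *(3)]] comp_neg_left[OF *(2,3)] by simp
qed

lemma subgroup_fac:
  assumes "A \<in> Obj K" "B \<in> Obj K"
  shows "subgroup (fac A B) (Hom K A B)"
proof (rule subgroup.intro)
  show "fac A B \<subseteq> Mor K A B" using arr_fac assms arrD by blast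
  show "zero_mor K A B \<in> fac A B"
  proof -
    obtain N where "N \<in> W" using W unfolding additive_subcategory_def by blast
    then show ?thesis
      using facI[OF _ arr_zero arr_zero] zero_right[OF arr_zero] assms W_subset by metis
  qed
  show "add_mor K A B h h' \<in> fac A B" if "h \<in> fac A B" "h' \<in> fac A B" for h h'
    using that assms fac_add by blast
  show "inv\<^bsub>Hom K A B\<^esub> h \<in> fac A B" if "h \<in> fac A B" for h
    using that assms fac_neg unfolding neg_def by blast
qed

lemma zero_fac: "\<lbrakk>A \<in> Obj K; B \<in> Obj K\<rbrakk> \<Longrightarrow> zero_mor K A B \<in> fac A B"
  using subgroup_fac subgroup.one_closed by blast

lemma cls_mem:
  assumes "f \<Colon> A \<rightarrow> B"
  shows "g \<in> cls A B f \<longleftrightarrow> g \<Colon> A \<rightarrow> B \<and> diff A B g f \<in> fac A B"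
proof -
  have o: "A \<in> Obj K" "B \<in> Obj K" "f \<in> Mor K A B" using arrD[OF assms] .
  then interpret H: comm_group "Hom K A B" using hom_group by blast
  interpret S: subgroup "fac A B" "Hom K A B" using subgroup_fac o by blast
  show ?thesis
    using S.rcos_module[OF H.is_group o(3), of g] S.elemrcos_carrier[OF H.is_group o(3), of g] o
    unfolding cls_def arr_def diff_def neg_def by blast
qed

lemma cls_eq_iff:
  assumes "f \<Colon> A \<rightarrow> B" "g \<Colon> A \<rightarrow> B"
  shows "cls A B f = cls A B g \<longleftrightarrow> diff A B f g \<in> fac A B"
proof
  have o: "A \<in> Obj K" "B \<in> Obj K" "g \<in> Mor K A B" using arrD[OF assms(2)] .
  then interpret H: comm_group "Hom K A B" using hom_group by blast
  assume "diff A B f g \<in> fac A B"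
  then have "f \<in> cls A B g" using cls_mem assms by blast
  then show "cls A B f = cls A B g"
    unfolding cls_def using H.repr_independence o subgroup_fac by metis
next
  assume *: "cls A B f = cls A B g"
  have "f \<in> cls A B f"
    using cls_mem[OF assms(1)] diff_self assms zero_fac arrD by metis
  then show "diff A B f g \<in> fac A B" using * cls_mem assms by blast
qed

lemma cls_self: "f \<Colon> A \<rightarrow> B \<Longrightarrow> f \<in> cls A B f"
  using cls_mem diff_self zero_fac arrD by metis

lemma cls_zero:
  assumes "f \<Colon> A \<rightarrow> B" "f \<in> fac A B"
  shows "cls A B f = fac A B"
  using assms group.coset_join2 hom_group arrD[OF assms(1)] subgroup_fac comm_group.axioms(2)
  unfolding cls_def by metis

section \<open>The quotient category in terms of representatives\<close>

lemma Obj_Q [simp]: "Obj Q = Obj K"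
  by (simp add: quotient_category_def)

lemma Mor_Q: "Mor Q A B = cls A B ` Mor K A B"
  by (simp add: quotient_category_def carrier_FactGroup cls_def)

lemma zero_Q: "zero_mor Q A B = fac A B"
  by (simp add: quotient_category_def)

lemma Ident_Q: "Ident Q A = cls A A (Ident K A)"
  by (simp add: quotient_category_def cls_def)

lemma Mor_QE:
  assumes "p \<in> Mor Q A B" "A \<in> Obj K" "B \<in> Obj K"
  obtains f where "f \<Colon> A \<rightarrow> B" "p = cls A B f"
  using assms unfolding Mor_Q arr_def by blast

lemma cls_closed: "f \<Colon> A \<rightarrow> B \<Longrightarrow> cls A B f \<in> Mor Q A B"
  unfolding Mor_Q using arrD by blast

lemma add_Q:
  assumes "f \<Colon> A \<rightarrow> B" "g \<Colon> A \<rightarrow> B"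
  shows "add_mor Q A B (cls A B f) (cls A B g) = cls A B (add_mor K A B f g)"
proof -
  have o: "A \<in> Obj K" "B \<in> Obj K" "f \<in> Mor K A B" "g \<in> Mor K A B" using arrD assms by auto
  interpret H: comm_group "Hom K A B" using hom_group o by blast
  interpret N: normal "fac A B" "Hom K A B" using H.subgroup_imp_normal subgroup_fac o by blast
  show ?thesis
    using N.rcos_sum o by (simp add: quotient_category_def cls_def)
qed

text \<open>The composite in the quotient is a union over all objects and all representatives.
  Disjointness of hom-sets fixes the objects, and since the factoring morphisms form an ideal all
  representatives give one coset; the union is thus over a singleton.\<close>

lemma comp_Q:
  assumes f: "f \<Colon> A \<rightarrow> B" and g: "g \<Colon> B \<rightarrow> C"
  shows "cls B C g \<cdot>\<^bsub>Q\<^esub> cls A B f = cls A C (g \<cdot> f)"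
proof -
  have *: "A' = A \<and> B' = B \<and> C' = C \<and> cls A' C' (g' \<cdot> f') = cls A C (g \<cdot> f)"
    if "A' \<in> Obj K" "B' \<in> Obj K" "C' \<in> Obj K" "f' \<in> cls A B f \<inter> Mor K A' B'"
      "g' \<in> cls B C g \<inter> Mor K B' C'" for A' B' C' f' g'
  proof -
    have f': "f' \<Colon> A \<rightarrow> B" "diff A B f' f \<in> fac A B" and g': "g' \<Colon> B \<rightarrow> C" "diff B C g' g \<in> fac B C"
      using that cls_mem f g by auto
    have eq: "A' = A" "B' = B" "C' = C"
      using that hom_disjoint[of A' B' A B f'] hom_disjoint[of B' C' B C g'] arrD[OF f'(1)] arrD[OF g'(1)] by auto
    have "g' \<cdot> diff A B f' f \<in> fac A C" "diff B C g' g \<cdot> f \<in> fac A C"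
      using fac_comp_left[OF f'(2) g'(1)] fac_comp_right[OF g'(2) f] arrD f g by auto
    moreover have "g' \<cdot> diff A B f' f = diff A C (g' \<cdot> f') (g' \<cdot> f)"
      "diff B C g' g \<cdot> f = diff A C (g' \<cdot> f) (g \<cdot> f)"
      using diff_right[OF f'(1) f g'(1)] diff_left[OF f g'(1) g] by auto
    ultimately have "cls A C (g' \<cdot> f') = cls A C (g' \<cdot> f)" "cls A C (g' \<cdot> f) = cls A C (g \<cdot> f)"
      using cls_eq_iff arr_comp f g f' g' by metis+
    then show ?thesis using eq by simp
  qed
  have "{cls A' C' (g' \<cdot> f') | A' B' C' f' g'. A' \<in> Obj K \<and> B' \<in> Obj K \<and> C' \<in> Obj K \<and>
      f' \<in> cls A B f \<inter> Mor K A' B' \<and> g' \<in> cls B C g \<inter> Mor K B' C'} = {cls A C (g \<cdot> f)}"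
  proof (intro equalityI subsetI)
    fix x assume "x \<in> {cls A C (g \<cdot> f)}"
    then show "x \<in> {cls A' C' (g' \<cdot> f') | A' B' C' f' g'. A' \<in> Obj K \<and> B' \<in> Obj K \<and> C' \<in> Obj K \<and>
      f' \<in> cls A B f \<inter> Mor K A' B' \<and> g' \<in> cls B C g \<inter> Mor K B' C'}"
      using cls_self[OF f] cls_self[OF g] arrD[OF f] arrD[OF g] by blast
  qed (use * in blast)
  then show ?thesis
    unfolding quotient_category_def cls_def[symmetric] by simp
qed

lemma preadditive_quotient: "preadditive_category Q"
proof (intro preadditive_category.intro; unfold Obj_Q)
  fix A B assume "A \<in> Obj K" "B \<in> Obj K"
  then show "comm_group (Hom Q A B)"
    using comm_group.abelian_FactGroup[OF hom_group subgroup_fac] by (simp add: quotient_category_def)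
next
  fix A B A' B' p
  assume o: "A \<in> Obj K" "B \<in> Obj K" "A' \<in> Obj K" "B' \<in> Obj K" and p: "p \<in> Mor Q A B" "p \<in> Mor Q A' B'"
  obtain f where f: "f \<Colon> A \<rightarrow> B" "p = cls A B f" using p(1) o(1,2) by (rule Mor_QE)
  obtain g where g: "g \<Colon> A' \<rightarrow> B'" "p = cls A' B' g" using p(2) o(3,4) by (rule Mor_QE)
  \<comment> \<open>A coset consists of morphisms with its own source and target, so disjointness
    descends from \<open>K\<close>.\<close>
  have "f \<Colon> A' \<rightarrow> B'" using cls_self[OF f(1)] cls_mem[OF g(1)] f(2) g(2) by simp
  then show "A = A' \<and> B = B'" using hom_disjoint o arrD f(1) by metis
next
  fix A assume "A \<in> Obj K"
  then show "Ident Q A \<in> Mor Q A A" unfolding Ident_Q by (intro cls_closed arr_ident)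
next
  fix A B C p q
  assume o: "A \<in> Obj K" "B \<in> Obj K" "C \<in> Obj K" and "p \<in> Mor Q A B" "q \<in> Mor Q B C"
  then show "q \<cdot>\<^bsub>Q\<^esub> p \<in> Mor Q A C"
    by (elim Mor_QE) (auto simp: comp_Q intro: cls_closed arr_comp)
next
  fix A B p assume "A \<in> Obj K" "B \<in> Obj K" "p \<in> Mor Q A B"
  then show "p \<cdot>\<^bsub>Q\<^esub> Ident Q A = p" "Ident Q B \<cdot>\<^bsub>Q\<^esub> p = p"
    by (elim Mor_QE; simp add: Ident_Q comp_Q[OF arr_ident] comp_Q[OF _ arr_ident] ident_left ident_right)+
next
  fix A B C D p q r
  assume o: "A \<in> Obj K" "B \<in> Obj K" "C \<in> Obj K" "D \<in> Obj K"
    and pqr: "p \<in> Mor Q A B" "q \<in> Mor Q B C" "r \<in> Mor Q C D"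
  obtain f where f: "f \<Colon> A \<rightarrow> B" "p = cls A B f" using pqr(1) o(1,2) by (rule Mor_QE)
  obtain g where g: "g \<Colon> B \<rightarrow> C" "q = cls B C g" using pqr(2) o(2,3) by (rule Mor_QE)
  obtain h where h: "h \<Colon> C \<rightarrow> D" "r = cls C D h" using pqr(3) o(3,4) by (rule Mor_QE)
  show "(r \<cdot>\<^bsub>Q\<^esub> q) \<cdot>\<^bsub>Q\<^esub> p = r \<cdot>\<^bsub>Q\<^esub> q \<cdot>\<^bsub>Q\<^esub> p"
    using f g h comp_Q[OF f(1) g(1)] comp_Q[OF g(1) h(1)] comp_Q[OF f(1) arr_comp[OF g(1) h(1)]]
      comp_Q[OF arr_comp[OF f(1) g(1)] h(1)] assoc[OF f(1) g(1) h(1)] by simp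
next
  fix A B C p p' q
  assume o: "A \<in> Obj K" "B \<in> Obj K" "C \<in> Obj K"
    and pq: "p \<in> Mor Q A B" "p' \<in> Mor Q A B" "q \<in> Mor Q B C"
  obtain f where f: "f \<Colon> A \<rightarrow> B" "p = cls A B f" using pq(1) o(1,2) by (rule Mor_QE)
  obtain f' where f': "f' \<Colon> A \<rightarrow> B" "p' = cls A B f'" using pq(2) o(1,2) by (rule Mor_QE)
  obtain g where g: "g \<Colon> B \<rightarrow> C" "q = cls B C g" using pq(3) o(2,3) by (rule Mor_QE)
  show "q \<cdot>\<^bsub>Q\<^esub> add_mor Q A B p p' = add_mor Q A C (q \<cdot>\<^bsub>Q\<^esub> p) (q \<cdot>\<^bsub>Q\<^esub> p')"
    using f(2) f'(2) g(2) comp_Q[OF f(1) g(1)] comp_Q[OF f'(1) g(1)] add_Q[OF f(1) f'(1)]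
      comp_Q[OF arr_add[OF f(1) f'(1)] g(1)] add_right[OF f(1) f'(1) g(1)]
      add_Q[OF arr_comp[OF f(1) g(1)] arr_comp[OF f'(1) g(1)]] by simp
next
  fix A B C p q q'
  assume o: "A \<in> Obj K" "B \<in> Obj K" "C \<in> Obj K"
    and pq: "p \<in> Mor Q A B" "q \<in> Mor Q B C" "q' \<in> Mor Q B C"
  obtain f where f: "f \<Colon> A \<rightarrow> B" "p = cls A B f" using pq(1) o(1,2) by (rule Mor_QE)
  obtain g where g: "g \<Colon> B \<rightarrow> C" "q = cls B C g" using pq(2) o(2,3) by (rule Mor_QE)
  obtain g' where g': "g' \<Colon> B \<rightarrow> C" "q' = cls B C g'" using pq(3) o(2,3) by (rule Mor_QE)
  show "add_mor Q B C q q' \<cdot>\<^bsub>Q\<^esub> p = add_mor Q A C (q \<cdot>\<^bsub>Q\<^esub> p) (q' \<cdot>\<^bsub>Q\<^esub> p)"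
    using f(2) g(2) g'(2) comp_Q[OF f(1) g(1)] comp_Q[OF f(1) g'(1)] add_Q[OF g(1) g'(1)]
      comp_Q[OF f(1) arr_add[OF g(1) g'(1)]] add_left[OF f(1) g(1) g'(1)]
      add_Q[OF arr_comp[OF f(1) g(1)] arr_comp[OF f(1) g'(1)]] by simp
qed

lemma zero_object_quotient:
  assumes "A \<in> Obj K"
  shows "zero_object Q A \<longleftrightarrow> Ident K A \<in> fac A A"
proof -
  interpret Q: preadditive_category Q by (rule preadditive_quotient)
  have "cls A A (Ident K A) = fac A A \<longleftrightarrow> Ident K A \<in> fac A A"
    using cls_zero cls_self arr_ident assms by metis
  then show ?thesis using assms by (simp add: Q.zero_object_iff Ident_Q zero_Q)
qed

lemma additive_sub_quotient:
  assumes "additive_subcategory K D"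
  shows "additive_category (sub_quotient K D W)"
proof -
  have D: "D \<subseteq> Obj K" using assms unfolding additive_subcategory_def by blast
  interpret Q: preadditive_category Q by (rule preadditive_quotient)
  interpret D: preadditive_category "sub_quotient K D W"
    unfolding sub_quotient_def using preadditive_full_subcategory[OF preadditive_quotient] D by simp
  show ?thesis
  proof
    obtain Z where Z: "Z \<in> D" "zero_object K Z"
      using assms unfolding additive_subcategory_def by blast
    then have "zero_object Q Z"
      using zero_object_quotient[of Z] zero_fac[of Z Z] D unfolding zero_object_iff by auto
    then show "\<exists>Z. zero_object (sub_quotient K D W) Z"
      using Z(1) unfolding D.zero_object_iff Q.zero_object_iff by (auto simp: sub_quotient_def)
    fix A B assume "A \<in> Obj (sub_quotient K D W)" "B \<in> Obj (sub_quotient K D W)"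
    then have "A \<in> D" "B \<in> D" by (auto simp: sub_quotient_def)
    then obtain P where P: "biproduct K A B P" "Sum P \<in> D"
      using assms unfolding additive_subcategory_def by blast
    let ?S = "Sum P"
    have o: "A \<in> Obj K" "B \<in> Obj K" "?S \<in> Obj K" using \<open>A \<in> D\<close> \<open>B \<in> D\<close> P D by auto
    have i: "inc1 P \<Colon> A \<rightarrow> ?S" "inc2 P \<Colon> B \<rightarrow> ?S" "prj1 P \<Colon> ?S \<rightarrow> A" "prj2 P \<Colon> ?S \<rightarrow> B"
      using P o unfolding biproduct_def arr_def by auto
    have "biproduct (sub_quotient K D W) A B \<lparr>Sum = ?S, inc1 = cls A ?S (inc1 P),
        inc2 = cls B ?S (inc2 P), prj1 = cls ?S A (prj1 P), prj2 = cls ?S B (prj2 P)\<rparr>"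
      using P o i unfolding biproduct_def
      by (simp add: sub_quotient_def comp_Q cls_closed Ident_Q zero_Q cls_zero[OF arr_zero]
          zero_fac add_Q arr_comp[of _ ?S A] arr_comp[of _ ?S B])
    then show "\<exists>P. biproduct (sub_quotient K D W) A B P" by blast
  qed
qed

end


section \<open>Exact sequences of an extriangulated category\<close>

context additive_bifunctor
begin

definition ext :: "'e \<Rightarrow> 'o \<Rightarrow> 'o \<Rightarrow> bool"
  where "ext \<delta> C A \<longleftrightarrow> C \<in> Obj K \<and> A \<in> Obj K \<and> \<delta> \<in> carrier (Ext K C A)"

lemma ext_push: "\<lbrakk>ext \<delta> C A; a \<Colon> A \<rightarrow> A'\<rbrakk> \<Longrightarrow> ext (push K C a \<delta>) C A'"
  unfolding ext_def push_def arr_def using ext_map_hom ident_closed by (meson hom_in_carrier)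

lemma ext_pull: "\<lbrakk>ext \<delta> C A; c \<Colon> C' \<rightarrow> C\<rbrakk> \<Longrightarrow> ext (pull K A c \<delta>) C' A"
  unfolding ext_def pull_def arr_def using ext_map_hom ident_closed by (meson hom_in_carrier)

lemma push_comp:
  assumes "ext \<delta> C A" "a \<Colon> A \<rightarrow> A'" "a' \<Colon> A' \<rightarrow> A''"
  shows "push K C (a' \<cdot> a) \<delta> = push K C a' (push K C a \<delta>)"
  using assms ext_map_comp[of C C C A A' A'' "Ident K C" "Ident K C" a a' \<delta>] ident_closed
    comp_ident_right[of C C "Ident K C"]
  unfolding ext_def push_def arr_def by simp

lemma pull_comp:
  assumes "ext \<delta> C A" "c \<Colon> C' \<rightarrow> C" "c' \<Colon> C'' \<rightarrow> C'"
  shows "pull K A (c \<cdot> c') \<delta> = pull K A c' (pull K A c \<delta>)"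
  using assms ext_map_comp[of C C' C'' A A A c c' "Ident K A" "Ident K A" \<delta>] ident_closed
    comp_ident_right[of A A "Ident K A"]
  unfolding ext_def pull_def arr_def by simp

lemma push_ident: "ext \<delta> C A \<Longrightarrow> push K C (Ident K A) \<delta> = \<delta>"
  unfolding ext_def push_def using ext_map_ident by blast

lemma pull_ident: "ext \<delta> C A \<Longrightarrow> pull K A (Ident K C) \<delta> = \<delta>"
  unfolding ext_def pull_def using ext_map_ident by blast

lemma push_one:
  assumes "a \<Colon> A \<rightarrow> A'" "C \<in> Obj K"
  shows "push K C a (one (Ext K C A)) = one (Ext K C A')"
  using hom_one[OF ext_map_hom[of C C A A' "Ident K C" a]] ext_group assms ident_closed
  unfolding push_def arr_def comm_group_def by blast

lemma pull_one:
  assumes "c \<Colon> C' \<rightarrow> C" "A \<in> Obj K"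
  shows "pull K A c (one (Ext K C A)) = one (Ext K C' A)"
  using hom_one[OF ext_map_hom[of C C' A A c "Ident K A"]] ext_group assms ident_closed
  unfolding pull_def arr_def comm_group_def by blast

lemma pull_add:
  assumes "ext \<delta> C A" "c \<Colon> C' \<rightarrow> C" "c' \<Colon> C' \<rightarrow> C"
  shows "pull K A (add_mor K C' C c c') \<delta> = mult (Ext K C' A) (pull K A c \<delta>) (pull K A c' \<delta>)"
  using assms ext_map_add_left ident_closed unfolding ext_def pull_def arr_def by blast

lemma ext_one_mult:
  assumes "C \<in> Obj K" "A \<in> Obj K"
  shows "mult (Ext K C A) (one (Ext K C A)) (one (Ext K C A)) = one (Ext K C A)"
  using assms ext_group by (meson comm_group_def group.is_monoid monoid.l_one monoid.one_closed)

lemma pull_add_trivial: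
  assumes "ext \<delta> C A" "c \<Colon> C' \<rightarrow> C" "c' \<Colon> C' \<rightarrow> C"
    and "pull K A c \<delta> = one (Ext K C' A)" "pull K A c' \<delta> = one (Ext K C' A)"
  shows "pull K A (add_mor K C' C c c') \<delta> = one (Ext K C' A)"
  using pull_add[OF assms(1-3)] assms ext_one_mult[of C' A] arrD[OF assms(2)] unfolding ext_def by simp

end

lemma opposite_simps [simp]:
  "Obj (opposite K) = Obj K" "Hom (opposite K) A B = Hom K B A" "Ident (opposite K) = Ident K"
  "Comp (opposite K) = (\<lambda>g f. f \<cdot>\<^bsub>K\<^esub> g)" "Ext (opposite K) C A = Ext K A C"
  "ext_map (opposite K) c a = ext_map K a c"
  by (simp_all add: opposite_def)

lemma etriangle_opposite [simp]: "etriangle (opposite K) A x B y C \<delta> \<longleftrightarrow> etriangle K C y B x A \<delta>"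
  by (auto simp: etriangle_def) (auto simp: opposite_def)

lemma push_opposite [simp]: "push (opposite K) C a \<delta> = pull K C a \<delta>"
  by (simp add: push_def pull_def)

lemma pull_opposite [simp]: "pull (opposite K) A c \<delta> = push K A c \<delta>"
  by (simp add: push_def pull_def)

lemma projective_opposite [simp]: "projective (opposite K) P \<longleftrightarrow> injective K P"
  unfolding projective_def injective_def by simp blast

lemma injective_opposite [simp]: "injective (opposite K) P \<longleftrightarrow> projective K P"
  unfolding projective_def injective_def by simp blast

text \<open>
  These assumptions are self-dual, so that every result dualizes by passing to the opposite category.
  Enough projectives and injectives allow dimension shifting in place of higher extension groups.
\<close>

locale exact_realization = additive_bifunctor K
  for K :: "('o, 'm, 'e) ext_category" (structure) +
  assumes tri_closed: "etriangle K A x B y C \<delta> \<Longrightarrow> B \<in> Obj K \<and> x \<in> Mor K A B \<and> y \<in> Mor K B C"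
    and realize: "\<lbrakk>C \<in> Obj K; A \<in> Obj K; \<delta> \<in> carrier (Ext K C A)\<rbrakk> \<Longrightarrow> \<exists>B x y. etriangle K A x B y C \<delta>"
    and tri_mor: "\<lbrakk>etriangle K A x B y C \<delta>; etriangle K A' x' B' y' C' \<delta>';
        a \<in> Mor K A A'; c \<in> Mor K C C'; push K C a \<delta> = pull K A' c \<delta>'\<rbrakk>
      \<Longrightarrow> \<exists>b \<in> Mor K B B'. b \<cdot> x = x' \<cdot> a \<and> y' \<cdot> b = c \<cdot> y"
    and tri_ident_left: "\<lbrakk>A \<in> Obj K; zero_object K Z\<rbrakk>
      \<Longrightarrow> etriangle K A (Ident K A) A (zero_mor K A Z) Z (one (Ext K Z A))"
    and tri_ident_right: "\<lbrakk>A \<in> Obj K; zero_object K Z\<rbrakk>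
      \<Longrightarrow> etriangle K Z (zero_mor K Z A) A (Ident K A) A (one (Ext K A Z))"
    and tri_third: "\<lbrakk>etriangle K A x B y C \<delta>; etriangle K A' x' B' y' C' \<delta>';
        a \<in> Mor K A A'; b \<in> Mor K B B'; b \<cdot> x = x' \<cdot> a\<rbrakk>
      \<Longrightarrow> \<exists>c \<in> Mor K C C'. y' \<cdot> b = c \<cdot> y \<and> push K C a \<delta> = pull K A' c \<delta>'"
    and tri_first: "\<lbrakk>etriangle K A x B y C \<delta>; etriangle K A' x' B' y' C' \<delta>';
        b \<in> Mor K B B'; c \<in> Mor K C C'; y' \<cdot> b = c \<cdot> y\<rbrakk>
      \<Longrightarrow> \<exists>a \<in> Mor K A A'. b \<cdot> x = x' \<cdot> a \<and> push K C a \<delta> = pull K A' c \<delta>'"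
    and enough_proj: "enough_projectives K" and enough_inj: "enough_injectives K"
begin

lemma
  assumes "etriangle K A x B y C \<delta>"
  shows tri_left: "x \<Colon> A \<rightarrow> B" and tri_right: "y \<Colon> B \<rightarrow> C" and tri_ext: "ext \<delta> C A"
  using assms tri_closed[OF assms] unfolding arr_def ext_def etriangle_def by auto

section \<open>Passage to the opposite category\<close>

lemma additive_bifunctor_opposite: "additive_bifunctor (opposite K)"
proof (intro additive_bifunctor.intro additive_bifunctor_axioms.intro)
  show "additive_category (opposite K)" by (rule additive_contravariant) auto
qed (simp_all add: ext_group ext_map_hom ext_map_ident ext_map_comp ext_map_add_left ext_map_add_right)

lemma exact_realization_opposite: "exact_realization (opposite K)"
proof (intro exact_realization.intro exact_realization_axioms.intro)
  interpret op: additive_bifunctor "opposite K" by (rule additive_bifunctor_opposite)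
  have z: "zero_object (opposite K) Z \<longleftrightarrow> zero_object K Z" for Z
    unfolding op.zero_object_iff zero_object_iff by simp
  show "additive_bifunctor (opposite K)" by (rule additive_bifunctor_opposite)
  show "enough_projectives (opposite K)" "enough_injectives (opposite K)"
    using enough_proj enough_inj unfolding enough_projectives_def enough_injectives_def by simp_all blast+
  show "etriangle (opposite K) A (Ident (opposite K) A) A (zero_mor (opposite K) A Z) Z
      (one (Ext (opposite K) Z A))" if "A \<in> Obj (opposite K)" "zero_object (opposite K) Z" for A Z
    using that tri_ident_right z by simp
  show "etriangle (opposite K) Z (zero_mor (opposite K) Z A) A (Ident (opposite K) A) A
      (one (Ext (opposite K) A Z))" if "A \<in> Obj (opposite K)" "zero_object (opposite K) Z" for A Z
    using that tri_ident_left z by simp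
  show "B \<in> Obj (opposite K) \<and> x \<in> Mor (opposite K) A B \<and> y \<in> Mor (opposite K) B C"
    if "etriangle (opposite K) A x B y C \<delta>" for A x B y C \<delta>
    using that tri_closed by fastforce
  show "\<exists>B x y. etriangle (opposite K) A x B y C \<delta>"
    if "C \<in> Obj (opposite K)" "A \<in> Obj (opposite K)" "\<delta> \<in> carrier (Ext (opposite K) C A)" for C A \<delta>
    using that realize[of A C \<delta>] by simp blast
  fix A x B y C \<delta> A' x' B' y' C' \<delta>'
  assume "etriangle (opposite K) A x B y C \<delta>" "etriangle (opposite K) A' x' B' y' C' \<delta>'"
  then have t: "etriangle K C' y' B' x' A' \<delta>'" "etriangle K C y B x A \<delta>" by simp_all
  show "\<exists>b \<in> Mor (opposite K) B B'. b \<cdot>\<^bsub>opposite K\<^esub> x = x' \<cdot>\<^bsub>opposite K\<^esub> a \<and>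
      y' \<cdot>\<^bsub>opposite K\<^esub> b = c \<cdot>\<^bsub>opposite K\<^esub> y"
    if "a \<in> Mor (opposite K) A A'" "c \<in> Mor (opposite K) C C'"
      "push (opposite K) C a \<delta> = pull (opposite K) A' c \<delta>'" for a c
    using tri_mor[OF t, of c a] that by simp metis
  show "\<exists>c \<in> Mor (opposite K) C C'. y' \<cdot>\<^bsub>opposite K\<^esub> b = c \<cdot>\<^bsub>opposite K\<^esub> y \<and>
      push (opposite K) C a \<delta> = pull (opposite K) A' c \<delta>'"
    if "a \<in> Mor (opposite K) A A'" "b \<in> Mor (opposite K) B B'"
      "b \<cdot>\<^bsub>opposite K\<^esub> x = x' \<cdot>\<^bsub>opposite K\<^esub> a" for a b
    using tri_first[OF t, of b a] that by simp metis
  show "\<exists>a \<in> Mor (opposite K) A A'. b \<cdot>\<^bsub>opposite K\<^esub> x = x' \<cdot>\<^bsub>opposite K\<^esub> a \<and>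
      push (opposite K) C a \<delta> = pull (opposite K) A' c \<delta>'"
    if "b \<in> Mor (opposite K) B B'" "c \<in> Mor (opposite K) C C'"
      "y' \<cdot>\<^bsub>opposite K\<^esub> b = c \<cdot>\<^bsub>opposite K\<^esub> y" for b c
    using tri_third[OF t, of c b] that by simp metis
qed

text \<open>The triangle \<open>A = A \<rightarrow> 0\<close> maps to the given one by the identity
  of \<open>A\<close> and by \<open>x\<close>; on third terms this factors
  \<open>y \<cdot> x\<close> through a zero object.\<close>

lemma tri_comp:
  assumes t: "etriangle K A x B y C \<delta>"
  shows "y \<cdot> x = zero_mor K A C"
proof -
  obtain Z where Z: "zero_object K Z" using has_zero_object by blast
  have x: "x \<Colon> A \<rightarrow> B" using tri_left[OF t] .
  have o: "A \<in> Obj K" "C \<in> Obj K" "Z \<in> Obj K"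
    using arrD[OF x] arrD[OF tri_right[OF t]] Z unfolding zero_object_def by auto
  have "x \<cdot> Ident K A = x \<cdot> Ident K A" ..
  then obtain c where "c \<in> Mor K Z C" "y \<cdot> x = c \<cdot> zero_mor K A Z"
    using tri_third[OF tri_ident_left[OF o(1) Z] t] ident_closed o(1) arrD(3)[OF x] by blast
  then show ?thesis using zero_right arrI o by metis
qed

text \<open>Since \<open>f\<close> kills \<open>x\<close>, it is the middle of a map to the triangle
  \<open>0 \<rightarrow> X = X\<close>; the induced map on third terms is \<open>g\<close>.\<close>

lemma hom_exact_left:
  assumes t: "etriangle K A x B y C \<delta>" and f: "f \<Colon> B \<rightarrow> X" and z: "f \<cdot> x = zero_mor K A X"
  obtains g where "g \<Colon> C \<rightarrow> X" "g \<cdot> y = f"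
proof -
  obtain Z where Z: "zero_object K Z" using has_zero_object by blast
  have o: "A \<in> Obj K" "C \<in> Obj K" "Z \<in> Obj K" "X \<in> Obj K" "f \<in> Mor K B X"
    using arrD[OF f] arrD[OF tri_right[OF t]] arrD[OF tri_left[OF t]] Z unfolding zero_object_def by auto
  have "f \<cdot> x = zero_mor K Z X \<cdot> zero_mor K A Z"
    using z zero_right[OF arr_zero] o by simp
  then obtain c where "c \<in> Mor K C X" "Ident K X \<cdot> f = c \<cdot> y"
    using tri_third[OF t tri_ident_right[OF o(4) Z]] zero_closed o by blast
  then show ?thesis using that arrI o ident_left[OF f] by metis
qed

text \<open>Extending \<open>f\<close> along \<open>x\<close> is the same as mapping the triangle to
  \<open>X = X \<rightarrow> 0\<close>, whose class is zero: if the pushforward vanishes, the pair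
  (\<open>f\<close>, 0) is realized on middle terms, and conversely an extension of \<open>f\<close>
  identifies the pushforward with a pullback of the zero class.\<close>

lemma push_trivial_iff:
  assumes t: "etriangle K A x B y C \<delta>" and f: "f \<Colon> A \<rightarrow> X"
  shows "push K C f \<delta> = one (Ext K C X) \<longleftrightarrow> (\<exists>g. g \<Colon> B \<rightarrow> X \<and> g \<cdot> x = f)"
proof -
  obtain Z where Z: "zero_object K Z" using has_zero_object by blast
  have o: "B \<in> Obj K" "C \<in> Obj K" "Z \<in> Obj K" "X \<in> Obj K" "f \<in> Mor K A X"
    using arrD[OF f] arrD[OF tri_right[OF t]] Z unfolding zero_object_def by auto
  have one: "pull K X c (one (Ext K Z X)) = one (Ext K C X)" if "c \<in> Mor K C Z" for c
    using pull_one arrI o that by blast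
  show ?thesis
  proof
    assume "push K C f \<delta> = one (Ext K C X)"
    then have "push K C f \<delta> = pull K X (zero_mor K C Z) (one (Ext K Z X))"
      using one zero_closed o by simp
    then obtain b where "b \<in> Mor K B X" "b \<cdot> x = Ident K X \<cdot> f"
      using tri_mor[OF t tri_ident_left[OF o(4) Z]] zero_closed o by blast
    then show "\<exists>g. g \<Colon> B \<rightarrow> X \<and> g \<cdot> x = f" using arrI o ident_left[OF f] by metis
  next
    assume "\<exists>g. g \<Colon> B \<rightarrow> X \<and> g \<cdot> x = f"
    then obtain g where g: "g \<Colon> B \<rightarrow> X" "g \<cdot> x = Ident K X \<cdot> f" using ident_left[OF f] by metis
    show "push K C f \<delta> = one (Ext K C X)"
      using tri_third[OF t tri_ident_left[OF o(4) Z] o(5) arrD(3)[OF g(1)] g(2)] one by auto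
  qed
qed

lemma opposite_arr: "preadditive_category.arr (opposite K) f A B \<longleftrightarrow> f \<Colon> B \<rightarrow> A"
proof -
  interpret op: additive_bifunctor "opposite K" by (rule additive_bifunctor_opposite)
  show ?thesis unfolding op.arr_def arr_def by auto
qed

lemma opposite_ext: "additive_bifunctor.ext (opposite K) \<delta> C A \<longleftrightarrow> ext \<delta> A C"
proof -
  interpret op: additive_bifunctor "opposite K" by (rule additive_bifunctor_opposite)
  show ?thesis unfolding op.ext_def ext_def by auto
qed

lemma hom_exact_right:
  assumes t: "etriangle K A x B y C \<delta>" and f: "f \<Colon> X \<rightarrow> B" and z: "y \<cdot> f = zero_mor K X C"
  obtains g where "g \<Colon> X \<rightarrow> A" "x \<cdot> g = f"
proof -
  interpret op: exact_realization "opposite K" by (rule exact_realization_opposite)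
  obtain g where "op.arr g A X" "x \<cdot> g = f"
    using op.hom_exact_left[of C y B x A \<delta> f X] assms by (auto simp: opposite_arr)
  then show ?thesis using that by (simp add: opposite_arr)
qed

lemma pull_trivial_iff:
  assumes t: "etriangle K A x B y C \<delta>" and f: "f \<Colon> X \<rightarrow> C"
  shows "pull K A f \<delta> = one (Ext K X A) \<longleftrightarrow> (\<exists>g. g \<Colon> X \<rightarrow> B \<and> y \<cdot> g = f)"
proof -
  interpret op: exact_realization "opposite K" by (rule exact_realization_opposite)
  show ?thesis
    using op.push_trivial_iff[of C y B x A \<delta> f X] assms by (simp add: opposite_arr)
qed

text \<open>Realize \<epsilon> by a triangle ending in \<open>q\<close>. As the pullback of
  \<epsilon> along \<open>y\<close> vanishes, \<open>y\<close> lifts through \<open>q\<close>; the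
  lift and the identity of \<open>C\<close> complete to a map of triangles, whose first component is
  \<open>f\<close>.\<close>

lemma ext_exact_left:
  assumes t: "etriangle K A x B y C \<delta>" and e: "ext \<epsilon> C X" and z: "pull K X y \<epsilon> = one (Ext K B X)"
  obtains f where "f \<Colon> A \<rightarrow> X" "push K C f \<delta> = \<epsilon>"
proof -
  obtain E p q where E: "etriangle K X p E q C \<epsilon>" using e realize unfolding ext_def by blast
  have o: "C \<in> Obj K" "A \<in> Obj K" "X \<in> Obj K" "y \<Colon> B \<rightarrow> C"
    using e t tri_right[OF t] unfolding ext_def etriangle_def by auto
  obtain b where b: "b \<Colon> B \<rightarrow> E" "q \<cdot> b = y"
    using pull_trivial_iff[OF E o(4)] z by auto
  then have "q \<cdot> b = Ident K C \<cdot> y" using ident_left[OF o(4)] by simp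
  then obtain a where "a \<in> Mor K A X" "push K C a \<delta> = pull K X (Ident K C) \<epsilon>"
    using tri_first[OF t E] b arrD ident_closed o by blast
  then show ?thesis using that arrI o pull_ident[OF e] by metis
qed

lemma ext_exact_right:
  assumes t: "etriangle K A x B y C \<delta>" and e: "ext \<epsilon> X A" and z: "push K X x \<epsilon> = one (Ext K X B)"
  obtains f where "f \<Colon> X \<rightarrow> C" "pull K A f \<delta> = \<epsilon>"
proof -
  interpret op: exact_realization "opposite K" by (rule exact_realization_opposite)
  obtain f where "op.arr f C X" "pull K A f \<delta> = \<epsilon>"
    using op.ext_exact_left[of C y B x A \<delta> \<epsilon> X] assms by (auto simp: opposite_arr opposite_ext)
  then show ?thesis using that by (simp add: opposite_arr)
qed

lemma injective_ext:
  assumes I: "injective K I" and e: "ext \<epsilon> C I"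
  shows "\<epsilon> = one (Ext K C I)"
proof -
  obtain B x y where t: "etriangle K I x B y C \<epsilon>" using e realize unfolding ext_def by blast
  have o: "I \<in> Obj K" using e unfolding ext_def by auto
  obtain g where "g \<in> Mor K B I" "g \<cdot> x = Ident K I"
    using I t ident_closed[OF o] unfolding injective_def by blast
  then have "push K C (Ident K I) \<epsilon> = one (Ext K C I)"
    using push_trivial_iff[OF t arr_ident[OF o]] arrI[of B I g] o tri_closed[OF t] by blast
  then show ?thesis using push_ident[OF e] by simp
qed

lemma projective_ext:
  assumes P: "projective K P" and e: "ext \<epsilon> P A"
  shows "\<epsilon> = one (Ext K P A)"
proof -
  interpret op: exact_realization "opposite K" by (rule exact_realization_opposite)
  show ?thesis using op.injective_ext[of P \<epsilon> A] assms by (simp add: opposite_ext)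
qed

lemma injective_extend:
  assumes "injective K I" "etriangle K A x B y C \<delta>" "f \<Colon> A \<rightarrow> I"
  obtains g where "g \<Colon> B \<rightarrow> I" "g \<cdot> x = f"
  using assms tri_closed[OF assms(2)] unfolding injective_def arr_def by blast

lemma injective_resolution:
  assumes "A \<in> Obj K"
  obtains x I y C \<delta> where "injective K I" "etriangle K A x I y C \<delta>"
  using enough_inj assms unfolding enough_injectives_def by blast

lemma projective_resolution:
  assumes "C \<in> Obj K"
  obtains A x P y \<delta> where "projective K P" "etriangle K A x P y C \<delta>"
  using enough_proj assms unfolding enough_projectives_def by blast

lemma pull_deflation:
  assumes t: "etriangle K A x B y C \<delta>"
  shows "pull K A y \<delta> = one (Ext K B A)"
  using pull_trivial_iff[OF t tri_right[OF t]] arr_ident ident_right[OF tri_right[OF t]]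
    arrD(1)[OF tri_right[OF t]] by blast

text \<open>A zero class gives a section \<open>s\<close> of \<open>y\<close> and a retraction
  \<open>r0\<close> of \<open>x\<close>, chosen independently, so \<open>r0 \<cdot> s\<close> need
  not vanish. The retraction is therefore replaced by the \<open>r\<close> with
  \<open>x \<cdot> r = 1 - s \<cdot> y\<close>.\<close>

lemma split_triangle:
  assumes t: "etriangle K A x B y C \<delta>" and d: "\<delta> = one (Ext K C A)"
  obtains P where "biproduct K A C P" "Sum P = B"
proof -
  have x: "x \<Colon> A \<rightarrow> B" and y: "y \<Colon> B \<rightarrow> C" using tri_left[OF t] tri_right[OF t] .
  have o: "A \<in> Obj K" "B \<in> Obj K" "C \<in> Obj K" using arrD[OF x] arrD[OF y] by auto
  obtain s where s: "s \<Colon> C \<rightarrow> B" "y \<cdot> s = Ident K C"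
    using pull_trivial_iff[OF t arr_ident[OF o(3)]] pull_ident[OF tri_ext[OF t]] d by auto
  obtain r0 where r0: "r0 \<Colon> B \<rightarrow> A" "r0 \<cdot> x = Ident K A"
    using push_trivial_iff[OF t arr_ident[OF o(1)]] push_ident[OF tri_ext[OF t]] d by auto
  have sy: "s \<cdot> y \<Colon> B \<rightarrow> B" and i: "Ident K B \<Colon> B \<rightarrow> B" using arr_comp[OF y s(1)] arr_ident[OF o(2)] .
  define h where "h = diff B B (Ident K B) (s \<cdot> y)"
  have h: "h \<Colon> B \<rightarrow> B" unfolding h_def using arr_diff[OF i sy] .
  have "y \<cdot> h = diff B C y (y \<cdot> s \<cdot> y)"
    unfolding h_def using diff_right[OF i sy y] ident_right[OF y] by simp
  also have "y \<cdot> s \<cdot> y = y" using assoc[OF y s(1) y] s(2) ident_left[OF y] by simp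
  finally have "y \<cdot> h = zero_mor K B C" using diff_self[OF y] by simp
  then obtain r where r: "r \<Colon> B \<rightarrow> A" "x \<cdot> r = h" using hom_exact_right[OF t h] by metis
  have "h \<cdot> x = diff A B x (s \<cdot> y \<cdot> x)"
    unfolding h_def using diff_left[OF x i sy] ident_left[OF x] assoc[OF x y s(1)] by simp
  then have hx: "h \<cdot> x = x"
    using tri_comp[OF t] zero_right[OF s(1) o(1)] add_diff[OF x arr_zero[OF o(1,2)]]
      zero_add arr_diff[OF x arr_zero[OF o(1,2)]] by simp
  have "h \<cdot> s = diff C B s (s \<cdot> y \<cdot> s)"
    unfolding h_def using diff_left[OF s(1) i sy] ident_left[OF s(1)] assoc[OF s(1) y s(1)] by simp
  then have hs: "h \<cdot> s = zero_mor K C B"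
    using s(2) ident_right[OF s(1)] diff_self[OF s(1)] by simp
  \<comment> \<open>\<open>x\<close> is a split monomorphism, so the equations for \<open>r\<close>
    may be verified after composing with \<open>x\<close>.\<close>
  have mono: "f = r0 \<cdot> x \<cdot> f" if "f \<Colon> D \<rightarrow> A" for f D
    using assoc[OF that x r0(1)] r0(2) ident_left[OF that] by simp
  have "r \<cdot> x = r0 \<cdot> x \<cdot> r \<cdot> x" using mono[OF arr_comp[OF x r(1)]] .
  then have rx: "r \<cdot> x = Ident K A" using assoc[OF x r(1) x] r(2) hx r0(2) by simp
  have "r \<cdot> s = r0 \<cdot> x \<cdot> r \<cdot> s" using mono[OF arr_comp[OF s(1) r(1)]] .
  then have rs: "r \<cdot> s = zero_mor K C A" using assoc[OF s(1) r(1) x] r(2) hs zero_right[OF r0(1) o(3)] by simp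
  have "add_mor K B B (x \<cdot> r) (s \<cdot> y) = Ident K B"
    using add_diff[OF i sy] add_commute[OF h sy] r(2) unfolding h_def by simp
  then have "biproduct K A C \<lparr>Sum = B, inc1 = x, inc2 = s, prj1 = r, prj2 = y\<rparr>"
    unfolding biproduct_def using o arrD(3)[OF x] arrD(3)[OF y] arrD(3)[OF s(1)] arrD(3)[OF r(1)]
      rx rs s(2) tri_comp[OF t] by simp
  then show ?thesis using that by fastforce
qed

text \<open>Embed \<open>X\<close> in an injective with third term \<open>S\<close>, so that
  \<epsilon> is the pullback of \<gamma> along some \<open>k : B \<rightarrow> S\<close>. Triviality
  over \<open>A\<close> lets \<open>k\<close> be corrected by a map through the injective until it
  kills \<open>x\<close>; the rest factors through \<open>C\<close>, where classes are trivial
  again. Both summands pull \<gamma> back to zero.\<close>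

lemma ext_trivial_middle_left:
  assumes t: "etriangle K A x B y C \<delta>" and e: "ext \<epsilon> B X"
    and triv: "\<And>\<epsilon>. ext \<epsilon> A X \<Longrightarrow> \<epsilon> = one (Ext K A X)" "\<And>\<epsilon>. ext \<epsilon> C X \<Longrightarrow> \<epsilon> = one (Ext K C X)"
  shows "\<epsilon> = one (Ext K B X)"
proof -
  have x: "x \<Colon> A \<rightarrow> B" and y: "y \<Colon> B \<rightarrow> C" using tri_left[OF t] tri_right[OF t] .
  have X: "X \<in> Obj K" using e unfolding ext_def by auto
  obtain i I q S \<gamma> where I: "injective K I" and g: "etriangle K X i I q S \<gamma>"
    by (rule injective_resolution[OF X])
  have q: "q \<Colon> I \<rightarrow> S" and i: "i \<Colon> X \<rightarrow> I" and \<gamma>: "ext \<gamma> S X"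
    using tri_right[OF g] tri_left[OF g] tri_ext[OF g] .
  obtain k where k: "k \<Colon> B \<rightarrow> S" "pull K X k \<gamma> = \<epsilon>"
    by (rule ext_exact_right[OF g e injective_ext[OF I ext_push[OF e i]]])
  have kx: "k \<cdot> x \<Colon> A \<rightarrow> S" using arr_comp[OF x k(1)] .
  obtain h where h: "h \<Colon> A \<rightarrow> I" "q \<cdot> h = k \<cdot> x"
    using pull_trivial_iff[OF g kx] triv(1)[OF ext_pull[OF \<gamma> kx]] by blast
  obtain h' where h': "h' \<Colon> B \<rightarrow> I" "h' \<cdot> x = h" by (rule injective_extend[OF I t h(1)])
  have qh: "q \<cdot> h' \<Colon> B \<rightarrow> S" using arr_comp[OF h'(1) q] .
  have z: "diff B S k (q \<cdot> h') \<cdot> x = zero_mor K A S"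
    using diff_left[OF x k(1) qh] assoc[OF x h'(1) q] h' h diff_self[OF kx] by simp
  obtain m where m: "m \<Colon> C \<rightarrow> S" "m \<cdot> y = diff B S k (q \<cdot> h')"
    by (rule hom_exact_left[OF t arr_diff[OF k(1) qh] z])
  have my: "m \<cdot> y \<Colon> B \<rightarrow> S" using arr_comp[OF y m(1)] .
  have "k = add_mor K B S (q \<cdot> h') (m \<cdot> y)" using add_diff[OF k(1) qh] m by simp
  moreover have "pull K X (q \<cdot> h') \<gamma> = one (Ext K B X)"
    using pull_comp[OF \<gamma> q h'(1)] pull_deflation[OF g] pull_one[OF h'(1) X] by simp
  moreover have "pull K X (m \<cdot> y) \<gamma> = one (Ext K B X)"
    using pull_comp[OF \<gamma> m(1) y] triv(2)[OF ext_pull[OF \<gamma> m(1)]] pull_one[OF y X] by simp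
  ultimately show ?thesis using pull_add_trivial[OF \<gamma> qh my] k(2) by simp
qed

lemma ext_trivial_middle_right:
  assumes t: "etriangle K A x B y C \<delta>" and e: "ext \<epsilon> X B"
    and triv: "\<And>\<epsilon>. ext \<epsilon> X A \<Longrightarrow> \<epsilon> = one (Ext K X A)" "\<And>\<epsilon>. ext \<epsilon> X C \<Longrightarrow> \<epsilon> = one (Ext K X C)"
  shows "\<epsilon> = one (Ext K X B)"
proof -
  interpret op: exact_realization "opposite K" by (rule exact_realization_opposite)
  show ?thesis
    using op.ext_trivial_middle_left[of C y B x A \<delta> \<epsilon> X] assms by (simp add: opposite_ext)
qed

end

lemma exact_realizationI:
  assumes "extriangulated_category K" "enough_projectives K" "enough_injectives K"
  shows "exact_realization K"
proof -
  interpret extriangulated_category K by fact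
  have seq: "Rlz K C A \<delta> \<in> sequences K A C // seq_equiv K A C"
    if "C \<in> Obj K" "A \<in> Obj K" "\<delta> \<in> carrier (Ext K C A)" for C A \<delta>
    using rlz_class that by blast
  have sub: "Rlz K C A \<delta> \<subseteq> sequences K A C" "Rlz K C A \<delta> \<noteq> {}"
    if C: "C \<in> Obj K" "A \<in> Obj K" "\<delta> \<in> carrier (Ext K C A)" for C A \<delta>
  proof -
    obtain s where s: "s \<in> sequences K A C" "Rlz K C A \<delta> = seq_equiv K A C `` {s}"
      using seq[OF C] by (auto elim: quotientE)
    then show "Rlz K C A \<delta> \<subseteq> sequences K A C" by (auto simp: seq_equiv_def)
    obtain B x y where B: "s = (B, x, y)" "B \<in> Obj K" "x \<in> Mor K A B" "y \<in> Mor K B C"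
      using s(1) unfolding sequences_def by auto
    have "isomorphism K B B (Ident K B)"
      unfolding isomorphism_def using B ident_closed comp_ident_left by metis
    then have "(s, s) \<in> seq_equiv K A C"
      using B C s(1) comp_ident_left comp_ident_right unfolding seq_equiv_def by auto
    then show "Rlz K C A \<delta> \<noteq> {}" using s by auto
  qed
  show ?thesis
  proof
    show "B \<in> Obj K \<and> x \<in> Mor K A B \<and> y \<in> Mor K B C" if "etriangle K A x B y C \<delta>" for A x B y C \<delta>
      using that sub(1) unfolding etriangle_def sequences_def by blast
    show "\<exists>B x y. etriangle K A x B y C \<delta>"
      if "C \<in> Obj K" "A \<in> Obj K" "\<delta> \<in> carrier (Ext K C A)" for C A \<delta>
      using that sub(2)[OF that] unfolding etriangle_def by fast
    fix A Z assume A: "A \<in> Obj K" and Z: "zero_object K Z"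
    then have Z': "Z \<in> Obj K" "Ident K Z = zero_mor K Z Z" using zero_object_iff by auto
    have i: "Ident K A \<Colon> A \<rightarrow> A" and z: "zero_mor K A Z \<Colon> A \<rightarrow> Z" "zero_mor K Z A \<Colon> Z \<rightarrow> A"
      using A Z' arr_ident arr_zero by auto
    \<comment> \<open>\<open>A\<close> itself is a biproduct of \<open>A\<close> with a zero object,
      so the split triangle on it has an identity as first map.\<close>
    have "biproduct K A Z \<lparr>Sum = A, inc1 = Ident K A, inc2 = zero_mor K Z A,
        prj1 = Ident K A, prj2 = zero_mor K A Z\<rparr>"
      unfolding biproduct_def using A Z' arrD[OF i] zero_closed ident_left[OF i] ident_left[OF z(2)]
        ident_right[OF z(1)] zero_right[OF z(1) Z'(1)] zero_right[OF z(2) A] add_zero[OF i] by simp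
    then show "etriangle K A (Ident K A) A (zero_mor K A Z) Z (one (Ext K Z A))"
      using rlz_zero[OF A Z'(1)] by fastforce
    have "biproduct K Z A \<lparr>Sum = A, inc1 = zero_mor K Z A, inc2 = Ident K A,
        prj1 = zero_mor K A Z, prj2 = Ident K A\<rparr>"
      unfolding biproduct_def using A Z' arrD[OF i] zero_closed ident_left[OF i] ident_left[OF z(2)]
        ident_right[OF z(1)] zero_right[OF z(1) Z'(1)] zero_right[OF z(2) A] zero_add[OF i] by simp
    then show "etriangle K Z (zero_mor K Z A) A (Ident K A) A (one (Ext K A Z))"
      using rlz_zero[OF Z'(1) A] by fastforce
  next
    fix A x B y C \<delta> A' x' B' y' C' \<delta>'
    assume t: "etriangle K A x B y C \<delta>" "etriangle K A' x' B' y' C' \<delta>'"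
    show "\<exists>b \<in> Mor K B B'. b \<cdot>\<^bsub>K\<^esub> x = x' \<cdot>\<^bsub>K\<^esub> a \<and> y' \<cdot>\<^bsub>K\<^esub> b = c \<cdot>\<^bsub>K\<^esub> y"
      if "a \<in> Mor K A A'" "c \<in> Mor K C C'" "push K C a \<delta> = pull K A' c \<delta>'" for a c
      using rlz_mor[OF t that] .
    show "\<exists>c \<in> Mor K C C'. y' \<cdot>\<^bsub>K\<^esub> b = c \<cdot>\<^bsub>K\<^esub> y \<and> push K C a \<delta> = pull K A' c \<delta>'"
      if "a \<in> Mor K A A'" "b \<in> Mor K B B'" "b \<cdot>\<^bsub>K\<^esub> x = x' \<cdot>\<^bsub>K\<^esub> a" for a b
      using ET3 t that unfolding ET3_def by blast
    \<comment> \<open>Completion on first terms is (ET3) in the opposite category, where the two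
      triangles trade places.\<close>
    have t': "etriangle (opposite K) C' y' B' x' A' \<delta>'" "etriangle (opposite K) C y B x A \<delta>"
      using t by simp_all
    show "\<exists>a \<in> Mor K A A'. b \<cdot>\<^bsub>K\<^esub> x = x' \<cdot>\<^bsub>K\<^esub> a \<and> push K C a \<delta> = pull K A' c \<delta>'"
      if b: "b \<in> Mor K B B'" and c: "c \<in> Mor K C C'" and e: "y' \<cdot>\<^bsub>K\<^esub> b = c \<cdot>\<^bsub>K\<^esub> y" for b c
    proof -
      have "c \<in> Mor (opposite K) C' C" "b \<in> Mor (opposite K) B' B"
        "b \<cdot>\<^bsub>opposite K\<^esub> y' = y \<cdot>\<^bsub>opposite K\<^esub> c" using b c e by simp_all
      then obtain a where "a \<in> Mor (opposite K) A' A" "x \<cdot>\<^bsub>opposite K\<^esub> b = a \<cdot>\<^bsub>opposite K\<^esub> x'"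
          "push (opposite K) A' c \<delta>' = pull (opposite K) C a \<delta>"
        using ET3_op t' unfolding ET3_def by metis
      then show ?thesis by (intro bexI[of _ a]) simp_all
    qed
  qed (use assms in auto)
qed


section \<open>Cotorsion pairs\<close>

context ideal_quotient
begin

text \<open>A criterion on representatives: composition is additive, so injectivity modulo
  \<open>W\<close> amounts to a trivial kernel, and surjectivity has to hold only up to the
  ideal.\<close>

lemma bij_betw_post_comp:
  assumes e: "e \<Colon> A' \<rightarrow> A" and N: "N \<in> Obj K"
    and surj: "\<And>f. f \<Colon> N \<rightarrow> A \<Longrightarrow> \<exists>g. g \<Colon> N \<rightarrow> A' \<and> diff N A (e \<cdot> g) f \<in> fac N A"
    and inj: "\<And>g. \<lbrakk>g \<Colon> N \<rightarrow> A'; e \<cdot> g \<in> fac N A\<rbrakk> \<Longrightarrow> g \<in> fac N A'"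
  shows "bij_betw (\<lambda>p. cls A' A e \<cdot>\<^bsub>Q\<^esub> p) (Mor Q N A') (Mor Q N A)"
proof -
  have o: "A \<in> Obj K" "A' \<in> Obj K" using arrD[OF e] by auto
  have c: "cls A' A e \<cdot>\<^bsub>Q\<^esub> cls N A' g = cls N A (e \<cdot> g)" if "g \<Colon> N \<rightarrow> A'" for g
    using comp_Q[OF that e] .
  show ?thesis
  proof (rule bij_betwI')
    fix p q assume "p \<in> Mor Q N A'" "q \<in> Mor Q N A'"
    then obtain f g where f: "f \<Colon> N \<rightarrow> A'" "p = cls N A' f" and g: "g \<Colon> N \<rightarrow> A'" "q = cls N A' g"
      using Mor_QE N o by metis
    have "e \<cdot> diff N A' f g = diff N A (e \<cdot> f) (e \<cdot> g)" using diff_right[OF f(1) g(1) e] .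
    then have "p = q" if "cls N A (e \<cdot> f) = cls N A (e \<cdot> g)"
      using that inj[OF arr_diff[OF f(1) g(1)]] cls_eq_iff[OF arr_comp[OF f(1) e] arr_comp[OF g(1) e]]
        cls_eq_iff[OF f(1) g(1)] f(2) g(2) by simp
    then show "(cls A' A e \<cdot>\<^bsub>Q\<^esub> p = cls A' A e \<cdot>\<^bsub>Q\<^esub> q) = (p = q)"
      using c[OF f(1)] c[OF g(1)] f(2) g(2) by metis
  next
    fix p assume "p \<in> Mor Q N A'"
    then obtain f where "f \<Colon> N \<rightarrow> A'" "p = cls N A' f" using Mor_QE N o by metis
    then show "cls A' A e \<cdot>\<^bsub>Q\<^esub> p \<in> Mor Q N A" using c cls_closed arr_comp e by metis
  next
    fix q assume "q \<in> Mor Q N A"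
    then obtain f where f: "f \<Colon> N \<rightarrow> A" "q = cls N A f" using Mor_QE N o by metis
    obtain g where g: "g \<Colon> N \<rightarrow> A'" "diff N A (e \<cdot> g) f \<in> fac N A" using surj[OF f(1)] by blast
    then have "q = cls A' A e \<cdot>\<^bsub>Q\<^esub> cls N A' g"
      using c[OF g(1)] cls_eq_iff[OF arr_comp[OF g(1) e] f(1)] f(2) by simp
    then show "\<exists>p \<in> Mor Q N A'. q = cls A' A e \<cdot>\<^bsub>Q\<^esub> p" using cls_closed g(1) by blast
  qed
qed

lemma bij_betw_pre_comp:
  assumes e: "e \<Colon> A \<rightarrow> A'" and N: "N \<in> Obj K"
    and surj: "\<And>f. f \<Colon> A \<rightarrow> N \<Longrightarrow> \<exists>g. g \<Colon> A' \<rightarrow> N \<and> diff A N (g \<cdot> e) f \<in> fac A N"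
    and inj: "\<And>g. \<lbrakk>g \<Colon> A' \<rightarrow> N; g \<cdot> e \<in> fac A N\<rbrakk> \<Longrightarrow> g \<in> fac A' N"
  shows "bij_betw (\<lambda>p. p \<cdot>\<^bsub>Q\<^esub> cls A A' e) (Mor Q A' N) (Mor Q A N)"
proof -
  have o: "A \<in> Obj K" "A' \<in> Obj K" using arrD[OF e] by auto
  have c: "cls A' N g \<cdot>\<^bsub>Q\<^esub> cls A A' e = cls A N (g \<cdot> e)" if "g \<Colon> A' \<rightarrow> N" for g
    using comp_Q[OF e that] .
  show ?thesis
  proof (rule bij_betwI')
    fix p q assume "p \<in> Mor Q A' N" "q \<in> Mor Q A' N"
    then obtain f g where f: "f \<Colon> A' \<rightarrow> N" "p = cls A' N f" and g: "g \<Colon> A' \<rightarrow> N" "q = cls A' N g"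
      using Mor_QE N o by metis
    have "diff A' N f g \<cdot> e = diff A N (f \<cdot> e) (g \<cdot> e)" using diff_left[OF e f(1) g(1)] .
    then have "p = q" if "cls A N (f \<cdot> e) = cls A N (g \<cdot> e)"
      using that inj[OF arr_diff[OF f(1) g(1)]] cls_eq_iff[OF arr_comp[OF e f(1)] arr_comp[OF e g(1)]]
        cls_eq_iff[OF f(1) g(1)] f(2) g(2) by simp
    then show "(p \<cdot>\<^bsub>Q\<^esub> cls A A' e = q \<cdot>\<^bsub>Q\<^esub> cls A A' e) = (p = q)"
      using c[OF f(1)] c[OF g(1)] f(2) g(2) by metis
  next
    fix p assume "p \<in> Mor Q A' N"
    then obtain f where "f \<Colon> A' \<rightarrow> N" "p = cls A' N f" using Mor_QE N o by metis
    then show "p \<cdot>\<^bsub>Q\<^esub> cls A A' e \<in> Mor Q A N" using c cls_closed arr_comp e by metis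
  next
    fix q assume "q \<in> Mor Q A N"
    then obtain f where f: "f \<Colon> A \<rightarrow> N" "q = cls A N f" using Mor_QE N o by metis
    obtain g where g: "g \<Colon> A' \<rightarrow> N" "diff A N (g \<cdot> e) f \<in> fac A N" using surj[OF f(1)] by blast
    then have "q = cls A' N g \<cdot>\<^bsub>Q\<^esub> cls A A' e"
      using c[OF g(1)] cls_eq_iff[OF arr_comp[OF e g(1)] f(1)] f(2) by simp
    then show "\<exists>p \<in> Mor Q A' N. q = p \<cdot>\<^bsub>Q\<^esub> cls A A' e" using cls_closed g(1) by blast
  qed
qed

end

locale cotorsion = exact_realization K
  for K :: "('o, 'm, 'e) ext_category" (structure) +
  fixes U V W
  assumes cotorsion_pair: "cotorsion_pair K U V" and core: "W = U \<inter> V"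
begin

lemma U_subset: "A \<in> U \<Longrightarrow> A \<in> Obj K" and V_subset: "A \<in> V \<Longrightarrow> A \<in> Obj K"
  using cotorsion_pair unfolding cotorsion_pair_def additive_subcategory_def by auto

lemma additive_U: "additive_subcategory K U" and additive_V: "additive_subcategory K V"
  using cotorsion_pair unfolding cotorsion_pair_def by auto

lemma ext_U_V: "\<lbrakk>ext \<epsilon> A B; A \<in> U; B \<in> V\<rbrakk> \<Longrightarrow> \<epsilon> = one (Ext K A B)"
  using cotorsion_pair unfolding cotorsion_pair_def ext_def by blast

lemma left_triangle:
  assumes "C \<in> Obj K"
  obtains A B x y \<delta> where "A \<in> V" "B \<in> U" "etriangle K A x B y C \<delta>"
  using cotorsion_pair assms unfolding cotorsion_pair_def by blast

lemma right_triangle: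
  assumes "C \<in> Obj K"
  obtains A B x y \<delta> where "A \<in> V" "B \<in> U" "etriangle K C x A y B \<delta>"
  using cotorsion_pair assms unfolding cotorsion_pair_def by blast

text \<open>The hypothesis splits the approximation triangle of \<open>C\<close>, so
  \<open>C\<close> is a direct summand of its middle term. Thus \<open>U\<close> is the whole left
  orthogonal of \<open>V\<close>, and closure properties of \<open>U\<close> become vanishing
  statements for extensions.\<close>

lemma U_I:
  assumes "C \<in> Obj K" and triv: "\<And>A \<epsilon>. \<lbrakk>A \<in> V; ext \<epsilon> C A\<rbrakk> \<Longrightarrow> \<epsilon> = one (Ext K C A)"
  shows "C \<in> U"
proof -
  obtain A B x y \<delta> where t: "A \<in> V" "B \<in> U" "etriangle K A x B y C \<delta>"
    by (rule left_triangle[OF assms(1)])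
  obtain P where P: "biproduct K A C P" "Sum P = B"
    by (rule split_triangle[OF t(3) triv[OF t(1) tri_ext[OF t(3)]]])
  then show ?thesis
    using cotorsion_pair t assms(1) V_subset
    unfolding cotorsion_pair_def closed_under_summands_def by blast
qed

lemma V_I:
  assumes "C \<in> Obj K" and triv: "\<And>A \<epsilon>. \<lbrakk>A \<in> U; ext \<epsilon> A C\<rbrakk> \<Longrightarrow> \<epsilon> = one (Ext K A C)"
  shows "C \<in> V"
proof -
  obtain A B x y \<delta> where t: "A \<in> V" "B \<in> U" "etriangle K C x A y B \<delta>"
    by (rule right_triangle[OF assms(1)])
  obtain P where P: "biproduct K C B P" "Sum P = A"
    by (rule split_triangle[OF t(3) triv[OF t(2) tri_ext[OF t(3)]]])
  then show ?thesis
    using cotorsion_pair t assms(1) U_subset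
    unfolding cotorsion_pair_def closed_under_summands_def by blast
qed

text \<open>Closure under summands concerns biproducts, and a retract need not have a complement.
  Orthogonality handles it: every class over \<open>C\<close> is pulled back from one over
  \<open>B\<close>.\<close>

lemma retract_U:
  assumes i: "i \<Colon> C \<rightarrow> B" and p: "p \<Colon> B \<rightarrow> C" and "p \<cdot> i = Ident K C" "B \<in> U"
  shows "C \<in> U"
proof (rule U_I)
  fix A \<epsilon> assume A: "A \<in> V" and e: "ext \<epsilon> C A"
  have "\<epsilon> = pull K A i (pull K A p \<epsilon>)"
    using pull_comp[OF e p i] pull_ident[OF e] assms(3) by simp
  then show "\<epsilon> = one (Ext K C A)"
    using ext_U_V[OF ext_pull[OF e p] assms(4) A] pull_one[OF i V_subset[OF A]] by simp
qed (use arrD[OF i] in simp)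

lemma retract_V:
  assumes i: "i \<Colon> C \<rightarrow> B" and p: "p \<Colon> B \<rightarrow> C" and "p \<cdot> i = Ident K C" "B \<in> V"
  shows "C \<in> V"
proof (rule V_I)
  fix A \<epsilon> assume A: "A \<in> U" and e: "ext \<epsilon> A C"
  have "\<epsilon> = push K A p (push K A i \<epsilon>)"
    using push_comp[OF e i p] push_ident[OF e] assms(3) by simp
  then show "\<epsilon> = one (Ext K A C)"
    using ext_U_V[OF ext_push[OF e i] A assms(4)] push_one[OF p U_subset[OF A]] by simp
qed (use arrD[OF i] in simp)

lemma middle_U:
  assumes t: "etriangle K A x B y C \<delta>" and "A \<in> U" "C \<in> U"
  shows "B \<in> U"
proof (rule U_I)
  show "B \<in> Obj K" using arrD[OF tri_left[OF t]] by simp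
  fix N \<epsilon> assume "N \<in> V" "ext \<epsilon> B N"
  then show "\<epsilon> = one (Ext K B N)" using ext_trivial_middle_left[OF t] ext_U_V assms(2,3) by blast
qed

lemma middle_V:
  assumes t: "etriangle K A x B y C \<delta>" and "A \<in> V" "C \<in> V"
  shows "B \<in> V"
proof (rule V_I)
  show "B \<in> Obj K" using arrD[OF tri_left[OF t]] by simp
  fix N \<epsilon> assume "N \<in> U" "ext \<epsilon> N B"
  then show "\<epsilon> = one (Ext K N B)" using ext_trivial_middle_right[OF t] ext_U_V assms(2,3) by blast
qed

lemma injective_V: "injective K I \<Longrightarrow> I \<in> V"
  using V_I injective_ext unfolding injective_def by blast

lemma projective_U: "projective K P \<Longrightarrow> P \<in> U"
  using U_I projective_ext unfolding projective_def by blast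

lemma zero_object_U:
  assumes "zero_object K Z"
  shows "Z \<in> U"
proof -
  obtain B where B: "B \<in> U" using additive_U unfolding additive_subcategory_def by blast
  have o: "Z \<in> Obj K" "B \<in> Obj K" using assms B U_subset zero_object_iff by auto
  have "zero_mor K B Z \<cdot> zero_mor K Z B = Ident K Z"
    using zero_right[OF arr_zero[OF o(2,1)] o(1)] assms zero_object_iff by simp
  then show ?thesis using retract_U[OF arr_zero arr_zero] o B by blast
qed

text \<open>An additive subcategory contains some biproduct of any two members. Having all of them
  in \<open>U\<close> lets an intersection with \<open>U\<close> use a biproduct supplied by the
  other subcategory.\<close>

lemma biproduct_U:
  assumes P: "biproduct K A B P" and AB: "A \<in> U" "B \<in> U"
  shows "Sum P \<in> U"
proof (rule U_I)
  let ?S = "Sum P"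
  have o: "A \<in> Obj K" "B \<in> Obj K" using AB U_subset by auto
  show S: "?S \<in> Obj K" using P unfolding biproduct_def by auto
  have i: "inc1 P \<Colon> A \<rightarrow> ?S" "inc2 P \<Colon> B \<rightarrow> ?S" "prj1 P \<Colon> ?S \<rightarrow> A" "prj2 P \<Colon> ?S \<rightarrow> B"
    and s: "add_mor K ?S ?S (inc1 P \<cdot> prj1 P) (inc2 P \<cdot> prj2 P) = Ident K ?S"
    using P o unfolding biproduct_def arr_def by auto
  fix N \<epsilon> assume N: "N \<in> V" and e: "ext \<epsilon> ?S N"
  have "pull K N (inc1 P \<cdot> prj1 P) \<epsilon> = one (Ext K ?S N)"
    using pull_comp[OF e i(1,3)] ext_U_V[OF ext_pull[OF e i(1)] AB(1) N] pull_one[OF i(3) V_subset[OF N]] by simp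
  moreover have "pull K N (inc2 P \<cdot> prj2 P) \<epsilon> = one (Ext K ?S N)"
    using pull_comp[OF e i(2,4)] ext_U_V[OF ext_pull[OF e i(2)] AB(2) N] pull_one[OF i(4) V_subset[OF N]] by simp
  ultimately show "\<epsilon> = one (Ext K ?S N)"
    using pull_add_trivial[OF e arr_comp[OF i(3,1)] arr_comp[OF i(4,2)]] s pull_ident[OF e] by simp
qed

lemma additive_subcategory_Int_U:
  assumes "additive_subcategory K D"
  shows "additive_subcategory K (D \<inter> U)"
  using assms zero_object_U biproduct_U unfolding additive_subcategory_def by blast

sublocale ideal_quotient K W
proof
  show "additive_subcategory K W"
    using additive_subcategory_Int_U[OF additive_V] core by (simp add: Int_commute)
qed

text \<open>An identity that factors through \<open>W\<close> makes \<open>A\<close> a retract of an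
  object lying in both \<open>U\<close> and \<open>V\<close>.\<close>

lemma zero_object_Q_iff:
  assumes "A \<in> Obj K"
  shows "zero_object Q A \<longleftrightarrow> A \<in> W"
proof
  assume "zero_object Q A"
  then have "Ident K A \<in> fac A A" using zero_object_quotient assms by blast
  then obtain N i p where "N \<in> W" "i \<Colon> A \<rightarrow> N" "p \<Colon> N \<rightarrow> A" "p \<cdot> i = Ident K A"
    using facE assms by metis
  then show "A \<in> W" using retract_U retract_V core by blast
next
  assume "A \<in> W"
  then have "Ident K A \<in> fac A A"
    using facI[OF _ arr_ident arr_ident] ident_left[OF arr_ident] assms by metis
  then show "zero_object Q A" using zero_object_quotient assms by blast
qed

lemma extend_to_V:
  assumes t: "etriangle K A x B y C \<delta>" and f: "f \<Colon> A \<rightarrow> N" and "C \<in> U" "N \<in> V"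
  obtains g where "g \<Colon> B \<rightarrow> N" "g \<cdot> x = f"
  using push_trivial_iff[OF t f] ext_U_V[OF ext_push[OF tri_ext[OF t] f]] assms(3,4) by blast

lemma lift_from_U:
  assumes t: "etriangle K A x B y C \<delta>" and f: "f \<Colon> N \<rightarrow> C" and "N \<in> U" "A \<in> V"
  obtains g where "g \<Colon> N \<rightarrow> B" "y \<cdot> g = f"
  using pull_trivial_iff[OF t f] ext_U_V[OF ext_pull[OF tri_ext[OF t] f]] assms(3,4) by blast

text \<open>In the triangle from \<open>A\<close> to its \<open>V\<close>-approximation the middle
  term is an extension of objects of \<open>U\<close>, hence in \<open>W\<close>, and
  \<open>f\<close> extends to it because the third term is in \<open>U\<close> and \<open>B\<close>
  in \<open>V\<close>.\<close>

lemma fac_U_V: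
  assumes f: "f \<Colon> A \<rightarrow> B" and A: "A \<in> U" and B: "B \<in> V"
  shows "f \<in> fac A B"
proof -
  obtain N C x y \<delta> where t: "N \<in> V" "C \<in> U" "etriangle K A x N y C \<delta>"
    by (rule right_triangle[OF U_subset[OF A]])
  obtain g where g: "g \<Colon> N \<rightarrow> B" "g \<cdot> x = f" by (rule extend_to_V[OF t(3) f t(2) B])
  have "N \<in> W" using middle_U[OF t(3) A t(2)] t(1) core by blast
  then show ?thesis using facI[OF _ tri_left[OF t(3)] g(1)] g(2) by simp
qed

text \<open>Maps from \<open>C\<close> to \<open>N\<close> extend to \<open>A\<close> on the nose.
  If \<open>g \<cdot> x\<close> factors through \<open>W\<close>, that factorization extends as
  well; what remains of \<open>g\<close> kills \<open>x\<close>, so it passes through a morphism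
  from \<open>U\<close> to \<open>V\<close>, hence through \<open>W\<close>.\<close>

lemma bij_betw_right_approximation:
  assumes t: "etriangle K C x A y B \<delta>" and A: "A \<in> V" and B: "B \<in> U" and N: "N \<in> V"
  shows "bij_betw (\<lambda>p. p \<cdot>\<^bsub>Q\<^esub> cls C A x) (Mor Q A N) (Mor Q C N)"
proof (rule bij_betw_pre_comp)
  have x: "x \<Colon> C \<rightarrow> A" and y: "y \<Colon> A \<rightarrow> B" using tri_left[OF t] tri_right[OF t] .
  show "x \<Colon> C \<rightarrow> A" "N \<in> Obj K" using x V_subset[OF N] .
  note o = arrD(1)[OF x] V_subset[OF N] arrD(2)[OF x]
  show "\<exists>g. g \<Colon> A \<rightarrow> N \<and> diff C N (g \<cdot> x) f \<in> fac C N" if f: "f \<Colon> C \<rightarrow> N" for f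
    using extend_to_V[OF t f B N] diff_self[OF f] zero_fac[OF o(1,2)] by metis
  fix g assume g: "g \<Colon> A \<rightarrow> N" and gx: "g \<cdot> x \<in> fac C N"
  obtain M p q where M: "M \<in> W" "p \<Colon> C \<rightarrow> M" "q \<Colon> M \<rightarrow> N" "g \<cdot> x = q \<cdot> p"
    using gx o(1,2) by (rule facE)
  have "M \<in> V" using M(1) core by blast
  obtain p' where p': "p' \<Colon> A \<rightarrow> M" "p' \<cdot> x = p" by (rule extend_to_V[OF t M(2) B \<open>M \<in> V\<close>])
  have qp: "q \<cdot> p' \<Colon> A \<rightarrow> N" using arr_comp[OF p'(1) M(3)] .
  have z: "diff A N g (q \<cdot> p') \<cdot> x = zero_mor K C N"
    using diff_left[OF x g qp] assoc[OF x p'(1) M(3)] p'(2) M(4) diff_self[OF arr_comp[OF M(2,3)]] by simp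
  obtain m where m: "m \<Colon> B \<rightarrow> N" "m \<cdot> y = diff A N g (q \<cdot> p')"
    by (rule hom_exact_left[OF t arr_diff[OF g qp] z])
  have "m \<cdot> y \<in> fac A N" using fac_comp_right[OF fac_U_V[OF m(1) B N] y o(2)] .
  then have "add_mor K A N (q \<cdot> p') (diff A N g (q \<cdot> p')) \<in> fac A N"
    using fac_add[OF facI[OF M(1) p'(1) M(3)] _ o(3,2)] m(2) by simp
  then show "g \<in> fac A N" using add_diff[OF g qp] by simp
qed

lemma bij_betw_left_approximation:
  assumes t: "etriangle K A x B y C \<delta>" and A: "A \<in> V" and B: "B \<in> U" and N: "N \<in> U"
  shows "bij_betw (\<lambda>p. cls B C y \<cdot>\<^bsub>Q\<^esub> p) (Mor Q N B) (Mor Q N C)"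
proof (rule bij_betw_post_comp)
  have x: "x \<Colon> A \<rightarrow> B" and y: "y \<Colon> B \<rightarrow> C" using tri_left[OF t] tri_right[OF t] .
  show "y \<Colon> B \<rightarrow> C" "N \<in> Obj K" using y U_subset[OF N] .
  note o = U_subset[OF N] arrD(2)[OF y] arrD(1)[OF y]
  show "\<exists>g. g \<Colon> N \<rightarrow> B \<and> diff N C (y \<cdot> g) f \<in> fac N C" if f: "f \<Colon> N \<rightarrow> C" for f
    using lift_from_U[OF t f N A] diff_self[OF f] zero_fac[OF o(1,2)] by metis
  fix g assume g: "g \<Colon> N \<rightarrow> B" and yg: "y \<cdot> g \<in> fac N C"
  obtain M p q where M: "M \<in> W" "p \<Colon> N \<rightarrow> M" "q \<Colon> M \<rightarrow> C" "y \<cdot> g = q \<cdot> p"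
    using yg o(1,2) by (rule facE)
  have "M \<in> U" using M(1) core by blast
  obtain q' where q': "q' \<Colon> M \<rightarrow> B" "y \<cdot> q' = q" by (rule lift_from_U[OF t M(3) \<open>M \<in> U\<close> A])
  have qp: "q' \<cdot> p \<Colon> N \<rightarrow> B" using arr_comp[OF M(2) q'(1)] .
  have z: "y \<cdot> diff N B g (q' \<cdot> p) = zero_mor K N C"
    using diff_right[OF g qp y] assoc[OF M(2) q'(1) y] q'(2) M(4) diff_self[OF arr_comp[OF M(2,3)]] by simp
  obtain m where m: "m \<Colon> N \<rightarrow> A" "x \<cdot> m = diff N B g (q' \<cdot> p)"
    by (rule hom_exact_right[OF t arr_diff[OF g qp] z])
  have "x \<cdot> m \<in> fac N B" using fac_comp_left[OF fac_U_V[OF m(1) N A] x o(1)] .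
  then have "add_mor K N B (q' \<cdot> p) (diff N B g (q' \<cdot> p)) \<in> fac N B"
    using fac_add[OF facI[OF M(1,2) q'(1)] _ o(1,3)] m(2) by simp
  then show "g \<in> fac N B" using add_diff[OF g qp] by simp
qed

end

locale suspended_cotorsion = cotorsion +
  assumes suspension_V: "suspension K V \<subseteq> V"
begin

lemma cosyzygy:
  assumes "A \<in> V"
  obtains i I q S \<gamma> where "injective K I" "etriangle K A i I q S \<gamma>" "S \<in> V"
proof -
  obtain i I q S \<gamma> where *: "injective K I" "etriangle K A i I q S \<gamma>"
    by (rule injective_resolution[OF V_subset[OF assms]])
  then have "S \<in> V" using suspension_V assms unfolding suspension_def by blast
  then show ?thesis using that * by blast
qed

text \<open>A class in \<bbbE>(A, N) is the pullback of the class \<gamma> of a cosyzygy triangle of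
  \<open>N\<close> along some \<open>c : A \<rightarrow> S\<close>. Since \<open>S\<close> stays in
  \<open>V\<close>, \<open>c\<close> extends to \<open>B\<close>, so the class comes from \<bbbE>(B,
  N), which vanishes.\<close>

lemma U_cocone:
  assumes t: "etriangle K A x B y C \<delta>" and B: "B \<in> U" and C: "C \<in> U"
  shows "A \<in> U"
proof (rule U_I)
  have x: "x \<Colon> A \<rightarrow> B" using tri_left[OF t] .
  show "A \<in> Obj K" using arrD[OF x] by simp
  fix N \<epsilon> assume N: "N \<in> V" and e: "ext \<epsilon> A N"
  obtain i I q S \<gamma> where g: "injective K I" "etriangle K N i I q S \<gamma>" "S \<in> V"
    by (rule cosyzygy[OF N])
  have \<gamma>: "ext \<gamma> S N" using tri_ext[OF g(2)] .
  obtain c where c: "c \<Colon> A \<rightarrow> S" "pull K N c \<gamma> = \<epsilon>"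
    by (rule ext_exact_right[OF g(2) e injective_ext[OF g(1) ext_push[OF e tri_left[OF g(2)]]]])
  obtain d where d: "d \<Colon> B \<rightarrow> S" "d \<cdot> x = c" by (rule extend_to_V[OF t c(1) C g(3)])
  have "\<epsilon> = pull K N x (pull K N d \<gamma>)" using pull_comp[OF \<gamma> d(1) x] d(2) c(2) by simp
  then show "\<epsilon> = one (Ext K A N)"
    using ext_U_V[OF ext_pull[OF \<gamma> d(1)] B N] pull_one[OF x V_subset[OF N]] by simp
qed

text \<open>The obstruction to lifting lies in a second extension group from \<open>U\<close> to \<open>V\<close>, which vanishes by shifting.\<close>

lemma ext_lift:
  assumes t: "etriangle K A x B y C \<delta>" and A: "A \<in> V" and N: "N \<in> U" and e: "ext \<epsilon> N C"
  obtains \<epsilon>' where "ext \<epsilon>' N B" "push K N y \<epsilon>' = \<epsilon>"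
proof -
  have y: "y \<Colon> B \<rightarrow> C" using tri_right[OF t] .
  obtain M j P p \<kappa> where P: "projective K P" and k: "etriangle K M j P p N \<kappa>"
    by (rule projective_resolution[OF U_subset[OF N]])
  obtain a where a: "a \<Colon> M \<rightarrow> C" "push K N a \<kappa> = \<epsilon>"
    by (rule ext_exact_left[OF k e projective_ext[OF P ext_pull[OF e tri_right[OF k]]]])
  \<comment> \<open>The syzygy \<open>M\<close> lies in \<open>U\<close> because \<open>P\<close>
    and \<open>N\<close> do, so \<bbbE>(M, A) vanishes and \<open>a\<close> lifts along
    \<open>y\<close>.\<close>
  have "pull K A a \<delta> = one (Ext K M A)"
    using ext_U_V[OF ext_pull[OF tri_ext[OF t] a(1)] U_cocone[OF k projective_U[OF P] N] A] .
  then obtain b where b: "b \<Colon> M \<rightarrow> B" "y \<cdot> b = a" using pull_trivial_iff[OF t a(1)] by blast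
  have "push K N y (push K N b \<kappa>) = \<epsilon>" using push_comp[OF tri_ext[OF k] b(1) y] b(2) a(2) by simp
  then show ?thesis using that ext_push[OF tri_ext[OF k] b(1)] by blast
qed

text \<open>By \<open>ext_lift\<close> every class in \<bbbE>(N, C) with \<open>N\<close> in
  \<open>U\<close> comes from \<bbbE>(N, B), which vanishes.\<close>

lemma V_cone:
  assumes t: "etriangle K A x B y C \<delta>" and A: "A \<in> V" and B: "B \<in> V"
  shows "C \<in> V"
proof (rule V_I)
  have y: "y \<Colon> B \<rightarrow> C" using tri_right[OF t] .
  show "C \<in> Obj K" using arrD[OF y] by simp
  fix N \<epsilon> assume N: "N \<in> U" and e: "ext \<epsilon> N C"
  obtain \<epsilon>' where "ext \<epsilon>' N B" "push K N y \<epsilon>' = \<epsilon>" by (rule ext_lift[OF t A N e])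
  then show "\<epsilon> = one (Ext K N C)" using ext_U_V[OF _ N B] push_one[OF y U_subset[OF N]] by metis
qed

end


section \<open>The two recollements\<close>

locale cotorsion_triple =
  exact_realization K + ideal_quotient K W +
  ST: cotorsion K S T W + UV: suspended_cotorsion K U V W + XY: suspended_cotorsion K X Y W
  for K :: "('o, 'm, 'e) ext_category" (structure) and S T U V X Y W +
  assumes X_T: "X \<inter> T = V" and Y_T: "Y \<subseteq> T"
begin

lemma S_subset_U: "A \<in> S \<Longrightarrow> A \<in> U"
  using UV.U_I[of A] ST.ext_U_V[of _ A] ST.U_subset[of A] X_T by blast

text \<open>Injectives lie in every right-hand class, hence in \<open>V\<close> and
  \<open>Y\<close>; \<open>V \<subseteq> X\<close> then puts them in the core.\<close>

lemma injective_W: "injective K I \<Longrightarrow> I \<in> W"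
  using UV.injective_V XY.injective_V XY.core X_T by blast

lemma left_triangle_V:
  assumes t: "etriangle K A x B y C \<delta>" and "A \<in> Y" "B \<in> X" "C \<in> T"
  shows "B \<in> V"
  using ST.middle_V[OF t] assms X_T Y_T by blast

text \<open>For \<open>N\<close> in \<open>T\<close> take the triangle from \<open>Y\<close> over
  \<open>V\<close> onto \<open>N\<close>. Classes in \<bbbE>(C, N) lift to the middle term since
  \<open>C\<close> is in \<open>X\<close> and \<open>\<Sigma>Y \<subseteq> Y\<close>; there they
  vanish since \<open>C\<close> is in \<open>U\<close>.\<close>

lemma U_X_subset_S:
  assumes "C \<in> U" "C \<in> X"
  shows "C \<in> S"
proof (rule ST.U_I)
  show "C \<in> Obj K" using UV.U_subset assms by blast
  fix N \<epsilon> assume N: "N \<in> T" and e: "ext \<epsilon> C N"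
  obtain A B x y \<delta> where t: "A \<in> Y" "B \<in> X" "etriangle K A x B y N \<delta>"
    by (rule XY.left_triangle[OF ST.V_subset[OF N]])
  have B: "B \<in> V" using left_triangle_V[OF t(3,1,2) N] .
  obtain \<epsilon>' where "ext \<epsilon>' C B" "push K C y \<epsilon>' = \<epsilon>"
    by (rule XY.ext_lift[OF t(3,1) assms(2) e])
  then show "\<epsilon> = one (Ext K C N)"
    using UV.ext_U_V[OF _ assms(1) B] push_one[OF tri_right[OF t(3)] UV.U_subset[OF assms(1)]] by metis
qed

lemma right_triangle_V:
  assumes t: "etriangle K A x B y C \<delta>" and A: "A \<in> T" and B: "B \<in> Y" and C: "C \<in> X"
  shows "C \<in> V"
proof -
  have y: "y \<Colon> B \<rightarrow> C" using tri_right[OF t] .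
  have "C \<in> T"
  proof (rule ST.V_I)
    show "C \<in> Obj K" using arrD[OF y] by simp
    fix N \<epsilon> assume N: "N \<in> S" and e: "ext \<epsilon> N C"
    obtain M j P p \<kappa> where P: "projective K P" and k: "etriangle K M j P p N \<kappa>"
      by (rule projective_resolution[OF ST.U_subset[OF N]])
    have "N \<in> U" "N \<in> X"
      using S_subset_U[OF N] XY.U_I[of N] ST.ext_U_V[OF _ N] ST.U_subset[OF N] Y_T by blast+
    \<comment> \<open>Both \<open>U\<close> and \<open>X\<close> contain \<open>N\<close> and
      \<open>P\<close>, so the syzygy \<open>M\<close> stays in \<open>U \<inter> X\<close> and
      hence in \<open>S\<close>. Then \<open>a\<close> lifts along \<open>y\<close>, and \<epsilon>
      is a pushforward from \<bbbE>(N, B), which vanishes because \<open>B\<close> is in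
      \<open>T\<close>.\<close>
    then have "M \<in> S"
      using U_X_subset_S UV.U_cocone[OF k UV.projective_U[OF P]] XY.U_cocone[OF k XY.projective_U[OF P]]
      by blast
    obtain a where a: "a \<Colon> M \<rightarrow> C" "push K N a \<kappa> = \<epsilon>"
      by (rule ext_exact_left[OF k e projective_ext[OF P ext_pull[OF e tri_right[OF k]]]])
    obtain b where b: "b \<Colon> M \<rightarrow> B" "y \<cdot> b = a" by (rule ST.lift_from_U[OF t a(1) \<open>M \<in> S\<close> A])
    have "\<epsilon> = push K N y (push K N b \<kappa>)" using push_comp[OF tri_ext[OF k] b(1) y] b(2) a(2) by simp
    then show "\<epsilon> = one (Ext K N C)"
      using ST.ext_U_V[OF ext_push[OF tri_ext[OF k] b(1)] N] B Y_T push_one[OF y ST.U_subset[OF N]] by auto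
  qed
  then show ?thesis using C X_T by blast
qed

text \<open>
  For injectivity in the next two lemmas, let \<open>\<epsilon>\<close> be the class of the approximation triangle
  \<open>N \<rightarrow> D \<rightarrow> E\<close> of the source of \<open>g\<close>: then \<open>g\<close> extends to \<open>D\<close>, and hence factors through \<open>W\<close>,
  as soon as \<open>g\<^sub>*\<epsilon> = 0\<close>.
\<close>

lemma bij_betw_unit:
  assumes t: "etriangle K A m B n C \<mu>" and A: "A \<in> T" and B: "B \<in> Y" and C: "C \<in> X" and N: "N \<in> U"
  shows "bij_betw (\<lambda>p. cls A B m \<cdot>\<^bsub>Q\<^esub> p) (Mor Q N A) (Mor Q N B)"
proof (rule bij_betw_post_comp)
  have m: "m \<Colon> A \<rightarrow> B" and n: "n \<Colon> B \<rightarrow> C" using tri_left[OF t] tri_right[OF t] .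
  show "m \<Colon> A \<rightarrow> B" "N \<in> Obj K" using m UV.U_subset[OF N] .
  note o = UV.U_subset[OF N] arrD(1)[OF m] arrD(2)[OF m] arrD(2)[OF n]
  have CV: "C \<in> V" using right_triangle_V[OF t A B C] .
  show "\<exists>g. g \<Colon> N \<rightarrow> A \<and> diff N B (m \<cdot> g) f \<in> fac N B" if f: "f \<Colon> N \<rightarrow> B" for f
  proof -
    \<comment> \<open>\<open>n \<cdot> f\<close> runs from \<open>U\<close> to \<open>V\<close> and
      so factors through \<open>W\<close>. As \<open>W \<subseteq> S\<close> and \<open>A\<close> is
      in \<open>T\<close>, the factor into \<open>C\<close> lifts to \<open>B\<close>; subtracting
      the lifted composite from \<open>f\<close> changes nothing modulo \<open>W\<close> and yields
      a map that factors through \<open>m\<close>.\<close>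
    obtain M p q where M: "M \<in> W" "p \<Colon> N \<rightarrow> M" "q \<Colon> M \<rightarrow> C" "n \<cdot> f = q \<cdot> p"
      using UV.fac_U_V[OF arr_comp[OF f n] N CV] o(1,4) by (rule facE)
    have "M \<in> S" using M(1) ST.core by blast
    obtain q' where q': "q' \<Colon> M \<rightarrow> B" "n \<cdot> q' = q" by (rule ST.lift_from_U[OF t M(3) \<open>M \<in> S\<close> A])
    have qp: "q' \<cdot> p \<Colon> N \<rightarrow> B" using arr_comp[OF M(2) q'(1)] .
    have z: "n \<cdot> diff N B f (q' \<cdot> p) = zero_mor K N C"
      using diff_right[OF f qp n] assoc[OF M(2) q'(1) n] q'(2) M(4) diff_self[OF arr_comp[OF M(2,3)]] by simp
    obtain g where g: "g \<Colon> N \<rightarrow> A" "m \<cdot> g = diff N B f (q' \<cdot> p)"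
      by (rule hom_exact_right[OF t arr_diff[OF f qp] z])
    have "diff N B f (m \<cdot> g) \<in> fac N B"
      using diff_diff[OF f qp] g(2) facI[OF M(1,2) q'(1)] by simp
    then have "diff N B (m \<cdot> g) f \<in> fac N B"
      using cls_eq_iff[OF f arr_comp[OF g(1) m]] cls_eq_iff[OF arr_comp[OF g(1) m] f] by simp
    then show ?thesis using g(1) by blast
  qed
  fix g assume g: "g \<Colon> N \<rightarrow> A" and mg: "m \<cdot> g \<in> fac N B"
  obtain M p h where M: "M \<in> W" "p \<Colon> N \<rightarrow> M" "h \<Colon> M \<rightarrow> B" "m \<cdot> g = h \<cdot> p"
    using mg o(1,3) by (rule facE)
  obtain D E x y \<epsilon> where r: "D \<in> V" "E \<in> U" "etriangle K N x D y E \<epsilon>"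
    by (rule UV.right_triangle[OF o(1)])
  have e: "ext \<epsilon> E N" using tri_ext[OF r(3)] .
  have "D \<in> W" using UV.middle_U[OF r(3) N r(2)] r(1) UV.core by blast
  have "push K E p \<epsilon> = one (Ext K E M)"
    using UV.ext_U_V[OF ext_push[OF e M(2)] r(2)] M(1) UV.core by blast
  then have "push K E m (push K E g \<epsilon>) = one (Ext K E B)"
    using push_comp[OF e g m] push_comp[OF e M(2,3)] M(4) push_one[OF M(3) UV.U_subset[OF r(2)]] by simp
  \<comment> \<open>Because \<open>m\<close> kills the pushforward of \<epsilon> along
    \<open>g\<close>, that class is a pullback of \<mu>. The map \<open>a\<close> from
    \<open>U\<close> to \<open>V\<close> factors through an object of
    \<open>W \<subseteq> S\<close>, over which extensions by \<open>A\<close> vanish.\<close>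
  then obtain a where a: "a \<Colon> E \<rightarrow> C" "pull K A a \<mu> = push K E g \<epsilon>"
    using ext_exact_right[OF t ext_push[OF e g]] by metis
  obtain M' p' h' where M': "M' \<in> W" "p' \<Colon> E \<rightarrow> M'" "h' \<Colon> M' \<rightarrow> C" "a = h' \<cdot> p'"
    using UV.fac_U_V[OF a(1) r(2) CV] UV.U_subset[OF r(2)] o(4) by (rule facE)
  have \<mu>: "ext \<mu> C A" using tri_ext[OF t] .
  have "pull K A h' \<mu> = one (Ext K M' A)"
    using ST.ext_U_V[OF ext_pull[OF \<mu> M'(3)] _ A] M'(1) ST.core by blast
  then have "push K E g \<epsilon> = one (Ext K E A)"
    using pull_comp[OF \<mu> M'(3,2)] M'(4) a(2) pull_one[OF M'(2) o(2)] by simp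
  then obtain g' where "g' \<Colon> D \<rightarrow> A" "g' \<cdot> x = g" using push_trivial_iff[OF r(3) g] by blast
  then show "g \<in> fac N A" using facI[OF \<open>D \<in> W\<close> tri_left[OF r(3)]] by blast
qed

lemma bij_betw_counit:
  assumes t: "etriangle K A v B u C \<delta>" and A: "A \<in> V" and B: "B \<in> U" and C: "C \<in> T" and N: "N \<in> Y"
  shows "bij_betw (\<lambda>p. p \<cdot>\<^bsub>Q\<^esub> cls B C u) (Mor Q C N) (Mor Q B N)"
proof (rule bij_betw_pre_comp)
  have v: "v \<Colon> A \<rightarrow> B" and u: "u \<Colon> B \<rightarrow> C" using tri_left[OF t] tri_right[OF t] .
  show "u \<Colon> B \<rightarrow> C" "N \<in> Obj K" using u XY.V_subset[OF N] .
  note o = XY.V_subset[OF N] arrD(1)[OF u] arrD(2)[OF u]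
  show "\<exists>g. g \<Colon> C \<rightarrow> N \<and> diff B N (g \<cdot> u) f \<in> fac B N" if f: "f \<Colon> B \<rightarrow> N" for f
  proof -
    \<comment> \<open>\<open>f\<close> must be corrected so as to kill \<open>v\<close>. The
      cosyzygy \<open>D\<close> of \<open>A\<close> lies in \<open>V \<subseteq> X\<close>, so
      \<open>f \<cdot> v\<close> extends to the injective \<open>I\<close>, and \<open>i\<close>
      extends to \<open>B\<close>; the correction \<open>h \<cdot> b\<close> passes through
      \<open>I\<close>, an object of \<open>W\<close>.\<close>
    obtain i I q D \<gamma> where I: "injective K I" "etriangle K A i I q D \<gamma>" "D \<in> V"
      by (rule UV.cosyzygy[OF A])
    have "D \<in> X" using I(3) X_T by blast
    obtain h where h: "h \<Colon> I \<rightarrow> N" "h \<cdot> i = f \<cdot> v"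
      by (rule XY.extend_to_V[OF I(2) arr_comp[OF v f] \<open>D \<in> X\<close> N])
    obtain b where b: "b \<Colon> B \<rightarrow> I" "b \<cdot> v = i" by (rule injective_extend[OF I(1) t tri_left[OF I(2)]])
    have hb: "h \<cdot> b \<Colon> B \<rightarrow> N" using arr_comp[OF b(1) h(1)] .
    have z: "diff B N f (h \<cdot> b) \<cdot> v = zero_mor K A N"
      using diff_left[OF v f hb] assoc[OF v b(1) h(1)] b(2) h(2) diff_self[OF arr_comp[OF v f]] by simp
    obtain g where g: "g \<Colon> C \<rightarrow> N" "g \<cdot> u = diff B N f (h \<cdot> b)"
      by (rule hom_exact_left[OF t arr_diff[OF f hb] z])
    have "diff B N f (g \<cdot> u) \<in> fac B N"
      using diff_diff[OF f hb] g(2) facI[OF injective_W[OF I(1)] b(1) h(1)] by simp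
    then have "diff B N (g \<cdot> u) f \<in> fac B N"
      using cls_eq_iff[OF f arr_comp[OF u g(1)]] cls_eq_iff[OF arr_comp[OF u g(1)] f] by simp
    then show ?thesis using g(1) by blast
  qed
  fix g assume g: "g \<Colon> C \<rightarrow> N" and gu: "g \<cdot> u \<in> fac B N"
  obtain M p h where M: "M \<in> W" "p \<Colon> B \<rightarrow> M" "h \<Colon> M \<rightarrow> N" "g \<cdot> u = h \<cdot> p"
    using gu o(2,1) by (rule facE)
  obtain D E x y \<epsilon> where r: "D \<in> V" "E \<in> U" "etriangle K C x D y E \<epsilon>"
    by (rule UV.right_triangle[OF o(3)])
  \<comment> \<open>Lifting \<epsilon> along \<open>u\<close> turns its pushforward along
    \<open>g\<close> into one along \<open>g \<cdot> u\<close>, which vanishes because that map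
    passes through \<open>W \<subseteq> V\<close>.\<close>
  obtain \<epsilon>' where e: "ext \<epsilon>' E B" "push K E u \<epsilon>' = \<epsilon>" by (rule UV.ext_lift[OF t A r(2) tri_ext[OF r(3)]])
  have "push K E p \<epsilon>' = one (Ext K E M)"
    using UV.ext_U_V[OF ext_push[OF e(1) M(2)] r(2)] M(1) UV.core by blast
  then have "push K E g \<epsilon> = one (Ext K E N)"
    using push_comp[OF e(1) u g] push_comp[OF e(1) M(2,3)] M(4) e(2) push_one[OF M(3) UV.U_subset[OF r(2)]]
    by simp
  then obtain g' where g': "g' \<Colon> D \<rightarrow> N" "g' \<cdot> x = g" using push_trivial_iff[OF r(3) g] by blast
  \<comment> \<open>Here the middle term \<open>D\<close> need not lie in \<open>W\<close>, but it
    is in \<open>V \<subseteq> X\<close>, and every map from \<open>X\<close> to \<open>Y\<close>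
    factors through the common core.\<close>
  have "g' \<in> fac D N" using XY.fac_U_V[OF g'(1) _ N] r(1) X_T by blast
  then show "g \<in> fac C N" using fac_comp_right[OF _ tri_left[OF r(3)] o(1)] g'(2) by blast
qed

text \<open>Given \<open>B\<close> in \<open>U\<close>, membership in \<open>W\<close> means
  membership in \<open>V\<close>, and \<open>V\<close> is closed under extensions and under
  cones.\<close>

lemma left_kernel:
  assumes t: "etriangle K A x B y C \<delta>" and A: "A \<in> V" and B: "B \<in> U"
  shows "B \<in> W \<longleftrightarrow> C \<in> V"
  using UV.V_cone[OF t A] UV.middle_V[OF t A] B UV.core by blast

text \<open>Given \<open>A\<close> in \<open>Y\<close>, membership in \<open>W\<close> means
  membership in \<open>X\<close>, which passes between \<open>A\<close> and \<open>C\<close> since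
  \<open>B\<close> is in \<open>X\<close>; for \<open>C\<close> in \<open>T\<close>, lying in
  \<open>X\<close> means lying in \<open>V\<close>.\<close>

lemma right_kernel:
  assumes t: "etriangle K C x A y B \<delta>" and A: "A \<in> Y" and B: "B \<in> X" and C: "C \<in> T"
  shows "A \<in> W \<longleftrightarrow> C \<in> V"
  using XY.U_cocone[OF t _ B] XY.middle_U[OF t _ B] A C XY.core X_T by blast

lemma zero_object_sub_quotient:
  assumes "A \<in> T"
  shows "zero_object (sub_quotient K T W) A \<longleftrightarrow> A \<in> W"
proof -
  interpret Q: preadditive_category Q by (rule preadditive_quotient)
  interpret L: additive_category "sub_quotient K T W"
    using additive_sub_quotient ST.additive_V by blast
  have "zero_object (sub_quotient K T W) A \<longleftrightarrow> zero_object Q A"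
    unfolding L.zero_object_iff Q.zero_object_iff using assms ST.V_subset by (auto simp: sub_quotient_def)
  then show ?thesis using ST.zero_object_Q_iff ST.V_subset assms by blast
qed

lemma sub_quotient_simps:
  "Obj (sub_quotient K D W) = D" "Hom (sub_quotient K D W) = Hom Q" "Comp (sub_quotient K D W) = Comp Q"
  by (simp_all add: sub_quotient_def full_subcategory_def)

lemma recollements:
  "\<exists>F Fl Fr G Gl Gr G' G'l G'r.
    recollement (sub_quotient K V W) (sub_quotient K T W) (sub_quotient K (T \<inter> U) W) F G \<and>
    recollement (sub_quotient K V W) (sub_quotient K T W) (sub_quotient K Y W) F G' \<and>
    adjoint (sub_quotient K T W) (sub_quotient K V W) Fl F \<and>
    adjoint (sub_quotient K V W) (sub_quotient K T W) F Fr \<and>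
    adjoint (sub_quotient K (T \<inter> U) W) (sub_quotient K T W) Gl G \<and>
    adjoint (sub_quotient K T W) (sub_quotient K (T \<inter> U) W) G Gr \<and>
    adjoint (sub_quotient K Y W) (sub_quotient K T W) G'l G' \<and>
    adjoint (sub_quotient K T W) (sub_quotient K Y W) G' G'r \<and>
    F = inclusion \<and> Gl = inclusion \<and> G'r = inclusion"
proof -
  \<comment> \<open>Approximations are chosen object by object: \<open>r\<close> yields
    \<open>G\<close>, \<open>s\<close> yields \<open>G'\<close>, and \<open>p\<close> and
    \<open>q\<close> yield the right and left adjoints of \<open>F\<close>.\<close>
  have "\<forall>C \<in> T. \<exists>A B x y \<delta>. A \<in> V \<and> B \<in> U \<and> etriangle K A x B y C \<delta>"
    using UV.left_triangle ST.V_subset by metis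
  then obtain rA r rx ry rd
    where r: "\<And>C. C \<in> T \<Longrightarrow> rA C \<in> V \<and> r C \<in> U \<and> etriangle K (rA C) (rx C) (r C) (ry C) C (rd C)"
    by metis
  have "\<forall>C \<in> T. \<exists>A B x y \<delta>. A \<in> Y \<and> B \<in> X \<and> etriangle K C x A y B \<delta>"
    using XY.right_triangle ST.V_subset by metis
  then obtain s sB sx sy sd
    where s: "\<And>C. C \<in> T \<Longrightarrow> s C \<in> Y \<and> sB C \<in> X \<and> etriangle K C (sx C) (s C) (sy C) (sB C) (sd C)"
    by metis
  have "\<forall>C \<in> T. \<exists>A B x y \<delta>. A \<in> Y \<and> B \<in> X \<and> etriangle K A x B y C \<delta>"
    using XY.left_triangle ST.V_subset by metis
  then obtain pA p px py pd
    where p: "\<And>C. C \<in> T \<Longrightarrow> pA C \<in> Y \<and> p C \<in> X \<and> etriangle K (pA C) (px C) (p C) (py C) C (pd C)"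
    by metis
  have "\<forall>C \<in> T. \<exists>A B x y \<delta>. A \<in> V \<and> B \<in> U \<and> etriangle K C x A y B \<delta>"
    using UV.right_triangle ST.V_subset by metis
  then obtain q qB qx qy qd
    where q: "\<And>C. C \<in> T \<Longrightarrow> q C \<in> V \<and> qB C \<in> U \<and> etriangle K C (qx C) (q C) (qy C) (qB C) (qd C)"
    by metis
  have rT: "r C \<in> T" if "C \<in> T" for C
    using ST.middle_V r[OF that] that X_T by blast
  have pV: "p C \<in> V" if "C \<in> T" for C
    using left_triangle_V p[OF that] that by blast
  let ?L = "sub_quotient K T W"
  have full: "full_subcategory ?L D = sub_quotient K D W" for D
    by (simp add: sub_quotient_def)
  have data: "recollement_data ?L V (T \<inter> U) Y r (\<lambda>C. cls (r C) C (ry C)) s (\<lambda>C. cls C (s C) (sx C))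
    p (\<lambda>C. cls (p C) C (py C)) q (\<lambda>C. cls C (q C) (qx C))"
  proof (intro recollement_data.intro recollement_data_axioms.intro; (unfold full)?)
    show "additive_category ?L" "additive_category (sub_quotient K V W)"
      "additive_category (sub_quotient K (T \<inter> U) W)" "additive_category (sub_quotient K Y W)"
      using additive_sub_quotient ST.additive_V UV.additive_V XY.additive_V UV.additive_subcategory_Int_U
      by blast+
    show "coreflection ?L (T \<inter> U) r (\<lambda>C. cls (r C) C (ry C))"
      unfolding coreflection_def sub_quotient_simps
    proof (intro conjI ballI)
      fix C N assume C: "C \<in> T"
      then have t: "rA C \<in> V" "r C \<in> U" "r C \<in> T"
        "etriangle K (rA C) (rx C) (r C) (ry C) C (rd C)"
        using r rT by auto
      show "r C \<in> T \<inter> U" using t by blast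
      show "cls (r C) C (ry C) \<in> Mor Q (r C) C" using cls_closed tri_right t(4) by blast
      assume "N \<in> T \<inter> U"
      then show "bij_betw (\<lambda>g. cls (r C) C (ry C) \<cdot>\<^bsub>Q\<^esub> g) (Mor Q N (r C)) (Mor Q N C)"
        using UV.bij_betw_left_approximation[OF t(4)] t X_T by blast
    qed (use X_T in blast)
    show "reflection ?L Y s (\<lambda>C. cls C (s C) (sx C))"
      unfolding reflection_def sub_quotient_simps
    proof (intro conjI ballI)
      fix C N assume C: "C \<in> T"
      then have t: "s C \<in> Y" "sB C \<in> X"
        "etriangle K C (sx C) (s C) (sy C) (sB C) (sd C)"
        using s by auto
      show "s C \<in> Y" using t by blast
      show "cls C (s C) (sx C) \<in> Mor Q C (s C)" using cls_closed tri_left t(3) by blast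
      assume "N \<in> Y"
      then show "bij_betw (\<lambda>g. g \<cdot>\<^bsub>Q\<^esub> cls C (s C) (sx C)) (Mor Q (s C) N) (Mor Q C N)"
        using XY.bij_betw_right_approximation[OF t(3)] t by blast
    qed (use X_T Y_T in blast)
    show "coreflection ?L V p (\<lambda>C. cls (p C) C (py C))"
      unfolding coreflection_def sub_quotient_simps
    proof (intro conjI ballI)
      fix C N assume C: "C \<in> T"
      then have t: "pA C \<in> Y" "p C \<in> X" "p C \<in> V"
        "etriangle K (pA C) (px C) (p C) (py C) C (pd C)"
        using p pV by auto
      show "p C \<in> V" using t by blast
      show "cls (p C) C (py C) \<in> Mor Q (p C) C" using cls_closed tri_right t(4) by blast
      assume "N \<in> V"
      then show "bij_betw (\<lambda>g. cls (p C) C (py C) \<cdot>\<^bsub>Q\<^esub> g) (Mor Q N (p C)) (Mor Q N C)"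
        using XY.bij_betw_left_approximation[OF t(4)] t X_T by blast
    qed (use X_T in blast)
    show "reflection ?L V q (\<lambda>C. cls C (q C) (qx C))"
      unfolding reflection_def sub_quotient_simps
    proof (intro conjI ballI)
      fix C N assume C: "C \<in> T"
      then have t: "q C \<in> V" "qB C \<in> U"
        "etriangle K C (qx C) (q C) (qy C) (qB C) (qd C)"
        using q by auto
      show "q C \<in> V" using t by blast
      show "cls C (q C) (qx C) \<in> Mor Q C (q C)" using cls_closed tri_left t(3) by blast
      assume "N \<in> V"
      then show "bij_betw (\<lambda>g. g \<cdot>\<^bsub>Q\<^esub> cls C (q C) (qx C)) (Mor Q (q C) N) (Mor Q C N)"
        using UV.bij_betw_right_approximation[OF t(3)] t by blast
    qed (use X_T Y_T in blast)
    show "bij_betw (\<lambda>g. cls A (s A) (sx A) \<cdot>\<^bsub>?L\<^esub> g) (Mor ?L N A) (Mor ?L N (s A))"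
      if "N \<in> T \<inter> U" "A \<in> Obj ?L" for N A
      using that s[of A] bij_betw_unit unfolding sub_quotient_simps by blast
    show "bij_betw (\<lambda>g. g \<cdot>\<^bsub>?L\<^esub> cls (r A) A (ry A)) (Mor ?L A N) (Mor ?L (r A) N)"
      if "N \<in> Y" "A \<in> Obj ?L" for N A
      using that r[of A] bij_betw_counit unfolding sub_quotient_simps by blast
    show "zero_object ?L (r A) \<longleftrightarrow> A \<in> V" if "A \<in> Obj ?L" for A
      using that r[of A] rT[of A] left_kernel zero_object_sub_quotient unfolding sub_quotient_simps by blast
    show "zero_object ?L (s A) \<longleftrightarrow> A \<in> V" if "A \<in> Obj ?L" for A
      using that s[of A] Y_T right_kernel zero_object_sub_quotient unfolding sub_quotient_simps by blast
  qed
  show ?thesis using recollement_data.two_recollements[OF data] unfolding full .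
qed

end

theorem theorem1p1:
  fixes K :: "('o, 'm, 'e) ext_category"
    and \<S> \<T> \<U> \<V> \<X> \<Y> \<W> :: "'o set"
  assumes "extriangulated_category K"
    and "enough_projectives K" and "enough_injectives K"
    and "cotorsion_pair K \<S> \<T>" and "cotorsion_pair K \<U> \<V>" and "cotorsion_pair K \<X> \<Y>"
    and "\<W> = \<S> \<inter> \<T>" and "\<W> = \<U> \<inter> \<V>" and "\<W> = \<X> \<inter> \<Y>"
    and "\<X> \<inter> \<T> = \<V>" and "\<Y> \<subseteq> \<T>"
    and "suspension K \<V> \<subseteq> \<V>" and "suspension K \<Y> \<subseteq> \<Y>"
  defines "VW \<equiv> sub_quotient K \<V> \<W>"
    and "TW \<equiv> sub_quotient K \<T> \<W>"
    and "TUW \<equiv> sub_quotient K (\<T> \<inter> \<U>) \<W>"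
    and "YW \<equiv> sub_quotient K \<Y> \<W>"
  shows "\<exists>F Fl Fr G Gl Gr G' G'l G'r.
    recollement VW TW TUW F G \<and> recollement VW TW YW F G' \<and>
    adjoint TW VW Fl F \<and> adjoint VW TW F Fr \<and>
    adjoint TUW TW Gl G \<and> adjoint TW TUW G Gr \<and>
    adjoint YW TW G'l G' \<and> adjoint TW YW G' G'r \<and>
    F = inclusion \<and> Gl = inclusion \<and> G'r = inclusion"
proof -
  interpret exact_realization K using exact_realizationI assms(1-3) .
  interpret ST: cotorsion K \<S> \<T> \<W> using assms by unfold_locales
  interpret UV: suspended_cotorsion K \<U> \<V> \<W> using assms by unfold_locales
  interpret XY: suspended_cotorsion K \<X> \<Y> \<W> using assms by unfold_locales
  interpret cotorsion_triple K \<S> \<T> \<U> \<V> \<X> \<Y> \<W>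
    using assms by unfold_locales
  show ?thesis unfolding VW_def TW_def TUW_def YW_def by (rule recollements)
qed

end
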